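(* Let $S$ be a separable operator system, let $X$ be a standard Borel space, let $\{H_x:x\in X\}$ be a standard Hilbert bundle (a Borel family of separable Hilbert spaces) over $X$, let $\{\phi_x:S\to\mathcal B(H_x):x\in X\}$ be a family of UCP maps, and let $\mu$ be a probability measure on $X$. Let $$H=\int_X^\oplus H_x\,d\mu(x)$$ be the direct integral of Hilbert spaces and let $\phi:S\to\mathcal B(H)$ be the direct integral of UCP maps $$\phi(s)=\int_X^\oplus\phi_x(s)\,d\mu(x),\qquad s\in S.$$ If $\phi$ has the unique extension property, then there is a Borel set $N\subseteq X$ with $\mu(N)=0$ such that $\phi_x:S\to\mathcal B(H_x)$ has the unique extension property for every $x\in X\setminus N$.
   Context: An operator system is a self-adjoint linear subspace $S$ of a unital $C^*$-algebra containing the unit; the $C^*$-algebra is assumed to be generated by $S$ and is written $C^*(S)$. A UCP map is a unital completely positive map. A UCP map $\phi:S\to\mathcal B(H)$ has the unique extension property if (i) $\phi$ has a unique completely positive extension $\tilde\phi:C^*(S)\to\mathcal B(H)$, and (ii) $\tilde\phi$ is a representation of $C^*(S)$ on $H$. Standard Hilbert bundle: a standard Borel space $H_{\rm tot}$ with a surjective Borel map $p:H_{\rm tot}\to X$ such that each fiber $H_x=p^{-1}(x)$ is a separable Hilbert space (assumed nonzero for convenience), vector addition and inner product are Borel on $\{(\xi,\eta):p(\xi)=p(\eta)\}$, scalar multiplication $\mathbb C\times H_{\rm tot}\to H_{\rm tot}$ is Borel, and there is a sequence of Borel sections $\xi_n:x\in X\mapsto\xi_n(x)\in H_x$ such that $H_x$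 is the closed linear span of $\{\xi_1(x),\xi_2(x),\dots\}$ for every $x\in X$. A family of UCP maps $\{\phi_x:S\to\mathcal B(H_x):x\in X\}$ is a collection of UCP maps $\phi_x$ such that for every pair of Borel sections $\xi,\eta$ of the bundle and every $s\in S$, the function $x\mapsto\langle\phi_x(s)\xi(x),\eta(x)\rangle$ is Borel on $X$. The direct integral $\int_X^\oplus H_x\,d\mu(x)$ is the Hilbert space of square-integrable Borel sections modulo equality $\mu$-a.e., and $\int_X^\oplus\phi_x(s)\,d\mu(x)$ is the decomposable operator $\xi\mapsto(x\mapsto\phi_x(s)\xi(x))$. *)

theory Defs
  imports "HOL-Probability.Probability"
begin

section \<open>C*-algebras and operator systems\<close>

class unital_cstar_algebra = real_normed_algebra_1 + banach +
  fixes scaleC :: "complex \<Rightarrow> 'a \<Rightarrow> 'a"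
    and star :: "'a \<Rightarrow> 'a"
  assumes scaleC_add_right: "scaleC c (x + y) = scaleC c x + scaleC c y"
    and scaleC_add_left: "scaleC (c + d) x = scaleC c x + scaleC d x"
    and scaleC_scaleC: "scaleC c (scaleC d x) = scaleC (c * d) x"
    and scaleR_eq_scaleC: "scaleR r x = scaleC (complex_of_real r) x"
    and scaleC_mult_left: "scaleC c x * y = scaleC c (x * y)"
    and scaleC_mult_right: "x * scaleC c y = scaleC c (x * y)"
    and norm_scaleC: "norm (scaleC c x) = cmod c * norm x"
    and star_star: "star (star x) = x"
    and star_add: "star (x + y) = star x + star y"
    and star_scaleC: "star (scaleC c x) = scaleC (cnj c) (star x)"
    and star_mult: "star (x * y) = star y * star x"
    and cstar_identity: "norm (star x * x) = (norm x)\<^sup>2"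

definition cstar_subalgebra :: "'a::unital_cstar_algebra set \<Rightarrow> bool" where
  "cstar_subalgebra B \<longleftrightarrow> module.subspace scaleC B \<and> closed B \<and>
     (\<forall>x\<in>B. \<forall>y\<in>B. x * y \<in> B) \<and> (\<forall>x\<in>B. star x \<in> B)"

definition cstar_generated :: "'a::unital_cstar_algebra set \<Rightarrow> 'a set" where
  "cstar_generated S = \<Inter>{B. cstar_subalgebra B \<and> S \<subseteq> B}"

text \<open>The ambient C*-algebra is the whole type, and it is required to be generated by \<open>S\<close>;
  hence \<open>UNIV\<close> plays the role of \<open>C*(S)\<close> in everything that follows.\<close>

definition operator_system :: "'a::unital_cstar_algebra set \<Rightarrow> bool" where
  "operator_system S \<longleftrightarrow> module.subspace scaleC S \<and> (\<forall>x\<in>S. star x \<in> S) \<and> 1 \<in> S \<and>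
     cstar_generated S = UNIV"

definition separable_operator_system :: "'a::unital_cstar_algebra set \<Rightarrow> bool" where
  "separable_operator_system S \<longleftrightarrow> operator_system S \<and> separable_space (top_of_set S)"

text \<open>An \<open>n\<close> by \<open>n\<close> matrix over the algebra is a function \<open>nat \<Rightarrow> nat \<Rightarrow> 'a\<close> whose entries with
  indices below \<open>n\<close> are the relevant ones. Positivity of \<open>a\<close> in the C*-algebra of such matrices
  means \<open>a = b* b\<close> for some matrix \<open>b\<close>.\<close>

definition positive_matrix :: "nat \<Rightarrow> (nat \<Rightarrow> nat \<Rightarrow> 'a::unital_cstar_algebra) \<Rightarrow> bool" where
  "positive_matrix n a \<longleftrightarrow>
     (\<exists>b. \<forall>i<n. \<forall>j<n. a i j = (\<Sum>k<n. star (b k i) * b k j))"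

section \<open>Complex Hilbert spaces with an explicit carrier\<close>

record 'v hilbert =
  hcarrier :: "'v set"
  hzero :: 'v
  hadd :: "'v \<Rightarrow> 'v \<Rightarrow> 'v"
  hscale :: "complex \<Rightarrow> 'v \<Rightarrow> 'v"
  hip :: "'v \<Rightarrow> 'v \<Rightarrow> complex"

definition hnorm :: "'v hilbert \<Rightarrow> 'v \<Rightarrow> real" where
  "hnorm H v = sqrt (Re (hip H v v))"

text \<open>The library's \<open>Metric_space\<close> requires symmetry and nonnegativity of the distance
  on the whole type, so it is set to \<open>0\<close> off the carrier.\<close>

definition hdist :: "'v hilbert \<Rightarrow> 'v \<Rightarrow> 'v \<Rightarrow> real" where
  "hdist H v w =
     (if v \<in> hcarrier H \<and> w \<in> hcarrier H then hnorm H (hadd H v (hscale H (-1) w)) else 0)"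

abbreviation htopology :: "'v hilbert \<Rightarrow> 'v topology" where
  "htopology H \<equiv> Metric_space.mtopology (hcarrier H) (hdist H)"

locale hilbert_space =
  fixes H :: "'v hilbert"
  assumes zero_closed: "hzero H \<in> hcarrier H"
    and add_closed: "\<lbrakk>v \<in> hcarrier H; w \<in> hcarrier H\<rbrakk> \<Longrightarrow> hadd H v w \<in> hcarrier H"
    and scale_closed: "v \<in> hcarrier H \<Longrightarrow> hscale H c v \<in> hcarrier H"
    and add_assoc: "\<lbrakk>u \<in> hcarrier H; v \<in> hcarrier H; w \<in> hcarrier H\<rbrakk> \<Longrightarrow>
          hadd H (hadd H u v) w = hadd H u (hadd H v w)"
    and add_commute: "\<lbrakk>v \<in> hcarrier H; w \<in> hcarrier H\<rbrakk> \<Longrightarrow> hadd H v w = hadd H w v"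
    and add_zero: "v \<in> hcarrier H \<Longrightarrow> hadd H (hzero H) v = v"
    and add_inverse: "v \<in> hcarrier H \<Longrightarrow> hadd H v (hscale H (-1) v) = hzero H"
    and scale_add_right: "\<lbrakk>v \<in> hcarrier H; w \<in> hcarrier H\<rbrakk> \<Longrightarrow>
          hscale H c (hadd H v w) = hadd H (hscale H c v) (hscale H c w)"
    and scale_add_left: "v \<in> hcarrier H \<Longrightarrow>
          hscale H (c + d) v = hadd H (hscale H c v) (hscale H d v)"
    and scale_scale: "v \<in> hcarrier H \<Longrightarrow> hscale H c (hscale H d v) = hscale H (c * d) v"
    and scale_one: "v \<in> hcarrier H \<Longrightarrow> hscale H 1 v = v"
    and ip_add_left: "\<lbrakk>u \<in> hcarrier H; v \<in> hcarrier H; w \<in> hcarrier H\<rbrakk> \<Longrightarrow>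
          hip H (hadd H u v) w = hip H u w + hip H v w"
    and ip_scale_left: "\<lbrakk>v \<in> hcarrier H; w \<in> hcarrier H\<rbrakk> \<Longrightarrow>
          hip H (hscale H c v) w = c * hip H v w"
    and ip_commute: "\<lbrakk>v \<in> hcarrier H; w \<in> hcarrier H\<rbrakk> \<Longrightarrow> hip H w v = cnj (hip H v w)"
    and ip_nonneg: "v \<in> hcarrier H \<Longrightarrow> hip H v v \<in> \<real>\<^sub>\<ge>\<^sub>0"
    and ip_definite: "\<lbrakk>v \<in> hcarrier H; hip H v v = 0\<rbrakk> \<Longrightarrow> v = hzero H"
    and complete: "Metric_space.mcomplete (hcarrier H) (hdist H)"

definition hsubspace :: "'v hilbert \<Rightarrow> 'v set \<Rightarrow> bool" where
  "hsubspace H V \<longleftrightarrow> V \<subseteq> hcarrier H \<and> hzero H \<in> V \<and>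
     (\<forall>v\<in>V. \<forall>w\<in>V. hadd H v w \<in> V) \<and> (\<forall>c. \<forall>v\<in>V. hscale H c v \<in> V)"

definition hclosed_span :: "'v hilbert \<Rightarrow> 'v set \<Rightarrow> 'v set" where
  "hclosed_span H A = htopology H closure_of \<Inter>{V. hsubspace H V \<and> A \<subseteq> V}"

text \<open>Bounded operators are functions that are \<open>undefined\<close> off the carrier, so that equality
  of operators is equality of functions.\<close>

definition bounded_operators :: "'v hilbert \<Rightarrow> ('v \<Rightarrow> 'v) set" where
  "bounded_operators H = {T \<in> hcarrier H \<rightarrow>\<^sub>E hcarrier H.
     (\<forall>v\<in>hcarrier H. \<forall>w\<in>hcarrier H. T (hadd H v w) = hadd H (T v) (T w)) \<and>
     (\<forall>c. \<forall>v\<in>hcarrier H. T (hscale H c v) = hscale H c (T v)) \<and>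
     (\<exists>K. \<forall>v\<in>hcarrier H. hnorm H (T v) \<le> K * hnorm H v)}"

section \<open>Completely positive maps and the unique extension property\<close>

definition operator_linear_on ::
    "'a::unital_cstar_algebra set \<Rightarrow> 'v hilbert \<Rightarrow> ('a \<Rightarrow> 'v \<Rightarrow> 'v) \<Rightarrow> bool" where
  "operator_linear_on D H \<psi> \<longleftrightarrow> \<psi> \<in> D \<rightarrow> bounded_operators H \<and>
     (\<forall>a\<in>D. \<forall>b\<in>D. \<forall>v\<in>hcarrier H. \<psi> (a + b) v = hadd H (\<psi> a v) (\<psi> b v)) \<and>
     (\<forall>c. \<forall>a\<in>D. \<forall>v\<in>hcarrier H. \<psi> (scaleC c a) v = hscale H c (\<psi> a v))"

text \<open>The amplification of \<open>\<psi>\<close> sends a positive matrix \<open>a\<close> with entries in \<open>D\<close> to the matrix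
  of operators \<open>\<psi> (a i j)\<close>; its positivity as an operator on the \<open>n\<close>-fold direct sum of \<open>H\<close> is
  the nonnegativity of the quadratic form below.\<close>

definition cp_map ::
    "'a::unital_cstar_algebra set \<Rightarrow> 'v hilbert \<Rightarrow> ('a \<Rightarrow> 'v \<Rightarrow> 'v) \<Rightarrow> bool" where
  "cp_map D H \<psi> \<longleftrightarrow> operator_linear_on D H \<psi> \<and>
     (\<forall>n a. (\<forall>i<n. \<forall>j<n. a i j \<in> D) \<and> positive_matrix n a \<longrightarrow>
        (\<forall>v. (\<forall>i<n. v i \<in> hcarrier H) \<longrightarrow>
           (\<Sum>i<n. \<Sum>j<n. hip H (\<psi> (a i j) (v j)) (v i)) \<in> \<real>\<^sub>\<ge>\<^sub>0))"

definition ucp_map ::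
    "'a::unital_cstar_algebra set \<Rightarrow> 'v hilbert \<Rightarrow> ('a \<Rightarrow> 'v \<Rightarrow> 'v) \<Rightarrow> bool" where
  "ucp_map S H \<phi> \<longleftrightarrow> cp_map S H \<phi> \<and> \<phi> 1 = (\<lambda>v\<in>hcarrier H. v)"

definition representation :: "'v hilbert \<Rightarrow> ('a::unital_cstar_algebra \<Rightarrow> 'v \<Rightarrow> 'v) \<Rightarrow> bool" where
  "representation H \<pi> \<longleftrightarrow> operator_linear_on UNIV H \<pi> \<and>
     \<pi> 1 = (\<lambda>v\<in>hcarrier H. v) \<and>
     (\<forall>a b. \<forall>v\<in>hcarrier H. \<pi> (a * b) v = \<pi> a (\<pi> b v)) \<and>
     (\<forall>a. \<forall>v\<in>hcarrier H. \<forall>w\<in>hcarrier H. hip H (\<pi> (star a) v) w = hip H v (\<pi> a w))"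

definition cp_extension ::
    "'a::unital_cstar_algebra set \<Rightarrow> 'v hilbert \<Rightarrow> ('a \<Rightarrow> 'v \<Rightarrow> 'v) \<Rightarrow> ('a \<Rightarrow> 'v \<Rightarrow> 'v) \<Rightarrow> bool" where
  "cp_extension S H \<phi> \<psi> \<longleftrightarrow> cp_map UNIV H \<psi> \<and> (\<forall>s\<in>S. \<psi> s = \<phi> s)"

definition unique_extension_property ::
    "'a::unital_cstar_algebra set \<Rightarrow> 'v hilbert \<Rightarrow> ('a \<Rightarrow> 'v \<Rightarrow> 'v) \<Rightarrow> bool" where
  "unique_extension_property S H \<phi> \<longleftrightarrow>
     (\<exists>!\<psi>. cp_extension S H \<phi> \<psi>) \<and> representation H (THE \<psi>. cp_extension S H \<phi> \<psi>)"

section \<open>Standard Hilbert bundles\<close>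

definition standard_borel_space :: "'x measure \<Rightarrow> bool" where
  "standard_borel_space X \<longleftrightarrow>
     (\<exists>T. completely_metrizable_space T \<and> separable_space T \<and> topspace T = space X \<and>
        sets X = sigma_sets (topspace T) {U. openin T U})"

text \<open>Only the measurable structure of \<open>btotal\<close> matters. The operations \<open>badd\<close> and \<open>bip\<close> are
  meaningful for pairs of points in the same fiber.\<close>

record ('x, 'h) hilbert_bundle =
  btotal :: "'h measure"
  bproj :: "'h \<Rightarrow> 'x"
  bzero :: "'x \<Rightarrow> 'h"
  badd :: "'h \<Rightarrow> 'h \<Rightarrow> 'h"
  bscale :: "complex \<Rightarrow> 'h \<Rightarrow> 'h"
  bip :: "'h \<Rightarrow> 'h \<Rightarrow> complex"

definition fiber :: "('x, 'h) hilbert_bundle \<Rightarrow> 'x \<Rightarrow> 'h hilbert" where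
  "fiber B x = \<lparr>hcarrier = {h \<in> space (btotal B). bproj B h = x}, hzero = bzero B x,
     hadd = badd B, hscale = bscale B, hip = bip B\<rparr>"

definition borel_sections :: "'x measure \<Rightarrow> ('x, 'h) hilbert_bundle \<Rightarrow> ('x \<Rightarrow> 'h) set" where
  "borel_sections X B = {\<xi> \<in> X \<rightarrow>\<^sub>M btotal B. \<forall>x\<in>space X. bproj B (\<xi> x) = x}"

definition same_fiber_pairs :: "('x, 'h) hilbert_bundle \<Rightarrow> ('h \<times> 'h) measure" where
  "same_fiber_pairs B =
     restrict_space (btotal B \<Otimes>\<^sub>M btotal B) {(h, k). bproj B h = bproj B k}"

locale standard_hilbert_bundle =
  fixes X :: "'x measure" and B :: "('x, 'h) hilbert_bundle"
  assumes standard_borel_total: "standard_borel_space (btotal B)"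
    and proj_measurable: "bproj B \<in> btotal B \<rightarrow>\<^sub>M X"
    and proj_surj: "bproj B ` space (btotal B) = space X"
    and fiber_hilbert: "x \<in> space X \<Longrightarrow> hilbert_space (fiber B x)"
    and fiber_separable: "x \<in> space X \<Longrightarrow> separable_space (htopology (fiber B x))"
    and fiber_nonzero: "x \<in> space X \<Longrightarrow> hcarrier (fiber B x) \<noteq> {hzero (fiber B x)}"
    and add_measurable: "(\<lambda>(h, k). badd B h k) \<in> same_fiber_pairs B \<rightarrow>\<^sub>M btotal B"
    and ip_measurable: "(\<lambda>(h, k). bip B h k) \<in> same_fiber_pairs B \<rightarrow>\<^sub>M borel"
    and scale_measurable:
          "(\<lambda>(c, h). bscale B c h) \<in> (borel :: complex measure) \<Otimes>\<^sub>M btotal B \<rightarrow>\<^sub>M btotal B"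
    and total_sections: "\<exists>\<xi> :: nat \<Rightarrow> 'x \<Rightarrow> 'h. (\<forall>n. \<xi> n \<in> borel_sections X B) \<and>
          (\<forall>x\<in>space X. hclosed_span (fiber B x) (range (\<lambda>n. \<xi> n x)) = hcarrier (fiber B x))"

definition ucp_family ::
    "'x measure \<Rightarrow> ('x, 'h) hilbert_bundle \<Rightarrow> 'a::unital_cstar_algebra set \<Rightarrow>
     ('x \<Rightarrow> 'a \<Rightarrow> 'h \<Rightarrow> 'h) \<Rightarrow> bool" where
  "ucp_family X B S \<phi> \<longleftrightarrow>
     (\<forall>x\<in>space X. ucp_map S (fiber B x) (\<phi> x)) \<and>
     (\<forall>\<xi>\<in>borel_sections X B. \<forall>\<eta>\<in>borel_sections X B. \<forall>s\<in>S.
        (\<lambda>x. bip B (\<phi> x s (\<xi> x)) (\<eta> x)) \<in> borel_measurable X)"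

section \<open>Direct integrals\<close>

definition L2_sections :: "'x measure \<Rightarrow> ('x, 'h) hilbert_bundle \<Rightarrow> ('x \<Rightarrow> 'h) set" where
  "L2_sections M B =
     {\<xi> \<in> borel_sections M B. integrable M (\<lambda>x. (hnorm (fiber B x) (\<xi> x))\<^sup>2)}"

definition ae_equal ::
    "'x measure \<Rightarrow> ('x, 'h) hilbert_bundle \<Rightarrow> (('x \<Rightarrow> 'h) \<times> ('x \<Rightarrow> 'h)) set" where
  "ae_equal M B =
     {(\<xi>, \<eta>). \<xi> \<in> L2_sections M B \<and> \<eta> \<in> L2_sections M B \<and> (AE x in M. \<xi> x = \<eta> x)}"

abbreviation ae_class ::
    "'x measure \<Rightarrow> ('x, 'h) hilbert_bundle \<Rightarrow> ('x \<Rightarrow> 'h) \<Rightarrow> ('x \<Rightarrow> 'h) set" where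
  "ae_class M B \<xi> \<equiv> ae_equal M B `` {\<xi>}"

text \<open>The operations below act on chosen representatives; the choice affects the results only on a
  null set.\<close>

definition ae_rep :: "('x \<Rightarrow> 'h) set \<Rightarrow> 'x \<Rightarrow> 'h" where
  "ae_rep u = (SOME \<xi>. \<xi> \<in> u)"

definition direct_integral ::
    "'x measure \<Rightarrow> ('x, 'h) hilbert_bundle \<Rightarrow> ('x \<Rightarrow> 'h) set hilbert" where
  "direct_integral M B = \<lparr>
     hcarrier = L2_sections M B // ae_equal M B,
     hzero = ae_class M B (bzero B),
     hadd = (\<lambda>u v. ae_class M B (\<lambda>x. badd B (ae_rep u x) (ae_rep v x))),
     hscale = (\<lambda>c u. ae_class M B (\<lambda>x. bscale B c (ae_rep u x))),
     hip = (\<lambda>u v. \<integral>x. bip B (ae_rep u x) (ae_rep v x) \<partial>M)\<rparr>"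

definition direct_integral_operator ::
    "'x measure \<Rightarrow> ('x, 'h) hilbert_bundle \<Rightarrow> ('x \<Rightarrow> 'h \<Rightarrow> 'h) \<Rightarrow>
     ('x \<Rightarrow> 'h) set \<Rightarrow> ('x \<Rightarrow> 'h) set" where
  "direct_integral_operator M B T =
     (\<lambda>u \<in> hcarrier (direct_integral M B). ae_class M B (\<lambda>x. T x (ae_rep u x)))"

definition direct_integral_map ::
    "'x measure \<Rightarrow> ('x, 'h) hilbert_bundle \<Rightarrow> ('x \<Rightarrow> 'a \<Rightarrow> 'h \<Rightarrow> 'h) \<Rightarrow>
     'a \<Rightarrow> ('x \<Rightarrow> 'h) set \<Rightarrow> ('x \<Rightarrow> 'h) set" where
  "direct_integral_map M B \<phi> s = direct_integral_operator M B (\<lambda>x. \<phi> x s)"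

end

theory Submission
  imports Defs "HOL-Library.Poly_Mapping"
begin

text \<open>
Write \<open>D\<close> for the direct integral, \<open>A\<close> for the C*-algebra, and \<open>\<pi>\<close> for the representation of \<open>A\<close> on
\<open>D\<close> that is the only completely positive extension of \<open>\<phi>\<close>. The proof replaces a measurable choice of bad
extensions in the fibers by a duality that turns uniqueness on \<open>D\<close> into countably many inequalities between
integrable functions.

Duality (\<open>extension_duality\<close>). Consider finite formal sums of terms \<open>a \<otimes> (\<eta>, \<xi>)\<close>, paired with a unital
completely positive map \<open>\<psi>\<close> through \<open>Re \<langle>\<psi>(a) \<eta>, \<xi>\<rangle>\<close>, and the cone generated by the sums that are visibly nonnegative on
every such \<open>\<psi>\<close>. If \<open>\<pi>\<close> is the only extension, then for all \<open>a, \<eta>, \<xi>\<close> and \<open>\<epsilon> > 0\<close> there is a formal sum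
\<open>\<sigma>\<close> with coefficients in \<open>S\<close> that dominates \<open>a \<otimes> (\<eta>, \<xi>)\<close> modulo the cone and whose value at \<open>\<pi>\<close> exceeds
\<open>Re \<langle>\<pi>(a) \<eta>, \<xi>\<rangle>\<close> by less than \<open>\<epsilon>\<close>: otherwise the Hahn-Banach theorem gives a functional on formal sums with
a larger value, and by the Riesz representation theorem that functional comes from a second extension.

Passage to the fibers (\<open>positive_cone_fibers\<close>, \<open>fiber_extension_bound\<close>). An element of the cone uses finitely many
vectors and finitely many linear relations between them. The relations hold between representing sections almost
everywhere, so the element stays nonnegative on every unital completely positive map on almost every fiber. Hence for almost
every \<open>x\<close> the value of \<open>\<sigma>\<close> at \<open>x\<close>, which depends on \<open>\<phi>\<^sub>x\<close> only, bounds
\<open>Re \<langle>\<psi>(a) \<eta>(x), \<xi>(x)\<rangle>\<close> for all extensions \<open>\<psi>\<close> of \<open>\<phi>\<^sub>x\<close> simultaneously. The integral of this bound is the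
value of \<open>\<sigma>\<close> at \<open>\<pi>\<close>. For a sequence of \<open>\<epsilon>\<close> tending to \<open>0\<close>, the infimum of the bounds is therefore, for almost
every \<open>x\<close>, the value that belongs to \<open>\<pi>\<close>. Countably many \<open>a, \<eta>, \<xi>\<close>, dense in \<open>A\<close> and in all fibers, determine \<open>\<psi>\<close>.

The representation in the fiber (\<open>fiber_representation\<close>). Rational noncommutative polynomials in a countable dense
part of \<open>S\<close> act on the fibers through \<open>\<phi>\<^sub>x\<close> and on \<open>D\<close> through \<open>\<pi>\<close>. Since \<open>\<pi>\<close> is contractive, the fiber action is
contractive for almost every \<open>x\<close>, so it extends to a representation of \<open>A\<close> that extends \<open>\<phi>\<^sub>x\<close>.

Completeness of \<open>D\<close> (\<open>hilbert_D\<close>) is needed for the Riesz representation theorem. A pointwise limit of Borel sections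
has Borel coordinates, but it must be Borel as a map into the total space, whose Borel structure is related to the
fiber norms only through the measurability of the operations. This follows from Blackwell's theorem
(\<open>countable_separating_generates\<close>): in a standard Borel space every countable family of Borel sets that separates
points generates the Borel sets.\<close>

section \<open>Square roots in C*-algebras\<close>

lemma star_zero [simp]: "star (0::'a::unital_cstar_algebra) = 0"
  using star_add[of 0 "0::'a"] by simp

lemma star_minus: "star (- x) = - star (x::'a::unital_cstar_algebra)"
  using star_add[of x "-x"] by (simp add: add_eq_0_iff)

lemma star_one [simp]: "star (1::'a::unital_cstar_algebra) = 1"
  using star_mult[of "star 1" "1::'a"] by (simp add: star_star)

lemma star_scaleR: "star (r *\<^sub>R x) = r *\<^sub>R star (x::'a::unital_cstar_algebra)"
  by (simp add: scaleR_eq_scaleC star_scaleC)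

lemma star_sum: "star (\<Sum>i\<in>I. f i) = (\<Sum>i\<in>I. star (f i :: 'a::unital_cstar_algebra))"
  by (induction I rule: infinite_finite_induct) (auto simp: star_add)

lemma norm_star [simp]: "norm (star x) = norm (x::'a::unital_cstar_algebra)"
proof -
  have le: "norm y \<le> norm (star y)" for y :: 'a
  proof (cases "y = 0")
    case False
    have "norm y * norm y \<le> norm (star y) * norm y"
      using norm_mult_ineq[of "star y" y] by (simp add: cstar_identity power2_eq_square)
    with False show ?thesis by simp
  qed simp
  show ?thesis using le[of x] le[of "star x"] by (simp add: star_star)
qed

lemma bounded_linear_star: "bounded_linear (star :: 'a::unital_cstar_algebra \<Rightarrow> 'a)"
  by (rule bounded_linear_intro[where K = 1]) (auto simp: star_add star_scaleR)

lemma module_scaleC: "module (scaleC :: complex \<Rightarrow> 'a::unital_cstar_algebra \<Rightarrow> 'a)"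
proof
  show "scaleC 1 x = x" for x :: 'a
    using scaleR_eq_scaleC[of 1 x] by simp
qed (auto simp: scaleC_add_right scaleC_add_left scaleC_scaleC)

lemmas scaleC_simps [simp] =
  module.scale_zero_left[OF module_scaleC] module.scale_zero_right[OF module_scaleC]
  module.scale_one[OF module_scaleC]
lemmas scaleC_minus_left [simp] = module.scale_minus_left[OF module_scaleC]
lemmas scaleC_minus_right [simp] = module.scale_minus_right[OF module_scaleC]
lemmas scaleC_diff_right = module.scale_right_diff_distrib[OF module_scaleC]

lemma star_power: "star x = x \<Longrightarrow> star (x ^ k) = (x::'a::unital_cstar_algebra) ^ k"
  by (induction k) (auto simp: star_mult power_commutes)

text \<open>The binomial series of \<open>sqrt (1 - x)\<close> converges absolutely for \<open>norm x < 1\<close>; its Cauchy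
square is \<open>1 - x\<close> by Vandermonde's identity for the coefficients \<open>(1/2 gchoose k)\<close>.\<close>

lemma selfadjoint_sqrt:
  fixes x :: "'a::unital_cstar_algebra"
  assumes sx: "star x = x" and nx: "norm x < 1"
  shows "\<exists>c. star c = c \<and> c * c = 1 - x"
proof -
  define b where "b k = ((1/2::real) gchoose k) *\<^sub>R (- x) ^ k" for k
  have sg: "summable (\<lambda>k. norm (((1/2::real) gchoose k) * norm x ^ k))"
    by (rule abs_summable_in_conv_radius) (use nx in \<open>simp add: conv_radius_gchoose\<close>)
  have "norm (b k) \<le> norm (((1/2::real) gchoose k) * norm x ^ k)" for k
    using norm_power_ineq[of "-x" k] by (auto simp: b_def abs_mult intro!: mult_left_mono)
  hence sb: "summable (\<lambda>k. norm (b k))"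
    by (intro summable_comparison_test[OF _ sg]) simp
  hence sums_b: "b sums suminf b" by (simp add: summable_norm_cancel summable_sums)
  have "(\<lambda>k. star (b k)) sums star (suminf b)"
    by (rule bounded_linear.sums[OF bounded_linear_star sums_b])
  moreover have "star (b k) = b k" for k
    using star_power[of "-x" k] sx by (simp add: b_def star_scaleR star_minus)
  ultimately have "b sums star (suminf b)" by (simp only:)
  hence 1: "star (suminf b) = suminf b" by (rule sums_unique2[OF _ sums_b])
  have conv: "(\<Sum>i\<le>k. b i * b (k - i)) = (1 gchoose k) *\<^sub>R (- x) ^ k" for k
  proof -
    have "(\<Sum>i\<le>k. b i * b (k - i)) =
        (\<Sum>i\<le>k. (((1/2::real) gchoose i) * ((1/2) gchoose (k - i))) *\<^sub>R (- x) ^ k)"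
      by (intro sum.cong refl) (simp add: b_def mult.commute flip: power_add)
    also have "\<dots> = (\<Sum>i=0..k. ((1/2::real) gchoose i) * ((1/2) gchoose (k - i))) *\<^sub>R (- x) ^ k"
      by (simp add: scaleR_sum_left atMost_atLeast0)
    also have "\<dots> = (1 gchoose k) *\<^sub>R (- x) ^ k"
      by (simp add: gbinomial_Vandermonde)
    finally show ?thesis .
  qed
  have one: "((1::real) gchoose k) = (if k = 0 \<or> k = 1 then 1 else 0)" for k
  proof -
    have "((1::real) gchoose k) = of_nat (1 choose k)" using binomial_gbinomial[of 1 k, where 'a = real] by simp
    thus ?thesis by (cases "k \<le> 1") (auto simp: binomial_eq_0 le_Suc_eq)
  qed
  have "(\<lambda>k. (1 gchoose k) *\<^sub>R (- x) ^ k) sums (\<Sum>k\<in>{0,1}. (1 gchoose k) *\<^sub>R (- x) ^ k)"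
    by (rule sums_finite) (auto simp: one)
  moreover have "(\<lambda>k. (1 gchoose k) *\<^sub>R (- x) ^ k) sums (suminf b * suminf b)"
    using Cauchy_product_sums[OF sb sb] by (simp add: conv)
  ultimately have "suminf b * suminf b = (\<Sum>k\<in>{0,1}. (1 gchoose k) *\<^sub>R (- x) ^ k)"
    by (rule sums_unique2[rotated])
  also have "\<dots> = 1 - x" by (simp add: one)
  finally have "suminf b * suminf b = 1 - x" .
  with 1 show ?thesis by blast
qed

text \<open>This is the only form in which the order of the C*-algebra enters: \<open>r\<^sup>2 - a\<^sup>* a\<close> is again of
the form \<open>c\<^sup>* c\<close>. It makes completely positive maps contractive and lets elements of \<open>S\<close>, namely scalars, dominate
arbitrary elements.\<close>

lemma complete_square_to_scalar:
  fixes a :: "'a::unital_cstar_algebra"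
  assumes "norm a < r"
  shows "\<exists>c. star a * a + star c * c = (r\<^sup>2) *\<^sub>R 1"
proof -
  have r: "r > 0" using assms norm_ge_zero[of a] by linarith
  have "norm ((1 / r\<^sup>2) *\<^sub>R (star a * a)) < 1"
    using assms r by (simp add: cstar_identity power_strict_mono)
  moreover have "star ((1 / r\<^sup>2) *\<^sub>R (star a * a)) = (1 / r\<^sup>2) *\<^sub>R (star a * a)"
    by (simp add: star_scaleR star_mult star_star)
  ultimately obtain c where c: "star c = c" "c * c = 1 - (1 / r\<^sup>2) *\<^sub>R (star a * a)"
    using selfadjoint_sqrt by blast
  have "star (r *\<^sub>R c) * (r *\<^sub>R c) = r\<^sup>2 *\<^sub>R (c * c)"
    by (simp add: star_scaleR c(1) power2_eq_square)
  also have "\<dots> = r\<^sup>2 *\<^sub>R 1 - star a * a"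
    using r by (simp add: c(2) scaleR_right_diff_distrib)
  finally have e: "star (r *\<^sub>R c) * (r *\<^sub>R c) = r\<^sup>2 *\<^sub>R 1 - star a * a" .
  have "star a * a + star (r *\<^sub>R c) * (r *\<^sub>R c) = r\<^sup>2 *\<^sub>R 1" unfolding e by (simp only: add.commute[of "star a * a"] diff_add_cancel)
  thus ?thesis by blast
qed

section \<open>The Hahn-Banach theorem\<close>

definition sublinear :: "('v::real_vector \<Rightarrow> real) \<Rightarrow> bool" where
  "sublinear p \<longleftrightarrow> (\<forall>u v. p (u + v) \<le> p u + p v) \<and> (\<forall>r v. 0 < r \<longrightarrow> p (r *\<^sub>R v) = r * p v)"

lemma sublinear_zero: "sublinear p \<Longrightarrow> p 0 = 0"
  unfolding sublinear_def by (metis scaleR_zero_right mult_cancel_right2 zero_less_numeral numeral_eq_one_iff semiring_norm(83))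

lemma sublinear_lower: "sublinear p \<Longrightarrow> - p (- v) \<le> p v"
  using sublinear_zero[of p] unfolding sublinear_def
  by (metis add.right_inverse minus_le_iff add_le_cancel_left)

text \<open>The largest sublinear functional below \<open>p\<close> that takes the value \<open>- p y\<close> at \<open>- y\<close>. If \<open>p\<close> is minimal, it
coincides with \<open>p\<close>, which forces additivity in the direction of \<open>y\<close>.\<close>

lemma sublinear_tilt:
  fixes p :: "'v::real_vector \<Rightarrow> real" and y :: 'v
  assumes p: "sublinear p"
  defines "q \<equiv> \<lambda>x. INF t\<in>{0..}. p (x + t *\<^sub>R y) - t * p y"
  shows "sublinear q" "\<And>x t. t \<ge> 0 \<Longrightarrow> q x \<le> p (x + t *\<^sub>R y) - t * p y"
proof -
  have sub: "p (u + v) \<le> p u + p v" for u v using p by (auto simp: sublinear_def)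
  have hom: "0 \<le> r \<Longrightarrow> p (r *\<^sub>R v) = r * p v" for r v
    using p sublinear_zero[OF p] by (cases "r = 0") (auto simp: sublinear_def)
  have bdd: "bdd_below ((\<lambda>t. p (x + t *\<^sub>R y) - t * p y) ` {0..})" for x
  proof (rule bdd_belowI2[where m = "- p (- x)"])
    fix t :: real assume "t \<in> {0..}"
    hence "t * p y = p ((x + t *\<^sub>R y) + - x)" using hom[of t y] by simp
    also have "\<dots> \<le> p (x + t *\<^sub>R y) + p (- x)" by (rule sub)
    finally show "- p (- x) \<le> p (x + t *\<^sub>R y) - t * p y" by simp
  qed
  show upper: "t \<ge> 0 \<Longrightarrow> q x \<le> p (x + t *\<^sub>R y) - t * p y" for x t
    unfolding q_def by (rule cINF_lower[OF bdd]) auto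
  have greatest: "m \<le> q x" if "\<And>t. t \<ge> 0 \<Longrightarrow> m \<le> p (x + t *\<^sub>R y) - t * p y" for m x
    unfolding q_def by (rule cINF_greatest) (use that in auto)
  have half: "q (r *\<^sub>R x) \<le> r * q x" if r: "r > 0" for r x
  proof -
    have "q (r *\<^sub>R x) / r \<le> q x"
    proof (rule greatest)
      fix t :: real assume t: "t \<ge> 0"
      have "q (r *\<^sub>R x) \<le> p (r *\<^sub>R x + (r * t) *\<^sub>R y) - (r * t) * p y"
        using upper r t by simp
      also have "r *\<^sub>R x + (r * t) *\<^sub>R y = r *\<^sub>R (x + t *\<^sub>R y)" by (simp add: scaleR_add_right)
      also have "p \<dots> = r * p (x + t *\<^sub>R y)" using hom r by simp
      finally show "q (r *\<^sub>R x) / r \<le> p (x + t *\<^sub>R y) - t * p y"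
        using r by (simp add: field_simps)
    qed
    thus ?thesis using r by (simp add: field_simps)
  qed
  show "sublinear q"
    unfolding sublinear_def
  proof (intro conjI allI impI)
    fix u v
    have "q (u + v) - q u \<le> q v"
    proof (rule greatest)
      fix t :: real assume t: "t \<ge> 0"
      have "q (u + v) - (p (v + t *\<^sub>R y) - t * p y) \<le> q u"
      proof (rule greatest)
        fix s :: real assume s: "s \<ge> 0"
        have "q (u + v) \<le> p ((u + v) + (s + t) *\<^sub>R y) - (s + t) * p y"
          using s t upper by simp
        also have "(u + v) + (s + t) *\<^sub>R y = (u + s *\<^sub>R y) + (v + t *\<^sub>R y)"
          by (simp add: scaleR_add_left)
        also have "p \<dots> \<le> p (u + s *\<^sub>R y) + p (v + t *\<^sub>R y)" by (rule sub)
        finally show "q (u + v) - (p (v + t *\<^sub>R y) - t * p y) \<le> p (u + s *\<^sub>R y) - s * p y"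
          by (simp add: algebra_simps)
      qed
      thus "q (u + v) - q u \<le> p (v + t *\<^sub>R y) - t * p y" by simp
    qed
    thus "q (u + v) \<le> q u + q v" by simp
  next
    fix r :: real and v assume r: "r > 0"
    have "q ((1/r) *\<^sub>R (r *\<^sub>R v)) \<le> (1/r) * q (r *\<^sub>R v)" by (rule half) (use r in simp)
    hence "r * q v \<le> q (r *\<^sub>R v)" using r by (simp add: field_simps)
    with half[OF r] show "q (r *\<^sub>R v) = r * q v" by (intro antisym)
  qed
qed

lemma minimal_sublinear_below:
  fixes p :: "'v::real_vector \<Rightarrow> real"
  assumes p: "sublinear p"
  obtains m where "sublinear m" "m \<le> p" "\<And>q. sublinear q \<Longrightarrow> q \<le> m \<Longrightarrow> q = m"
proof -
  define A where "A = {q. sublinear q \<and> q \<le> p}"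
  let ?R = "relation_of (\<lambda>x y. y \<le> x) A"
  have po: "partial_order_on A ?R"
    by (rule partial_order_on_relation_ofI) auto
  have "\<exists>u\<in>A. \<forall>a\<in>C. u \<le> a" if C: "C \<in> Chains ?R" for C
  proof (cases "C = {}")
    case True thus ?thesis using p by (auto simp: A_def)
  next
    case False
    have CA: "C \<subseteq> A" and lin: "\<And>a b. a \<in> C \<Longrightarrow> b \<in> C \<Longrightarrow> a \<le> b \<or> b \<le> a"
      using C by (auto simp: Chains_def relation_of_def)
    define u where "u v = (INF q\<in>C. q v)" for v
    have bdd: "bdd_below ((\<lambda>q. q v) ` C)" for v
    proof (rule bdd_belowI2[where m = "- p (- v)"])
      fix q assume "q \<in> C"
      hence "sublinear q" "q \<le> p" using CA by (auto simp: A_def)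
      thus "- p (- v) \<le> q v" using sublinear_lower[of q v] le_funD[of q p "-v"] by simp
    qed
    have low: "u v \<le> q v" if "q \<in> C" for q v
      unfolding u_def by (rule cINF_lower[OF bdd that])
    have gr: "m \<le> u v" if "\<And>q. q \<in> C \<Longrightarrow> m \<le> q v" for m v
      unfolding u_def by (rule cINF_greatest[OF False that])
    have "sublinear u"
      unfolding sublinear_def
    proof (intro conjI allI impI)
      fix x y
      have "u (x + y) - u x \<le> u y"
      proof (rule gr)
        fix q2 assume q2: "q2 \<in> C"
        have "u (x + y) - q2 y \<le> u x"
        proof (rule gr)
          fix q1 assume q1: "q1 \<in> C"
          \<comment> \<open>of two comparable functionals the smaller one bounds both terms\<close>
          obtain q where q: "q \<in> C" "q \<le> q1" "q \<le> q2" using lin[OF q1 q2] q1 q2 by auto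
          have "u (x + y) \<le> q (x + y)" by (rule low[OF q(1)])
          also have "\<dots> \<le> q x + q y" using q(1) CA by (auto simp: A_def sublinear_def)
          also have "\<dots> \<le> q1 x + q2 y" using q by (intro add_mono) (auto simp: le_fun_def)
          finally show "u (x + y) - q2 y \<le> q1 x" by simp
        qed
        thus "u (x + y) - u x \<le> q2 y" by simp
      qed
      thus "u (x + y) \<le> u x + u y" by simp
    next
      fix r :: real and v assume r: "r > 0"
      have hom: "q (r *\<^sub>R v) = r * q v" if "q \<in> C" for q
        using that CA r by (auto simp: A_def sublinear_def)
      have "u (r *\<^sub>R v) / r \<le> u v"
        by (rule gr) (use low hom r in \<open>fastforce simp: field_simps\<close>)
      moreover have "r * u v \<le> u (r *\<^sub>R v)"
      proof (rule gr)
        fix q assume q: "q \<in> C"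
        show "r * u v \<le> q (r *\<^sub>R v)"
          unfolding hom[OF q] by (rule mult_left_mono[OF low[OF q]]) (use r in simp)
      qed
      ultimately show "u (r *\<^sub>R v) = r * u v" using r by (simp add: field_simps)
    qed
    moreover have "u \<le> p"
    proof -
      obtain q where "q \<in> C" using False by auto
      thus ?thesis using low CA by (force simp: A_def le_fun_def intro: order_trans)
    qed
    ultimately show ?thesis using low by (intro bexI[of _ u]) (auto simp: A_def le_fun_def)
  qed
  hence "\<exists>m\<in>A. \<forall>a\<in>A. a \<le> m \<longrightarrow> a = m"
    by (intro predicate_Zorn[OF po]) auto
  thus ?thesis by (auto simp: A_def intro!: that dest: order_trans)
qed

text \<open>Minimal sublinear functionals are linear. A minimal one below the tilt of \<open>p\<close> at \<open>w\<close> agrees with \<open>p\<close>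
at \<open>w\<close>.\<close>

theorem hahn_banach_attained:
  fixes p :: "'v::real_vector \<Rightarrow> real"
  assumes p: "sublinear p"
  obtains F :: "'v \<Rightarrow> real" where "linear F" "\<And>v. F v \<le> p v" "F w = p w"
proof -
  define p0 where "p0 x = (INF t\<in>{0..}. p (x + t *\<^sub>R w) - t * p w)" for x
  note p0 = sublinear_tilt[OF p, where y = w, folded p0_def]
  obtain m where m: "sublinear m" "m \<le> p0" and min: "\<And>q. sublinear q \<Longrightarrow> q \<le> m \<Longrightarrow> q = m"
    using minimal_sublinear_below[OF p0(1)] by blast
  have sub: "m (u + v) \<le> m u + m v" for u v using m by (auto simp: sublinear_def)
  have add: "m (u + v) = m u + m v" for u v
  proof -
    define q where "q x = (INF t\<in>{0..}. m (x + t *\<^sub>R v) - t * m v)" for x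
    note q = sublinear_tilt[OF m(1), where y = v, folded q_def]
    have "q \<le> m" using q(2)[of 0] by (simp add: le_fun_def)
    hence "q = m" using min q(1) by blast
    hence "m u \<le> m (u + v) - m v" using q(2)[of 1 u] by simp
    with sub[of u v] show ?thesis by simp
  qed
  have neg: "m (- v) = - m v" for v using add[of v "-v"] sublinear_zero[OF m(1)] by simp
  have "m (r *\<^sub>R v) = r * m v" for r v
  proof (cases r "0::real" rule: linorder_cases)
    case less
    hence "m ((-r) *\<^sub>R v) = (-r) * m v" using m(1) unfolding sublinear_def by (metis neg_0_less_iff_less)
    thus ?thesis using neg[of "r *\<^sub>R v"] by simp
  qed (use m(1) sublinear_zero[OF m(1)] in \<open>auto simp: sublinear_def\<close>)
  with add have lin: "linear m" by (intro linearI) auto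
  have le: "m v \<le> p v" for v
    using m(2) p0(2)[of 0 v] by (force simp: le_fun_def intro: order_trans)
  have "m (- w) \<le> p0 (- w)" using m(2) by (simp add: le_fun_def)
  also have "\<dots> \<le> - p w" using p0(2)[of 1 "-w"] sublinear_zero[OF p] by simp
  finally have "m w = p w" using neg[of w] le[of w] by simp
  with lin le show ?thesis using that by blast
qed

section \<open>Hilbert spaces with an explicit carrier\<close>

text \<open>Completeness is split off so that the metric and the Cauchy-Schwarz inequality are available for the
direct integral before its completeness is proved.\<close>

locale pre_hilbert_space =
  fixes H :: "'v hilbert"
  assumes zero_closed: "hzero H \<in> hcarrier H"
    and add_closed: "\<lbrakk>v \<in> hcarrier H; w \<in> hcarrier H\<rbrakk> \<Longrightarrow> hadd H v w \<in> hcarrier H"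
    and scale_closed: "v \<in> hcarrier H \<Longrightarrow> hscale H c v \<in> hcarrier H"
    and add_assoc: "\<lbrakk>u \<in> hcarrier H; v \<in> hcarrier H; w \<in> hcarrier H\<rbrakk> \<Longrightarrow>
          hadd H (hadd H u v) w = hadd H u (hadd H v w)"
    and add_commute: "\<lbrakk>v \<in> hcarrier H; w \<in> hcarrier H\<rbrakk> \<Longrightarrow> hadd H v w = hadd H w v"
    and add_zero: "v \<in> hcarrier H \<Longrightarrow> hadd H (hzero H) v = v"
    and add_inverse: "v \<in> hcarrier H \<Longrightarrow> hadd H v (hscale H (-1) v) = hzero H"
    and scale_add_right: "\<lbrakk>v \<in> hcarrier H; w \<in> hcarrier H\<rbrakk> \<Longrightarrow>
          hscale H c (hadd H v w) = hadd H (hscale H c v) (hscale H c w)"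
    and scale_add_left: "v \<in> hcarrier H \<Longrightarrow>
          hscale H (c + d) v = hadd H (hscale H c v) (hscale H d v)"
    and scale_scale: "v \<in> hcarrier H \<Longrightarrow> hscale H c (hscale H d v) = hscale H (c * d) v"
    and scale_one: "v \<in> hcarrier H \<Longrightarrow> hscale H 1 v = v"
    and ip_add_left: "\<lbrakk>u \<in> hcarrier H; v \<in> hcarrier H; w \<in> hcarrier H\<rbrakk> \<Longrightarrow>
          hip H (hadd H u v) w = hip H u w + hip H v w"
    and ip_scale_left: "\<lbrakk>v \<in> hcarrier H; w \<in> hcarrier H\<rbrakk> \<Longrightarrow>
          hip H (hscale H c v) w = c * hip H v w"
    and ip_commute: "\<lbrakk>v \<in> hcarrier H; w \<in> hcarrier H\<rbrakk> \<Longrightarrow> hip H w v = cnj (hip H v w)"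
    and ip_nonneg: "v \<in> hcarrier H \<Longrightarrow> hip H v v \<in> \<real>\<^sub>\<ge>\<^sub>0"
    and ip_definite: "\<lbrakk>v \<in> hcarrier H; hip H v v = 0\<rbrakk> \<Longrightarrow> v = hzero H"

context pre_hilbert_space
begin

abbreviation "C \<equiv> hcarrier H"
definition sub where "sub v w = hadd H v (hscale H (-1) w)"

lemma sub_closed: "v \<in> C \<Longrightarrow> w \<in> C \<Longrightarrow> sub v w \<in> C"
  by (simp add: sub_def add_closed scale_closed)

lemmas closed = zero_closed add_closed scale_closed sub_closed

lemma ip_add_right: "u \<in> C \<Longrightarrow> v \<in> C \<Longrightarrow> w \<in> C \<Longrightarrow> hip H u (hadd H v w) = hip H u v + hip H u w"
  by (metis add_closed complex_cnj_add ip_add_left ip_commute)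

lemma ip_scale_right: "v \<in> C \<Longrightarrow> w \<in> C \<Longrightarrow> hip H v (hscale H c w) = cnj c * hip H v w"
  by (metis complex_cnj_mult ip_commute ip_scale_left scale_closed)

lemma scale_zero: "v \<in> C \<Longrightarrow> hscale H 0 v = hzero H"
  using scale_add_left[of v 1 "-1"] by (simp add: scale_one add_inverse)

lemma ip_zero_left: "v \<in> C \<Longrightarrow> hip H (hzero H) v = 0"
  using ip_scale_left[of v v 0] by (simp add: scale_zero)

lemma ip_zero_right: "v \<in> C \<Longrightarrow> hip H v (hzero H) = 0"
  using ip_scale_right[of v v 0] by (simp add: scale_zero)

lemma ip_sub_left: "u \<in> C \<Longrightarrow> v \<in> C \<Longrightarrow> w \<in> C \<Longrightarrow> hip H (sub u v) w = hip H u w - hip H v w"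
  by (simp add: sub_def ip_add_left ip_scale_left scale_closed)

lemma ip_sub_right: "u \<in> C \<Longrightarrow> v \<in> C \<Longrightarrow> w \<in> C \<Longrightarrow> hip H u (sub v w) = hip H u v - hip H u w"
  by (simp add: sub_def ip_add_right ip_scale_right scale_closed)

lemmas ips = ip_add_left ip_add_right ip_scale_left ip_scale_right ip_zero_left ip_zero_right
  ip_sub_left ip_sub_right closed

lemma add_sub_cancel: "u \<in> C \<Longrightarrow> v \<in> C \<Longrightarrow> hadd H v (sub u v) = u"
  unfolding sub_def
  by (metis add_assoc add_commute add_inverse add_zero scale_closed zero_closed add_closed)

lemma sub_zero_imp_eq: "u \<in> C \<Longrightarrow> v \<in> C \<Longrightarrow> sub u v = hzero H \<Longrightarrow> u = v"
  by (metis add_sub_cancel add_commute add_zero zero_closed)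

lemma eq_by_ip:
  assumes "u \<in> C" "v \<in> C" "\<And>w. w \<in> C \<Longrightarrow> hip H u w = hip H v w"
  shows "u = v"
proof -
  have "hip H (sub u v) (sub u v) = 0" using assms by (simp add: ips)
  hence "sub u v = hzero H" using assms by (intro ip_definite) (auto simp: sub_closed)
  thus ?thesis using assms sub_zero_imp_eq by blast
qed

lemma ip_self: "v \<in> C \<Longrightarrow> hip H v v = complex_of_real ((hnorm H v)\<^sup>2)"
  using ip_nonneg[of v] by (auto simp: hnorm_def nonneg_Reals_def complex_eq_iff)

lemma hnorm_nonneg: "v \<in> C \<Longrightarrow> 0 \<le> hnorm H v"
  using ip_nonneg[of v] by (auto simp: hnorm_def nonneg_Reals_def)

lemma hnorm_sq: "v \<in> C \<Longrightarrow> (hnorm H v)\<^sup>2 = Re (hip H v v)"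
  by (simp add: ip_self)

lemma hnorm_zero [simp]: "hnorm H (hzero H) = 0"
  by (simp add: hnorm_def ip_zero_left zero_closed)

lemma hnorm_eq_zero: "v \<in> C \<Longrightarrow> hnorm H v = 0 \<Longrightarrow> v = hzero H"
  by (rule ip_definite) (auto simp: ip_self)

lemma hnorm_scale: "v \<in> C \<Longrightarrow> hnorm H (hscale H c v) = cmod c * hnorm H v"
proof -
  assume v: "v \<in> C"
  have "hip H (hscale H c v) (hscale H c v) = (c * cnj c) * hip H v v"
    using v by (simp add: ips)
  also have "\<dots> = complex_of_real ((cmod c * hnorm H v)\<^sup>2)"
    using v by (simp add: ip_self power_mult_distrib flip: complex_norm_square)
  finally have "(hnorm H (hscale H c v))\<^sup>2 = (cmod c * hnorm H v)\<^sup>2"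
    using v by (simp add: hnorm_sq closed)
  thus ?thesis using v by (simp add: hnorm_nonneg closed)
qed

lemma cauchy_schwarz:
  assumes v: "v \<in> C" and w: "w \<in> C"
  shows "cmod (hip H v w) \<le> hnorm H v * hnorm H w"
proof (cases "hnorm H w = 0")
  case True
  thus ?thesis using hnorm_eq_zero[OF w] v by (simp add: ips)
next
  case False
  define n where "n = (hnorm H w)\<^sup>2"
  have n: "n > 0" using False by (simp add: n_def)
  define z where "z = hip H v w"
  define u where "u = sub v (hscale H (z / n) w)"
  have wv: "hip H w v = cnj z" unfolding z_def by (rule ip_commute[OF v w])
  have "hip H u u = hip H v v - cnj (z / n) * z - (z / n) * cnj z + (z / n) * cnj (z/n) * n"
    using v w by (simp add: u_def ips wv ip_self[OF w, folded n_def] add: algebra_simps flip: z_def)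
  also have "\<dots> = hip H v v - z * cnj z / n" using n by (simp add: field_simps)
  also have "z * cnj z = complex_of_real ((cmod z)\<^sup>2)" by (rule complex_norm_square[symmetric])
  finally have "Re (hip H u u) = (hnorm H v)\<^sup>2 - (cmod z)\<^sup>2 / n"
    using v by (simp add: ip_self)
  moreover have "Re (hip H u u) \<ge> 0"
  proof -
    have "u \<in> C" using v w by (simp add: u_def closed)
    from hnorm_sq[OF this] show ?thesis by (metis zero_le_power2)
  qed
  ultimately have "(cmod z)\<^sup>2 / n \<le> (hnorm H v)\<^sup>2" by simp
  hence "(cmod z)\<^sup>2 \<le> (hnorm H v)\<^sup>2 * n" using n by (simp only: pos_divide_le_eq)
  hence "(cmod z)\<^sup>2 \<le> (hnorm H v * hnorm H w)\<^sup>2" by (simp add: n_def power_mult_distrib)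
  hence "cmod z \<le> hnorm H v * hnorm H w"
    by (rule power2_le_imp_le[OF _ mult_nonneg_nonneg[OF hnorm_nonneg[OF v] hnorm_nonneg[OF w]]])
  thus ?thesis by (simp only: z_def)
qed

lemma hnorm_triangle:
  assumes v: "v \<in> C" and w: "w \<in> C"
  shows "hnorm H (hadd H v w) \<le> hnorm H v + hnorm H w"
proof (rule power2_le_imp_le)
  have "(hnorm H (hadd H v w))\<^sup>2 = (hnorm H v)\<^sup>2 + (hnorm H w)\<^sup>2 + 2 * Re (hip H v w)"
    using v w ip_commute[OF v w] by (simp add: hnorm_sq ips)
  also have "Re (hip H v w) \<le> hnorm H v * hnorm H w"
    using cauchy_schwarz[OF v w] complex_Re_le_cmod[of "hip H v w"] by linarith
  finally show "(hnorm H (hadd H v w))\<^sup>2 \<le> (hnorm H v + hnorm H w)\<^sup>2"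
    by (simp add: power2_sum)
qed (use v w hnorm_nonneg in auto)

lemma hdist_sub: "v \<in> C \<Longrightarrow> w \<in> C \<Longrightarrow> hdist H v w = hnorm H (sub v w)"
  by (simp add: hdist_def sub_def)

lemma sub_commute: "v \<in> C \<Longrightarrow> w \<in> C \<Longrightarrow> hnorm H (sub v w) = hnorm H (sub w v)"
proof -
  assume vw: "v \<in> C" "w \<in> C"
  have "sub v w = hscale H (-1) (sub w v)" by (rule eq_by_ip) (use vw in \<open>auto simp: ips\<close>)
  thus ?thesis using vw by (simp add: hnorm_scale closed)
qed

lemma sub_triangle:
  "u \<in> C \<Longrightarrow> v \<in> C \<Longrightarrow> w \<in> C \<Longrightarrow> hnorm H (sub u w) \<le> hnorm H (sub u v) + hnorm H (sub v w)"
proof -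
  assume a: "u \<in> C" "v \<in> C" "w \<in> C"
  have "sub u w = hadd H (sub u v) (sub v w)" by (rule eq_by_ip) (use a in \<open>auto simp: ips\<close>)
  thus ?thesis using a hnorm_triangle by (simp add: closed)
qed

lemma sub_self: "u \<in> C \<Longrightarrow> sub u u = hzero H"
  by (simp add: sub_def add_inverse)

sublocale M: Metric_space C "hdist H"
proof
  show "0 \<le> hdist H x y" for x y
    by (auto simp: hdist_def hnorm_nonneg closed)
  show "hdist H x y = hdist H y x" for x y
  proof (cases "x \<in> C \<and> y \<in> C")
    case True thus ?thesis using sub_commute by (simp add: hdist_sub)
  qed (auto simp: hdist_def)
  show "(hdist H x y = 0) = (x = y)" if "x \<in> C" "y \<in> C" for x y
    using that hnorm_eq_zero[of "sub x y"] sub_zero_imp_eq[of x y]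
    by (auto simp: hdist_sub closed sub_self)
  show "hdist H x z \<le> hdist H x y + hdist H y z" if "x \<in> C" "y \<in> C" "z \<in> C" for x y z
    using that by (simp add: hdist_sub sub_triangle)
qed

lemma hnorm_sub_diff: "v \<in> C \<Longrightarrow> w \<in> C \<Longrightarrow> \<bar>hnorm H v - hnorm H w\<bar> \<le> hnorm H (sub v w)"
  using hnorm_triangle[of w "sub v w"] hnorm_triangle[of v "sub w v"] sub_commute[of v w]
  by (auto simp: add_sub_cancel closed)

lemma parallelogram:
  assumes "v \<in> C" "w \<in> C"
  shows "(hnorm H (hadd H v w))\<^sup>2 + (hnorm H (sub v w))\<^sup>2 = 2 * (hnorm H v)\<^sup>2 + 2 * (hnorm H w)\<^sup>2"
  using assms by (simp add: hnorm_sq ips)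

lemma eq_real_ip:
  assumes "u \<in> C" "v \<in> C" "\<And>w. w \<in> C \<Longrightarrow> Re (hip H u w) = Re (hip H v w)"
  shows "u = v"
proof -
  have "Re (hip H (sub u v) (sub u v)) = 0"
    using assms closed by (simp add: ip_sub_left)
  hence "hnorm H (sub u v) = 0" using assms by (simp add: closed flip: hnorm_sq)
  hence "sub u v = hzero H" using assms by (intro hnorm_eq_zero) (auto simp: sub_closed)
  thus ?thesis using assms sub_zero_imp_eq by blast
qed

end

sublocale hilbert_space \<subseteq> pre_hilbert_space H
  by unfold_locales
    (fact zero_closed add_closed scale_closed add_assoc add_commute add_zero add_inverse scale_add_right scale_add_left scale_scale scale_one ip_add_left ip_scale_left ip_commute ip_nonneg ip_definite)+

context hilbert_space
begin

lemma cauchy_limit: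
  assumes v: "\<And>n::nat. v n \<in> C"
    and c: "\<And>e. e > 0 \<Longrightarrow> \<exists>N. \<forall>m\<ge>N. \<forall>n\<ge>N. hnorm H (sub (v m) (v n)) < e"
  obtains w where "w \<in> C" "(\<lambda>n. hnorm H (sub (v n) w)) \<longlonglongrightarrow> 0"
proof -
  have "M.MCauchy v"
    unfolding M.MCauchy_def using v c by (fastforce simp: hdist_sub)
  then obtain w where w: "limitin M.mtopology v w sequentially"
    using complete unfolding M.mcomplete_def by blast
  hence "w \<in> C" by (simp add: M.limitin_metric)
  moreover have "(\<lambda>n. hnorm H (sub (v n) w)) \<longlonglongrightarrow> 0"
  proof (rule tendstoI)
    fix e :: real assume "e > 0"
    with w have "\<forall>\<^sub>F n in sequentially. v n \<in> C \<and> hdist H (v n) w < e"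
      by (simp add: M.limitin_metric)
    thus "\<forall>\<^sub>F n in sequentially. dist (hnorm H (sub (v n) w)) 0 < e"
      by eventually_elim (use \<open>w \<in> C\<close> in \<open>auto simp: hdist_sub hnorm_nonneg closed\<close>)
  qed
  ultimately show ?thesis using that by blast
qed

lemma summable_limit:
  assumes v: "\<And>n::nat. v n \<in> C" and s: "\<And>n. hnorm H (sub (v n) (v (Suc n))) \<le> g n" "summable g"
  obtains w where "w \<in> C" "(\<lambda>n. hnorm H (sub (v n) w)) \<longlonglongrightarrow> 0"
proof (rule cauchy_limit[OF v])
  fix e :: real assume e: "e > 0"
  have g0: "0 \<le> g n" for n using s(1)[of n] hnorm_nonneg[OF sub_closed[OF v v]] by (rule order_trans[rotated])
  have tel: "hnorm H (sub (v m) (v (m + k))) \<le> (\<Sum>i\<in>{m..<m+k}. g i)" for m k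
  proof (induction k)
    case 0 thus ?case using v by (simp add: sub_self)
  next
    case (Suc k)
    have "hnorm H (sub (v m) (v (m + Suc k))) \<le> hnorm H (sub (v m) (v (m + k))) + hnorm H (sub (v (m+k)) (v (m + Suc k)))"
      using v by (intro sub_triangle)
    thus ?case using Suc s(1)[of "m+k"] by simp
  qed
  obtain N where N: "\<And>m n. m \<ge> N \<Longrightarrow> norm (sum g {m..<n}) < e"
    using s(2) e unfolding summable_Cauchy by blast
  have "hnorm H (sub (v m) (v n)) < e" if "m \<ge> N" "m \<le> n" for m n
    using tel[of m "n - m"] N[of m n] that g0 by (auto simp: sum_nonneg)
  hence "hnorm H (sub (v m) (v n)) < e" if "m \<ge> N" "n \<ge> N" for m n
    using that sub_commute[OF v v, of m n] by (metis nle_le)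
  thus "\<exists>N. \<forall>m\<ge>N. \<forall>n\<ge>N. hnorm H (sub (v m) (v n)) < e" by blast
qed (use that in blast)

end

context hilbert_space
begin

text \<open>The representing vector is the minimizer of \<open>\<parallel>v\<parallel>\<^sup>2 - 2 Re (L v)\<close>. Minimizing sequences are Cauchy by the
parallelogram law, and the first variation at the minimum is the claim.\<close>

lemma riesz_representation:
  assumes add: "\<And>v w. v \<in> C \<Longrightarrow> w \<in> C \<Longrightarrow> L (hadd H v w) = L v + L w"
    and scale: "\<And>c v. v \<in> C \<Longrightarrow> L (hscale H c v) = cnj c * L v"
    and bd: "\<And>v. v \<in> C \<Longrightarrow> cmod (L v) \<le> K * hnorm H v"
  obtains y where "y \<in> C" "\<And>v. v \<in> C \<Longrightarrow> L v = hip H y v"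
proof -
  define E where "E v = (hnorm H v)\<^sup>2 - 2 * Re (L v)" for v
  have lower: "- K\<^sup>2 \<le> E v" if v: "v \<in> C" for v
  proof -
    have "Re (L v) \<le> K * hnorm H v" using bd[OF v] complex_Re_le_cmod[of "L v"] by linarith
    moreover have "0 \<le> (hnorm H v - K)\<^sup>2" by simp
    ultimately show ?thesis by (simp add: E_def power2_diff algebra_simps)
  qed
  define I where "I = (INF v\<in>C. E v)"
  have bdd: "bdd_below (E ` C)" using lower by (intro bdd_belowI2) auto
  have IE: "I \<le> E v" if "v \<in> C" for v unfolding I_def by (rule cINF_lower[OF bdd that])
  \<comment> \<open>this rate makes successive distances of the minimizing sequence at most \<open>(1/2)^n\<close>\<close>
  have "\<exists>v\<in>C. E v < I + (1/4)^n/4" for n :: nat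
  proof (rule ccontr)
    assume "\<not> ?thesis"
    hence "I + (1/4)^n/4 \<le> I" unfolding I_def using zero_closed
      by (intro cINF_greatest) (auto simp: not_less)
    moreover have "(0::real) < (1/4)^n" by simp
    ultimately show False by linarith
  qed
  then obtain v where v: "\<And>n. v n \<in> C" and Ev: "\<And>n. E (v n) < I + (1/4)^n/4" by metis
  have mid: "(hnorm H (sub x y))\<^sup>2 / 4 \<le> (E x + E y) / 2 - I" if xy: "x \<in> C" "y \<in> C" for x y
  proof -
    have "I \<le> E (hscale H (1/2) (hadd H x y))" using xy by (intro IE closed)
    also have "\<dots> = (hnorm H (hadd H x y))\<^sup>2 / 4 - Re (L x) - Re (L y)"
      using xy by (simp add: E_def hnorm_scale closed scale add power_mult_distrib power2_eq_square norm_divide add_divide_distrib)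
    finally show ?thesis using parallelogram[OF xy] by (simp add: E_def field_simps)
  qed
  have vd: "hnorm H (sub (v n) (v (Suc n))) \<le> (1/2)^n" for n
  proof (rule power2_le_imp_le)
    define q q' :: real where "q = (1/4)^n" and "q' = (1/4)^Suc n"
    have "q' \<le> q" by (simp add: q_def q'_def)
    moreover have "(hnorm H (sub (v n) (v (Suc n))))\<^sup>2 / 4 \<le> (E (v n) + E (v (Suc n))) / 2 - I"
      by (rule mid[OF v v])
    moreover have "E (v n) < I + q / 4" "E (v (Suc n)) < I + q' / 4"
      unfolding q_def q'_def by (rule Ev)+
    ultimately have "(hnorm H (sub (v n) (v (Suc n))))\<^sup>2 \<le> q" by (simp add: field_simps)
    hence "(hnorm H (sub (v n) (v (Suc n))))\<^sup>2 \<le> (1/4)^n" by (simp only: q_def)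
    thus "(hnorm H (sub (v n) (v (Suc n))))\<^sup>2 \<le> ((1/2)^n)\<^sup>2"
      by (simp add: power2_eq_square flip: power_mult_distrib)
  qed simp
  obtain y where y: "y \<in> C" and lim: "(\<lambda>n. hnorm H (sub (v n) y)) \<longlonglongrightarrow> 0"
    using summable_limit[of v "\<lambda>n. (1/2)^n", OF v vd] summable_geometric[of "1/2::real"] by auto
  have Lsub: "L (sub x w) = L x - L w" if "x \<in> C" "w \<in> C" for x w
    using that add[of x "hscale H (-1) w"] scale[of w "-1"] by (simp add: sub_def closed)
  have "(\<lambda>n. hnorm H (v n)) \<longlonglongrightarrow> hnorm H y"
  proof (rule LIM_zero_cancel, rule Lim_null_comparison[OF _ lim])
    show "\<forall>\<^sub>F n in sequentially. norm (hnorm H (v n) - hnorm H y) \<le> hnorm H (sub (v n) y)"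
      using hnorm_sub_diff[OF v y] by (simp add: real_norm_def)
  qed
  moreover have "(\<lambda>n. L (v n)) \<longlonglongrightarrow> L y"
  proof (rule LIM_zero_cancel)
    have Klim: "(\<lambda>n. K * hnorm H (sub (v n) y)) \<longlonglongrightarrow> 0" using tendsto_mult_right_zero[OF lim] .
    have "norm (L (v n) - L y) \<le> K * hnorm H (sub (v n) y)" for n
      using bd[OF sub_closed[OF v y], of n] unfolding Lsub[OF v y] .
    hence "\<forall>\<^sub>F n in sequentially. norm (L (v n) - L y) \<le> K * hnorm H (sub (v n) y)"
      by (rule always_eventually[OF allI])
    thus "(\<lambda>n. L (v n) - L y) \<longlonglongrightarrow> 0"
      by (rule Lim_null_comparison[OF _ Klim])
  qed
  ultimately have "(\<lambda>n. E (v n)) \<longlonglongrightarrow> E y" unfolding E_def by (intro tendsto_intros) 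
  moreover have "(\<lambda>n. I + (1/4)^n/4) \<longlonglongrightarrow> I + 0/4"
    by (intro tendsto_intros LIMSEQ_power_zero) auto
  ultimately have EyI: "E y \<le> I" using Ev by (intro LIMSEQ_le[of "\<lambda>n. E (v n)"]) (auto intro: less_imp_le)
  \<comment> \<open>the first variation of \<open>E\<close> at its minimum vanishes\<close>
  have var: "Re (hip H y w) = Re (L w)" if w: "w \<in> C" for w
  proof -
    define d where "d = Re (hip H y w) - Re (L w)"
    have quad: "0 \<le> t\<^sup>2 * (hnorm H w)\<^sup>2 + 2 * t * d" for t :: real
    proof -
      have "E y \<le> E (hadd H y (hscale H t w))" using EyI IE[of "hadd H y (hscale H t w)"] w y by (simp add: add_closed scale_closed)
      also have "\<dots> = E y + t\<^sup>2 * (hnorm H w)\<^sup>2 + 2 * t * d"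
        using y w ip_commute[OF y w]
        by (simp add: E_def hnorm_sq ips add scale d_def) (simp add: power2_eq_square algebra_simps)
      finally show ?thesis by simp
    qed
    define q where "q = (hnorm H w)\<^sup>2 + 1"
    have q: "q > 0" "(hnorm H w)\<^sup>2 < q" by (auto simp: q_def add_nonneg_pos)
    have "0 \<le> (d/q)\<^sup>2 * (hnorm H w)\<^sup>2 - 2 * (d/q) * d" using quad[of "- (d/q)"] by simp
    also have "(d/q)\<^sup>2 * (hnorm H w)\<^sup>2 \<le> (d/q)\<^sup>2 * q" using q by (intro mult_left_mono) auto
    also have "(d/q)\<^sup>2 * q - 2 * (d/q) * d = - (d\<^sup>2 / q)" using q by (simp add: field_simps power2_eq_square)
    finally have "d\<^sup>2 / q \<le> 0" by simp
    hence "d = 0" using q by (simp add: divide_le_0_iff)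
    thus ?thesis by (simp add: d_def)
  qed
  have "L w = hip H y w" if w: "w \<in> C" for w
  proof (rule complex_eqI)
    show "Re (L w) = Re (hip H y w)" using var[OF w] by simp
    have "Re (hip H y (hscale H \<i> w)) = Re (L (hscale H \<i> w))" by (rule var) (use w closed in auto)
    thus "Im (L w) = Im (hip H y w)" using w y by (simp add: ips scale)
  qed
  with y show ?thesis using that by blast
qed

end

section \<open>Souslin sets and Blackwell's theorem\<close>

text \<open>Projections of closed sets along the Baire space, the analytic sets of descriptive set theory.\<close>

definition souslin :: "'a topology \<Rightarrow> 'a set \<Rightarrow> bool" where
  "souslin T A \<longleftrightarrow> (\<exists>C. closedin (prod_topology T (euclidean :: (nat \<Rightarrow> nat) topology)) C \<and> A = fst ` C)"

abbreviation "baire \<equiv> (euclidean :: (nat \<Rightarrow> nat) topology)"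

lemma continuous_map_reindex:
  "continuous_map (prod_topology T baire) (prod_topology T baire) (\<lambda>p. (fst p, \<lambda>k. snd p (g k)))"
proof -
  have "continuous_map baire baire (\<lambda>\<gamma>. \<lambda>k. \<gamma> (g k))"
    by (auto intro!: continuous_on_coordinatewise_then_product continuous_on_product_coordinates)
  hence "continuous_map (prod_topology T baire) baire ((\<lambda>\<gamma>. \<lambda>k. \<gamma> (g k)) \<circ> snd)"
    by (rule continuous_map_compose[OF continuous_map_snd])
  thus ?thesis by (auto intro!: continuous_map_pairedI continuous_map_fst simp: o_def)
qed

lemma closedin_reindex:
  assumes "closedin (prod_topology T baire) C"
  shows "closedin (prod_topology T baire) {p \<in> topspace T \<times> UNIV. (fst p, \<lambda>k. snd p (g k)) \<in> C}"
  using closedin_continuous_map_preimage[OF continuous_map_reindex assms] by simp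

lemma closedin_coordinate:
  "closedin (prod_topology T baire) {p \<in> topspace T \<times> UNIV. snd p k \<in> (N::nat set)}"
proof -
  have "continuous_map baire euclidean (\<lambda>\<gamma>. \<gamma> k)"
    by (auto intro: continuous_on_product_coordinates)
  hence c: "continuous_map (prod_topology T baire) euclidean ((\<lambda>\<gamma>. \<gamma> k) \<circ> snd)"
    by (rule continuous_map_compose[OF continuous_map_snd])
  have "closed N" unfolding closed_def by (rule discrete_topology_class.open_discrete)
  thus ?thesis using closedin_continuous_map_preimage[OF c, of N] by simp
qed

lemma souslin_closedin:
  assumes "closedin T A" shows "souslin T A"
  unfolding souslin_def
  by (rule exI[of _ "A \<times> UNIV"]) (use assms in \<open>auto simp: closedin_prod_Times_iff\<close>)

text \<open>The coordinate \<open>0\<close> of the parameter names the set, and the remaining coordinates form a parameter for it.\<close>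

lemma souslin_Union:
  assumes "\<And>n::nat. souslin T (A n)" shows "souslin T (\<Union>n. A n)"
proof -
  obtain C where C: "\<And>n. closedin (prod_topology T baire) (C n)" "\<And>n. A n = fst ` C n"
    using assms unfolding souslin_def by metis
  have CT: "C n \<subseteq> topspace T \<times> UNIV" for n using closedin_subset[OF C(1)[of n]] by simp
  define D where "D = (\<Inter>n. {p \<in> topspace T \<times> UNIV. snd p 0 \<in> - {n}} \<union>
      {p \<in> topspace T \<times> UNIV. (fst p, \<lambda>k. snd p (Suc k)) \<in> C n})"
  have "closedin (prod_topology T baire) D"
    unfolding D_def using C(1) by (intro closedin_INT closedin_Un closedin_coordinate closedin_reindex) auto
  moreover have "(\<Union>n. A n) = fst ` D"
  proof (intro set_eqI iffI)
    fix z assume "z \<in> (\<Union>n. A n)"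
    then obtain n \<gamma> where *: "(z, \<gamma>) \<in> C n" by (auto simp: C(2))
    have "(z, case_nat n \<gamma>) \<in> D" using * CT by (auto simp: D_def)
    thus "z \<in> fst ` D" by force
  next
    fix z assume "z \<in> fst ` D"
    then obtain \<gamma> where "(z, \<gamma>) \<in> D" by force
    hence "(z, \<lambda>k. \<gamma> (Suc k)) \<in> C (\<gamma> 0)" by (auto simp: D_def)
    thus "z \<in> (\<Union>n. A n)" by (force simp: C(2))
  qed
  ultimately show ?thesis unfolding souslin_def by blast
qed

text \<open>One parameter codes a sequence of parameters, by means of a pairing of natural numbers.\<close>

lemma souslin_Inter:
  assumes "\<And>n::nat. souslin T (A n)" shows "souslin T (\<Inter>n. A n)"
proof -
  obtain C where C: "\<And>n. closedin (prod_topology T baire) (C n)" "\<And>n. A n = fst ` C n"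
    using assms unfolding souslin_def by metis
  have CT: "C n \<subseteq> topspace T \<times> UNIV" for n using closedin_subset[OF C(1)[of n]] by simp
  define D where "D = (\<Inter>n. {p \<in> topspace T \<times> UNIV. (fst p, \<lambda>k. snd p (prod_encode (n, k))) \<in> C n})"
  have "closedin (prod_topology T baire) D"
    unfolding D_def using C(1) by (intro closedin_INT closedin_reindex) auto
  moreover have "(\<Inter>n. A n) = fst ` D"
  proof (intro set_eqI iffI)
    fix z assume "z \<in> (\<Inter>n. A n)"
    hence "\<forall>n. \<exists>\<gamma>. (z, \<gamma>) \<in> C n" by (force simp: C(2))
    then obtain \<gamma> where *: "\<And>n. (z, \<gamma> n) \<in> C n" by metis
    have "(z, \<lambda>m. \<gamma> (fst (prod_decode m)) (snd (prod_decode m))) \<in> D"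
      using * CT by (auto simp: D_def)
    thus "z \<in> fst ` D" by force
  next
    fix z assume "z \<in> fst ` D"
    thus "z \<in> (\<Inter>n. A n)" by (force simp: C(2) D_def)
  qed
  ultimately show ?thesis unfolding souslin_def by blast
qed

lemma souslin_openin:
  assumes "metrizable_space T" "openin T A" shows "souslin T A"
proof -
  obtain C where "\<And>n::nat. closedin T (C n)" "\<Union> (range C) = A"
    using open_imp_fsigma_in[OF assms] unfolding fsigma_in_ascending by blast
  thus ?thesis using souslin_Union[of T C] souslin_closedin by blast
qed

lemma souslin_borel:
  assumes T: "metrizable_space T" and A: "A \<in> sigma_sets (topspace T) {U. openin T U}"
  shows "souslin T A \<and> souslin T (topspace T - A)"
  using A
proof (induction A rule: sigma_sets.induct)
  case (Basic U)
  hence U: "openin T U" by simp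
  hence "closedin T (topspace T - U)" using openin_closedin_eq by blast
  thus ?case using souslin_openin[OF T U] souslin_closedin by blast
next
  case Empty
  thus ?case using souslin_closedin[of T] by simp
next
  case (Compl U)
  have "U \<subseteq> topspace T" using sigma_sets_into_sp[OF _ Compl.hyps] openin_subset by blast
  hence "topspace T - (topspace T - U) = U" by blast
  thus ?case using Compl.IH by simp
next
  case (Union A)
  have "topspace T - (\<Union>i. A i) = (\<Inter>i. topspace T - A i)" by auto
  thus ?case using Union.IH souslin_Union[of T A] souslin_Inter[of T "\<lambda>i. topspace T - A i"] by simp
qed

lemma second_countable_separable_metrizable:
  assumes "metrizable_space T" "separable_space T" shows "second_countable T"
proof -
  obtain M d where "Metric_space M d" and T: "T = Metric_space.mtopology M d"
    using assms(1) unfolding metrizable_space_def by blast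
  then interpret Metric_space M d by simp
  obtain D where D: "countable D" "D \<subseteq> M" "mtopology closure_of D = M"
    using assms(2) unfolding separable_space_def T by auto
  define \<B> where "\<B> = (\<lambda>(x, n). mball x (1 / Suc n)) ` (D \<times> (UNIV :: nat set))"
  have "countable \<B>" unfolding \<B>_def using D by auto
  moreover have "\<exists>V\<in>\<B>. x \<in> V \<and> V \<subseteq> U" if U: "openin mtopology U" "x \<in> U" for U x
  proof -
    obtain r where r: "r > 0" "mball x r \<subseteq> U" and x: "x \<in> M"
      using U openin_mtopology openin_subset by (metis subset_iff topspace_mtopology)
    obtain n where n: "1 / Suc n < r / 2" using r by (metis half_gt_zero nat_approx_posE)
    have "x \<in> mtopology closure_of D" using D(3) x by simp
    hence "\<forall>r>0. \<exists>y\<in>D. y \<in> mball x r" unfolding metric_closure_of by blast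
    hence "\<exists>y\<in>D. y \<in> mball x (1 / Suc n)" by (rule allE[of _ "1 / Suc n"]) simp
    then obtain y where y: "y \<in> D" "y \<in> mball x (1 / Suc n)" by blast
    have "mball y (1 / Suc n) \<subseteq> mball x r"
      using y n by (intro mball_subset) (auto simp: in_mball commute)
    hence "x \<in> mball y (1 / Suc n) \<and> mball y (1 / Suc n) \<subseteq> U"
      using y r(2) by (auto simp: in_mball commute)
    thus ?thesis using y(1) unfolding \<B>_def by blast
  qed
  moreover have "\<forall>V\<in>\<B>. openin mtopology V" by (auto simp: \<B>_def)
  ultimately show ?thesis unfolding second_countable_def T by blast
qed

lemma second_countable_prod_topology:
  assumes "second_countable T1" "second_countable T2"
  shows "second_countable (prod_topology T1 T2)"
proof -
  obtain B1 B2 where B: "countable B1" "\<And>V. V \<in> B1 \<Longrightarrow> openin T1 V"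
      "\<And>U x. openin T1 U \<Longrightarrow> x \<in> U \<Longrightarrow> \<exists>V\<in>B1. x \<in> V \<and> V \<subseteq> U"
      "countable B2" "\<And>V. V \<in> B2 \<Longrightarrow> openin T2 V"
      "\<And>U x. openin T2 U \<Longrightarrow> x \<in> U \<Longrightarrow> \<exists>V\<in>B2. x \<in> V \<and> V \<subseteq> U"
    using assms unfolding second_countable_def by metis
  define \<B> where "\<B> = (\<lambda>(V, W). V \<times> W) ` (B1 \<times> B2)"
  have "\<exists>V\<in>\<B>. p \<in> V \<and> V \<subseteq> U" if U: "openin (prod_topology T1 T2) U" "p \<in> U" for U p
  proof -
    obtain V W where VW: "openin T1 V" "openin T2 W" "p \<in> V \<times> W" "V \<times> W \<subseteq> U"
      using U(1)[unfolded openin_prod_topology_alt, rule_format, of "fst p" "snd p"] U(2)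
      by (auto simp: mem_Times_iff)
    obtain V' where V': "V' \<in> B1" "fst p \<in> V'" "V' \<subseteq> V" using B(3)[OF VW(1), of "fst p"] VW(3) by (auto simp: mem_Times_iff)
    obtain W' where W': "W' \<in> B2" "snd p \<in> W'" "W' \<subseteq> W" using B(6)[OF VW(2), of "snd p"] VW(3) by (auto simp: mem_Times_iff)
    have "V' \<times> W' \<in> \<B>" using V' W' by (auto simp: \<B>_def)
    moreover have "p \<in> V' \<times> W'" using V'(2) W'(2) by (simp add: mem_Times_iff)
    moreover have "V' \<times> W' \<subseteq> U" using Sigma_mono[OF V'(3) W'(3)] VW(4) by (rule order_trans)
    ultimately show ?thesis by (intro bexI[of _ "V' \<times> W'"] conjI)
  qed
  moreover have "countable \<B>" unfolding \<B>_def using B(1,4) by auto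
  moreover have "\<forall>V\<in>\<B>. openin (prod_topology T1 T2) V"
    unfolding \<B>_def using B(2,5) by (simp add: openin_prod_Times_iff split_beta)
  ultimately show ?thesis unfolding second_countable_def by blast
qed

lemma second_countable_euclidean:
  "second_countable (euclidean :: 'a::second_countable_topology topology)"
proof -
  obtain B :: "'a set set" where B: "countable B" "topological_basis B"
    using ex_countable_basis by blast
  have "\<exists>V\<in>B. x \<in> V \<and> V \<subseteq> U" if "open U" "x \<in> U" for U x
    using topological_basisE[OF B(2) that] by metis
  moreover have "\<forall>V\<in>B. open V" using topological_basis_open[OF B(2)] by blast
  ultimately show ?thesis unfolding second_countable_def using B(1) by (intro exI[of _ B]) simp
qed

context Metric_space
begin

text \<open>Cantor's intersection argument for sets that need not be closed: the limit point lies in the closed set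
\<open>A\<close> and all its neighbourhoods contain the sets from some index on.\<close>

lemma shrinking_sets_converge:
  assumes complete: "mcomplete" and A: "closedin mtopology A"
    and P: "\<And>n. P n \<noteq> {}" "P 0 \<subseteq> A" "\<And>n. P (Suc n) \<subseteq> P n"
    and ball: "\<And>n. \<exists>c. P (Suc n) \<subseteq> mball c ((1/2)^n)"
  obtains x where "x \<in> A" "\<And>G. openin mtopology G \<Longrightarrow> x \<in> G \<Longrightarrow> \<exists>N. \<forall>n\<ge>N. P n \<subseteq> G"
proof -
  have dec: "m \<le> n \<Longrightarrow> P n \<subseteq> P m" for m n by (rule lift_Suc_antimono_le[of P]) (use P in auto)
  obtain c where c: "\<And>n. P (Suc n) \<subseteq> mball (c n) ((1/2)^n)" using ball by metis
  have small: "d x y < 2 * (1/2)^n" if "x \<in> P (Suc n)" "y \<in> P (Suc n)" for x y n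
  proof -
    have "x \<in> M" "y \<in> M" "c n \<in> M" "d (c n) x < (1/2)^n" "d (c n) y < (1/2)^n"
      using c[of n] that by (auto simp: in_mball)
    thus ?thesis using triangle[of x "c n" y] commute[of x "c n"] by simp
  qed
  have "\<forall>n. \<exists>x. x \<in> P n" using P(1) by auto
  then obtain a where a: "\<And>n. a n \<in> P n" by metis
  have aA: "a n \<in> A" for n using a dec[of 0 n] P(2) by auto
  have AM: "A \<subseteq> M" using closedin_subset[OF A] by simp
  have lim0: "(\<lambda>n. 2 * (1/2)^n :: real) \<longlonglongrightarrow> 2 * 0"
    by (intro tendsto_intros LIMSEQ_power_zero) auto
  have exN: "\<exists>N. 2 * (1/2)^N < e" if "e > 0" for e :: real
    using order_tendstoD(2)[OF lim0, of e] that by (auto simp: eventually_sequentially)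
  have "MCauchy a" unfolding MCauchy_def
  proof (intro conjI allI impI)
    fix e :: real assume "e > 0"
    then obtain N where N: "2 * (1/2)^N < e" using exN by blast
    have "d (a m) (a n) < e" if "m \<ge> Suc N" "n \<ge> Suc N" for m n
    proof -
      have "a m \<in> P (Suc N)" "a n \<in> P (Suc N)" using a that dec by blast+
      thus ?thesis using small N by fastforce
    qed
    thus "\<exists>N. \<forall>n n'. N \<le> n \<longrightarrow> N \<le> n' \<longrightarrow> d (a n) (a n') < e" by blast
  qed (use aA AM in auto)
  then obtain x where x: "limitin mtopology a x sequentially"
    using complete unfolding mcomplete_def by blast
  have xM: "x \<in> M" using x by (simp add: limitin_metric)
  have "x \<in> A"
    by (rule limitin_closedin[OF x A]) (use aA in auto)
  moreover have "\<exists>N. \<forall>n\<ge>N. P n \<subseteq> G" if G: "openin mtopology G" "x \<in> G" for G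
  proof -
    obtain r where r: "r > 0" "mball x r \<subseteq> G" using G openin_mtopology by metis
    obtain N where N: "2 * (1/2)^N < r/2" using exN[of "r/2"] r by auto
    have "y \<in> mball x r" if y: "y \<in> P (Suc N)" for y
    proof -
      have "\<forall>\<^sub>F n in sequentially. a n \<in> M \<and> d (a n) x < r/2"
        using x[unfolded limitin_metric] half_gt_zero[OF r(1)] by blast
      moreover have "\<forall>\<^sub>F n in sequentially. n \<ge> Suc N" by (rule eventually_ge_at_top)
      ultimately have "\<forall>\<^sub>F n in sequentially. d (a n) x < r/2 \<and> n \<ge> Suc N" by eventually_elim simp
      then obtain n where n: "d (a n) x < r/2" "n \<ge> Suc N"
        by (auto simp: eventually_sequentially)
      have "a n \<in> P (Suc N)" using a dec n(2) by blast
      hence "d (a n) y < r/2" using small[OF _ y] N by fastforce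
      moreover have "y \<in> M" "a n \<in> M" using y dec[of 0 "Suc N"] P(2) AM aA by auto
      ultimately show ?thesis using n xM triangle[of x "a n" y] commute[of x "a n"] by (simp add: in_mball)
    qed
    hence "P (Suc N) \<subseteq> G" using r(2) by blast
    thus ?thesis using dec by blast
  qed
  ultimately show ?thesis using that by blast
qed

end

text \<open>Lusin's separation argument. Inseparability passes to one of the pieces of a countable cover, so inseparable
pieces can be chosen of diameter tending to \<open>0\<close> in both sets. They shrink to two points, whose images are told apart
by some \<open>U \<in> \<U>\<close>; since \<open>U\<close> has open preimages, it separates the pieces themselves from some index on.\<close>

lemma separate_disjoint_images:
  assumes R: "completely_metrizable_space R" "second_countable R"
    and g: "g \<in> topspace R \<rightarrow> \<Omega>"
    and U: "\<U> \<subseteq> Pow \<Omega>"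
    and opn: "\<And>U. U \<in> \<U> \<Longrightarrow> openin R {r \<in> topspace R. g r \<in> U}"
      "\<And>U. U \<in> \<U> \<Longrightarrow> openin R {r \<in> topspace R. g r \<notin> U}"
    and AB: "closedin R A" "closedin R B"
    and sep: "\<And>a b. a \<in> A \<Longrightarrow> b \<in> B \<Longrightarrow> \<exists>U\<in>\<U>. (g a \<in> U) \<noteq> (g b \<in> U)"
  shows "\<exists>M\<in>sigma_sets \<Omega> \<U>. g ` A \<subseteq> M \<and> g ` B \<inter> M = {}"
proof (rule ccontr)
  define S where "S P Q \<longleftrightarrow> (\<exists>M\<in>sigma_sets \<Omega> \<U>. g ` P \<subseteq> M \<and> g ` Q \<inter> M = {})" for P Q
  assume "\<not> ?thesis"
  hence nS: "\<not> S A B" by (simp add: S_def)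
  have S_Union1: "S (\<Union>n::nat. P n) Q" if S: "\<And>n. S (P n) Q" for P Q
  proof -
    obtain M where M: "\<And>n. M n \<in> sigma_sets \<Omega> \<U>" "\<And>n. g ` P n \<subseteq> M n" "\<And>n. g ` Q \<inter> M n = {}"
      using S unfolding S_def by metis
    have "(\<Union>n. M n) \<in> sigma_sets \<Omega> \<U>" by (rule sigma_sets.Union[OF M(1)])
    thus ?thesis unfolding S_def using M(2,3) by (intro bexI[of _ "\<Union>n. M n"]) fastforce+
  qed
  have S_Union2: "S P (\<Union>n::nat. Q n)" if S: "\<And>n. S P (Q n)" for P Q
  proof -
    obtain M where M: "\<And>n. M n \<in> sigma_sets \<Omega> \<U>" "\<And>n. g ` P \<subseteq> M n" "\<And>n. g ` Q n \<inter> M n = {}"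
      using S unfolding S_def by metis
    have "(\<Inter>n. M n) \<in> sigma_sets \<Omega> \<U>" by (rule sigma_sets_Inter[OF U M(1)]) 
    thus ?thesis unfolding S_def using M(2,3) by (intro bexI[of _ "\<Inter>n. M n"]) fastforce+
  qed
  have S_empty: "S {} Q" for Q
    unfolding S_def by (intro bexI[OF _ sigma_sets.Empty]) auto
  obtain M d where "Metric_space M d" and mc: "Metric_space.mcomplete M d" and RM: "R = Metric_space.mtopology M d"
    using R(1) unfolding completely_metrizable_space_def by blast
  then interpret Metric_space M d by simp
  have AM: "A \<subseteq> M" "B \<subseteq> M" using AB closedin_subset RM by (metis topspace_mtopology)+
  have gM: "g \<in> M \<rightarrow> \<Omega>" using g by (simp add: RM)
  have "A \<noteq> {}"
    using nS S_empty by metis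
  obtain D where D: "countable D" "D \<subseteq> M" "mtopology closure_of D = M"
    using second_countable_imp_separable_space[OF R(2)] unfolding separable_space_def RM by auto
  have "D \<noteq> {}" using D \<open>A \<noteq> {}\<close> AM by auto
  define e where "e = from_nat_into D"
  have e: "range e = D" unfolding e_def by (rule range_from_nat_into[OF \<open>D \<noteq> {}\<close> D(1)])
  have cover: "P = (\<Union>i::nat. P \<inter> mball (e i) r)" if "P \<subseteq> M" "r > 0" for P r
  proof -
    have "x \<in> (\<Union>i. mball (e i) r)" if x: "x \<in> P" for x
    proof -
      have "x \<in> mtopology closure_of D" using D(3) x \<open>P \<subseteq> M\<close> by auto
      hence "\<forall>r>0. \<exists>y\<in>D. y \<in> mball x r" unfolding metric_closure_of by blast
      then obtain y where "y \<in> D" "y \<in> mball x r" using \<open>r > 0\<close> by blast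
      thus ?thesis using e by (auto simp: in_mball commute)
    qed
    thus ?thesis by auto
  qed
  have step: "\<exists>i j. \<not> S (P \<inter> mball (e i) r) (Q \<inter> mball (e j) r)"
    if PQ: "\<not> S P Q" "P \<subseteq> M" "Q \<subseteq> M" "r > 0" for P Q r
  proof (rule ccontr)
    assume "\<not> ?thesis"
    hence "S (P \<inter> mball (e i) r) (\<Union>j. Q \<inter> mball (e j) r)" for i by (intro S_Union2) auto
    hence "S (\<Union>i. P \<inter> mball (e i) r) (\<Union>j. Q \<inter> mball (e j) r)" by (intro S_Union1)
    thus False using PQ cover by metis
  qed
  have "\<exists>f. \<forall>n. (\<not> S (fst (f n)) (snd (f n)) \<and> fst (f n) \<subseteq> A \<and> snd (f n) \<subseteq> B) \<and>
      (fst (f (Suc n)) \<subseteq> fst (f n) \<and> snd (f (Suc n)) \<subseteq> snd (f n) \<and>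
       (\<exists>c. fst (f (Suc n)) \<subseteq> mball c ((1/2)^n)) \<and> (\<exists>c. snd (f (Suc n)) \<subseteq> mball c ((1/2)^n)))"
  proof (rule dependent_nat_choice)
    show "\<exists>x. \<not> S (fst x) (snd x) \<and> fst x \<subseteq> A \<and> snd x \<subseteq> B"
      using nS by (intro exI[of _ "(A, B)"]) auto
  next
    fix x :: "'a set \<times> 'a set" and n :: nat
    assume x: "\<not> S (fst x) (snd x) \<and> fst x \<subseteq> A \<and> snd x \<subseteq> B"
    have "\<exists>i j. \<not> S (fst x \<inter> mball (e i) ((1/2)^n)) (snd x \<inter> mball (e j) ((1/2)^n))"
      by (rule step) (use x AM in auto)
    then obtain i j where "\<not> S (fst x \<inter> mball (e i) ((1/2)^n)) (snd x \<inter> mball (e j) ((1/2)^n))"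
      by blast
    thus "\<exists>y. (\<not> S (fst y) (snd y) \<and> fst y \<subseteq> A \<and> snd y \<subseteq> B) \<and> fst y \<subseteq> fst x \<and> snd y \<subseteq> snd x \<and>
        (\<exists>c. fst y \<subseteq> mball c ((1/2)^n)) \<and> (\<exists>c. snd y \<subseteq> mball c ((1/2)^n))"
      using x by (intro exI[of _ "(fst x \<inter> mball (e i) ((1/2)^n), snd x \<inter> mball (e j) ((1/2)^n))"]) auto
  qed
  then obtain f where f: "\<And>n. \<not> S (fst (f n)) (snd (f n))" "\<And>n. fst (f n) \<subseteq> A" "\<And>n. snd (f n) \<subseteq> B"
      "\<And>n. fst (f (Suc n)) \<subseteq> fst (f n)" "\<And>n. snd (f (Suc n)) \<subseteq> snd (f n)"
      "\<And>n. \<exists>c. fst (f (Suc n)) \<subseteq> mball c ((1/2)^n)" "\<And>n. \<exists>c. snd (f (Suc n)) \<subseteq> mball c ((1/2)^n)"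
    by metis
  have Om: "\<Omega> \<in> sigma_sets \<Omega> \<U>" by (rule sigma_sets_top)
  have ne1: "fst (f n) \<noteq> {}" for n
    using f(1)[of n] S_empty by metis
  have ne2: "snd (f n) \<noteq> {}" for n
  proof
    assume "snd (f n) = {}"
    hence "S (fst (f n)) (snd (f n))" unfolding S_def
      using f(2)[of n] AM gM by (intro bexI[OF _ Om]) (auto simp: Pi_iff subset_iff)
    thus False using f(1) by blast
  qed
  obtain a where a: "a \<in> A" "\<And>G. openin mtopology G \<Longrightarrow> a \<in> G \<Longrightarrow> \<exists>N. \<forall>n\<ge>N. fst (f n) \<subseteq> G"
    using shrinking_sets_converge[OF mc, of A "\<lambda>n. fst (f n)"] AB(1) RM ne1 f(2,4,6) by metis
  obtain b where b: "b \<in> B" "\<And>G. openin mtopology G \<Longrightarrow> b \<in> G \<Longrightarrow> \<exists>N. \<forall>n\<ge>N. snd (f n) \<subseteq> G"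
    using shrinking_sets_converge[OF mc, of B "\<lambda>n. snd (f n)"] AB(2) RM ne2 f(3,5,7) by metis
  obtain U where UU: "U \<in> \<U>" "(g a \<in> U) \<noteq> (g b \<in> U)" using sep a(1) b(1) by blast
  let ?I = "{r \<in> M. g r \<in> U}" and ?O = "{r \<in> M. g r \<notin> U}"
  have op: "openin mtopology ?I" "openin mtopology ?O" using opn[OF UU(1)] by (auto simp: RM)
  have ab: "a \<in> M" "b \<in> M" using a(1) b(1) AM by auto
  show False
  proof (cases "g a \<in> U")
    case True
    obtain N1 N2 where "\<forall>n\<ge>N1. fst (f n) \<subseteq> ?I" "\<forall>n\<ge>N2. snd (f n) \<subseteq> ?O"
      using a(2)[OF op(1)] b(2)[OF op(2)] True UU ab by auto
    hence "fst (f (max N1 N2)) \<subseteq> ?I" "snd (f (max N1 N2)) \<subseteq> ?O" by auto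
    hence "S (fst (f (max N1 N2))) (snd (f (max N1 N2)))"
      unfolding S_def by (intro bexI[OF _ sigma_sets.Basic[OF UU(1)]]) auto
    thus False using f(1) by blast
  next
    case False
    obtain N1 N2 where "\<forall>n\<ge>N1. fst (f n) \<subseteq> ?O" "\<forall>n\<ge>N2. snd (f n) \<subseteq> ?I"
      using a(2)[OF op(2)] b(2)[OF op(1)] False UU ab by auto
    hence "fst (f (max N1 N2)) \<subseteq> ?O" "snd (f (max N1 N2)) \<subseteq> ?I" by auto
    hence "S (fst (f (max N1 N2))) (snd (f (max N1 N2)))"
      unfolding S_def using gM
      by (intro bexI[OF _ sigma_sets.Compl[OF sigma_sets.Basic[OF UU(1)]]]) auto
    thus False using f(1) by blast
  qed
qed

text \<open>For a Borel set \<open>E\<close>, the Souslin representations of \<open>E\<close>, of the sets \<open>U n\<close> and of all complements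
are combined into one Polish space \<open>K\<close> that projects onto the whole space and on which the preimages of these sets are
clopen. The two preimages of \<open>E\<close> and of its complement are then closed, so their images are separated by a set
generated by the \<open>U n\<close>, which can only be \<open>E\<close>.\<close>

theorem countable_separating_generates:
  assumes Z: "standard_borel_space Z" and U: "\<And>n::nat. U n \<in> sets Z"
    and sep: "\<And>x y. x \<in> space Z \<Longrightarrow> y \<in> space Z \<Longrightarrow> x \<noteq> y \<Longrightarrow> \<exists>n. (x \<in> U n) \<noteq> (y \<in> U n)"
  shows "sets Z = sigma_sets (space Z) (range U)"
proof
  show "sigma_sets (space Z) (range U) \<subseteq> sets Z"
    using U by (intro sets.sigma_sets_subset) auto
  show "sets Z \<subseteq> sigma_sets (space Z) (range U)"
  proof
    fix E assume E: "E \<in> sets Z"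
    obtain T where T: "completely_metrizable_space T" "separable_space T" "topspace T = space Z"
        "sets Z = sigma_sets (topspace T) {U. openin T U}"
      using Z unfolding standard_borel_space_def by blast
    have mT: "metrizable_space T" using T(1) by (rule completely_metrizable_imp_metrizable_space)
    define V where "V = case_nat E U"
    have V: "V n \<in> sets Z" for n using E U by (auto simp: V_def split: nat.split)
    define b where "b = (\<lambda>n::nat. \<lambda>k. prod_encode (n, k))"
    have "\<exists>C C'. closedin (prod_topology T baire) C \<and> V n = fst ` C \<and>
        closedin (prod_topology T baire) C' \<and> topspace T - V n = fst ` C'" for n
      using souslin_borel[OF mT, of "V n"] V[of n] unfolding T(4) souslin_def by blast
    then obtain C C' where C: "\<And>n. closedin (prod_topology T baire) (C n)" "\<And>n. V n = fst ` C n"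
        "\<And>n. closedin (prod_topology T baire) (C' n)" "\<And>n. topspace T - V n = fst ` C' n"
      by metis
    have CT: "C n \<subseteq> topspace T \<times> UNIV" "C' n \<subseteq> topspace T \<times> UNIV" for n
      using closedin_subset[OF C(1)[of n]] closedin_subset[OF C(3)[of n]] by auto
    let ?X = "topspace T \<times> (UNIV :: (nat \<Rightarrow> nat) set)"
    \<comment> \<open>the coordinate \<open>b n 0\<close> of the parameter decides whether the point lies in \<open>V n\<close>, and the coordinates \<open>b n (Suc k)\<close> certify it\<close>
    define K where "K = (\<Inter>n.
       ({p \<in> ?X. snd p (b n 0) \<in> {0}} \<inter> {p \<in> ?X. (fst p, \<lambda>k. snd p (b n (Suc k))) \<in> C n}) \<union>
       ({p \<in> ?X. snd p (b n 0) \<in> - {0}} \<inter> {p \<in> ?X. (fst p, \<lambda>k. snd p (b n (Suc k))) \<in> C' n}))"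
    have Kc: "closedin (prod_topology T baire) K"
      unfolding K_def using C(1,3)
      by (intro closedin_INT closedin_Un closedin_Int closedin_coordinate closedin_reindex) auto
    have KX: "K \<subseteq> ?X" using closedin_subset[OF Kc] by simp
    have Kdec: "fst p \<in> V n \<longleftrightarrow> snd p (b n 0) = 0" if p: "p \<in> K" for p n
    proof -
      have "(snd p (b n 0) = 0 \<and> (fst p, \<lambda>k. snd p (b n (Suc k))) \<in> C n) \<or>
            (snd p (b n 0) \<noteq> 0 \<and> (fst p, \<lambda>k. snd p (b n (Suc k))) \<in> C' n)"
        using p unfolding K_def by blast
      moreover have "fst p \<in> V n" if "(fst p, \<gamma>) \<in> C n" for \<gamma>
        using imageI[OF that, of fst] C(2) by simp
      moreover have "fst p \<in> topspace T - V n" if "(fst p, \<gamma>) \<in> C' n" for \<gamma>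
        unfolding C(4) using imageI[OF that, of fst] by simp
      ultimately show ?thesis by blast
    qed
    have Ksurj: "\<exists>\<gamma>. (z, \<gamma>) \<in> K" if z: "z \<in> topspace T" for z
    proof -
      have "\<exists>\<gamma>. if z \<in> V n then (z, \<gamma>) \<in> C n else (z, \<gamma>) \<in> C' n" for n
        using C(2)[of n] C(4)[of n] z by (cases "z \<in> V n") force+
      then obtain \<gamma> where \<gamma>: "\<And>n. if z \<in> V n then (z, \<gamma> n) \<in> C n else (z, \<gamma> n) \<in> C' n" by metis
      define \<delta> where "\<delta> m = (case prod_decode m of (n, k) \<Rightarrow>
         case_nat (if z \<in> V n then 0 else 1) (\<gamma> n) k)" for m
      have "\<delta> (b n k) = case_nat (if z \<in> V n then 0 else 1) (\<gamma> n) k" for n k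
        by (simp add: \<delta>_def b_def)
      hence "(z, \<delta>) \<in> K" unfolding K_def using \<gamma> z by (auto split: if_splits)
      thus ?thesis by blast
    qed
    define R where "R = subtopology (prod_topology T baire) K"
    have tR: "topspace R = K" using KX by (auto simp: R_def)
    have "discrete_topology UNIV = (euclidean :: nat topology)"
      unfolding discrete_topology_unique by (simp add: discrete_topology_class.open_discrete)
    hence "completely_metrizable_space (euclidean :: nat topology)"
      using completely_metrizable_space_discrete_topology by metis
    hence "completely_metrizable_space (product_topology (\<lambda>_::nat. euclidean :: nat topology) UNIV)"
      unfolding completely_metrizable_space_product_topology by auto
    hence cb: "completely_metrizable_space baire" by (simp only: euclidean_product_topology)
    have R1: "completely_metrizable_space R" unfolding R_def
      by (rule completely_metrizable_space_closedin[OF _ Kc])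
        (use T(1) cb in \<open>auto simp: completely_metrizable_space_prod_topology\<close>)
    have R2: "second_countable R" unfolding R_def
      by (intro second_countable_subtopology second_countable_prod_topology second_countable_euclidean
          second_countable_separable_metrizable mT T(2))
    have cl: "closedin R {r \<in> K. snd r k \<in> N}" for k N
    proof -
      have "{r \<in> K. snd r k \<in> N} = {p \<in> ?X. snd p k \<in> N} \<inter> K" using KX by auto
      thus ?thesis unfolding R_def closedin_subtopology using closedin_coordinate by blast
    qed
    have "\<exists>M\<in>sigma_sets (space Z) (range U). fst ` {r \<in> K. snd r (b 0 0) \<in> {0}} \<subseteq> M \<and>
        fst ` {r \<in> K. snd r (b 0 0) \<in> - {0}} \<inter> M = {}"
    proof (rule separate_disjoint_images[OF R1 R2])
      show "fst \<in> topspace R \<rightarrow> space Z" using KX T(3) by (auto simp: tR)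
      show "range U \<subseteq> Pow (space Z)" using U sets.sets_into_space by blast
      fix W assume "W \<in> range U"
      then obtain n where n: "W = V (Suc n)" by (auto simp: V_def)
      have eq: "topspace R - {r \<in> topspace R. fst r \<in> W} = {r \<in> K. snd r (b (Suc n) 0) \<in> - {0}}"
          "topspace R - {r \<in> topspace R. fst r \<notin> W} = {r \<in> K. snd r (b (Suc n) 0) \<in> {0}}"
        using Kdec[of _ "Suc n"] by (auto simp: n tR)
      show "openin R {r \<in> topspace R. fst r \<in> W}" "openin R {r \<in> topspace R. fst r \<notin> W}"
        unfolding openin_closedin_eq eq by (intro conjI cl; blast)+
    next
      fix p q assume "p \<in> {r \<in> K. snd r (b 0 0) \<in> {0}}" "q \<in> {r \<in> K. snd r (b 0 0) \<in> - {0}}"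
      hence pq: "p \<in> K" "q \<in> K" "fst p \<in> V 0" "fst q \<notin> V 0" using Kdec[of p 0] Kdec[of q 0] by simp_all
      have "fst p \<noteq> fst q" using pq(3,4) by metis
      moreover have "fst p \<in> space Z" "fst q \<in> space Z"
        using pq(1,2)[THEN subsetD[OF KX]] unfolding T(3) mem_Times_iff by (simp_all only:)
      ultimately obtain n where "(fst p \<in> U n) \<noteq> (fst q \<in> U n)" using sep by metis
      thus "\<exists>W\<in>range U. (fst p \<in> W) \<noteq> (fst q \<in> W)" by (intro bexI[of _ "U n"] rangeI)
    qed (rule cl)+
    then obtain M where M: "M \<in> sigma_sets (space Z) (range U)" "fst ` {r \<in> K. snd r (b 0 0) \<in> {0}} \<subseteq> M"
        "fst ` {r \<in> K. snd r (b 0 0) \<in> - {0}} \<inter> M = {}" by blast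
    have MZ: "M \<subseteq> space Z" using M(1) U sets.sets_into_space by (metis sigma_sets_into_sp image_subset_iff Pow_iff)
    have "E = M"
    proof (intro set_eqI)
      fix z show "z \<in> E \<longleftrightarrow> z \<in> M"
      proof (cases "z \<in> space Z")
        case True
        then obtain \<gamma> where "(z, \<gamma>) \<in> K" using Ksurj T(3) by auto
        thus ?thesis using Kdec[of "(z, \<gamma>)" 0] M(2,3) by (force simp: V_def)
      next
        case False
        thus ?thesis using MZ sets.sets_into_space[OF E] by auto
      qed
    qed
    thus "E \<in> sigma_sets (space Z) (range U)" using M(1) by simp
  qed
qed

section \<open>Completely positive maps\<close>

definition selfadjoint_subspace :: "'a::unital_cstar_algebra set \<Rightarrow> bool" where
  "selfadjoint_subspace D \<longleftrightarrow> module.subspace scaleC D \<and> (\<forall>x\<in>D. star x \<in> D) \<and> 1 \<in> D"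

lemma selfadjoint_subspace_UNIV: "selfadjoint_subspace UNIV"
  by (simp add: selfadjoint_subspace_def module.subspace_UNIV[OF module_scaleC])

lemma selfadjoint_subspaceD:
  assumes "selfadjoint_subspace D"
  shows "x \<in> D \<Longrightarrow> star x \<in> D" "1 \<in> D" "0 \<in> D" "x \<in> D \<Longrightarrow> scaleC c x \<in> D" "x \<in> D \<Longrightarrow> r *\<^sub>R x \<in> D"
    "x \<in> D \<Longrightarrow> y \<in> D \<Longrightarrow> x + y \<in> D"
  using assms module.subspace_0[OF module_scaleC, of D] module.subspace_scale[OF module_scaleC, of D]
    module.subspace_add[OF module_scaleC, of D]
  by (auto simp: selfadjoint_subspace_def scaleR_eq_scaleC)

lemma operator_linear_onD:
  assumes "operator_linear_on D H \<psi>" "a \<in> D" "v \<in> hcarrier H"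
  shows "\<psi> a v \<in> hcarrier H" "w \<in> hcarrier H \<Longrightarrow> \<psi> a (hadd H v w) = hadd H (\<psi> a v) (\<psi> a w)"
    "\<psi> a (hscale H c v) = hscale H c (\<psi> a v)"
    "b \<in> D \<Longrightarrow> \<psi> (a + b) v = hadd H (\<psi> a v) (\<psi> b v)"
    "\<psi> (scaleC c a) v = hscale H c (\<psi> a v)"
    "\<psi> a \<in> extensional (hcarrier H)"
proof -
  have "\<psi> a \<in> bounded_operators H" using assms by (auto simp: operator_linear_on_def)
  thus "\<psi> a v \<in> hcarrier H" "w \<in> hcarrier H \<Longrightarrow> \<psi> a (hadd H v w) = hadd H (\<psi> a v) (\<psi> a w)"
    "\<psi> a (hscale H c v) = hscale H c (\<psi> a v)" "\<psi> a \<in> extensional (hcarrier H)"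
    using assms(3) by (auto simp: bounded_operators_def PiE_def)
  show "b \<in> D \<Longrightarrow> \<psi> (a + b) v = hadd H (\<psi> a v) (\<psi> b v)"
    "\<psi> (scaleC c a) v = hscale H c (\<psi> a v)"
    using assms by (auto simp: operator_linear_on_def)
qed

lemma cp_mapD:
  assumes "cp_map D H \<psi>" "\<And>i j. i < n \<Longrightarrow> j < n \<Longrightarrow> a i j \<in> D" "positive_matrix n a"
    "\<And>i. i < n \<Longrightarrow> v i \<in> hcarrier H"
  shows "(\<Sum>i<n. \<Sum>j<n. hip H (\<psi> (a i j) (v j)) (v i)) \<in> \<real>\<^sub>\<ge>\<^sub>0"
proof -
  have "(\<forall>i<n. \<forall>j<n. a i j \<in> D) \<and> positive_matrix n a \<longrightarrow> (\<forall>v. (\<forall>i<n. v i \<in> hcarrier H) \<longrightarrow>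
      (\<Sum>i<n. \<Sum>j<n. hip H (\<psi> (a i j) (v j)) (v i)) \<in> \<real>\<^sub>\<ge>\<^sub>0)"
    using assms(1) unfolding cp_map_def by (elim conjE allE)
  with assms(2-4) show ?thesis by simp
qed

context hilbert_space
begin

lemma operator_linear_sub:
  assumes "operator_linear_on D H \<psi>" "a \<in> D" "v \<in> C" "w \<in> C"
  shows "\<psi> a (sub v w) = sub (\<psi> a v) (\<psi> a w)"
  using assms by (simp add: sub_def operator_linear_onD closed)

text \<open>For \<open>norm s < 1\<close> the matrix with diagonal entries \<open>1\<close> and off-diagonal entries \<open>s\<close> and \<open>star s\<close> is
positive; a factorization is found by completing the square. All its entries lie in an operator system that contains
\<open>s\<close>, so the estimate is available on \<open>S\<close> and not only on the whole algebra.\<close>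

lemma cp_two_by_two:
  assumes cp: "cp_map D H \<psi>" and one: "\<psi> 1 = (\<lambda>v\<in>C. v)" and D: "selfadjoint_subspace D"
    and s: "s \<in> D" "norm s < 1" and v: "v \<in> C" "w \<in> C"
  shows "hip H v v + hip H (\<psi> s w) v + hip H (\<psi> (star s) v) w + hip H w w \<in> \<real>\<^sub>\<ge>\<^sub>0"
proof -
  obtain c where c: "star s * s + star c * c = 1"
    using complete_square_to_scalar[OF s(2)] by auto
  define a where "a i j = (if i = (0::nat) then if j = (0::nat) then 1 else s else if j = 0 then star s else 1)" for i j
  define b where "b k i = (if k = (0::nat) then if i = (0::nat) then 1 else s else if i = 0 then 0 else c)" for k i
  define u where "u i = (if i = (0::nat) then v else w)" for i
  have "positive_matrix 2 a"
    unfolding positive_matrix_def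
    by (rule exI[of _ b]) (auto simp: a_def b_def numeral_2_eq_2 less_Suc_eq c)
  moreover have "a i j \<in> D" for i j using s selfadjoint_subspaceD[OF D] by (simp add: a_def)
  moreover have "u i \<in> C" for i using v by (simp add: u_def)
  ultimately have "(\<Sum>i<2. \<Sum>j<2. hip H (\<psi> (a i j) (u j)) (u i)) \<in> \<real>\<^sub>\<ge>\<^sub>0"
    by (intro cp_mapD[OF cp])
  thus ?thesis using v by (simp add: numeral_2_eq_2 a_def u_def one algebra_simps)
qed

lemma ucp_hermitian:
  assumes cp: "cp_map D H \<psi>" and one: "\<psi> 1 = (\<lambda>v\<in>C. v)" and D: "selfadjoint_subspace D"
    and s: "s \<in> D" and v: "v \<in> C" "w \<in> C"
  shows "hip H (\<psi> (star s) v) w = hip H v (\<psi> s w)"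
proof -
  have lin: "operator_linear_on D H \<psi>" using cp by (simp add: cp_map_def)
  define r where "r = norm s + 1"
  have r: "r > 0" "norm s < r" using norm_ge_zero[of s] by (auto simp: r_def simp del: norm_ge_zero)
  define t where "t = scaleC (1 / of_real r) s"
  have t: "t \<in> D" "star t \<in> D" "norm t < 1"
    using s r selfadjoint_subspaceD[OF D] by (auto simp: t_def norm_scaleC norm_divide)
  have st: "star t = scaleC (1 / of_real r) (star s)" by (simp add: t_def star_scaleC)
  have C: "\<psi> t x \<in> C" "\<psi> (star t) x \<in> C" if "x \<in> C" for x
    using operator_linear_onD(1)[OF lin] t that by auto
  have real: "Im (hip H (\<psi> t y) x + hip H (\<psi> (star t) x) y) = 0" if "x \<in> C" "y \<in> C" for x y
    using cp_two_by_two[OF cp one D t(1,3) that] that by (simp add: complex_nonneg_Reals_iff ip_self)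
  have "hip H (\<psi> (star t) v) w = hip H v (\<psi> t w)"
  proof (rule complex_eqI)
    have sw: "hip H v (\<psi> t w) = cnj (hip H (\<psi> t w) v)" using v C ip_commute by blast
    show "Im (hip H (\<psi> (star t) v) w) = Im (hip H v (\<psi> t w))"
      using real[OF v] by (simp add: sw)
    have "Im (hip H (\<psi> t (hscale H \<i> w)) v + hip H (\<psi> (star t) v) (hscale H \<i> w)) = 0"
      by (rule real) (use v closed in auto)
    thus "Re (hip H (\<psi> (star t) v) w) = Re (hip H v (\<psi> t w))"
      using v C t by (simp add: sw operator_linear_onD[OF lin] ips)
  qed
  moreover have "\<psi> t w = hscale H (1 / of_real r) (\<psi> s w)" "\<psi> (star t) v = hscale H (1 / of_real r) (\<psi> (star s) v)"
    unfolding st unfolding t_def using s v selfadjoint_subspaceD[OF D] by (auto simp: operator_linear_onD[OF lin])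
  moreover have "\<psi> s w \<in> C" "\<psi> (star s) v \<in> C" using s v selfadjoint_subspaceD[OF D] operator_linear_onD(1)[OF lin] by auto
  ultimately show ?thesis using v r by (simp add: ips)
qed

lemma ucp_contractive:
  assumes cp: "cp_map D H \<psi>" and one: "\<psi> 1 = (\<lambda>v\<in>C. v)" and D: "selfadjoint_subspace D"
    and s: "s \<in> D" and w: "w \<in> C"
  shows "hnorm H (\<psi> s w) \<le> norm s * hnorm H w"
proof -
  have lin: "operator_linear_on D H \<psi>" using cp by (simp add: cp_map_def)
  have unit: "hnorm H (\<psi> t w) \<le> hnorm H w" if t: "t \<in> D" "norm t < 1" for t
  proof -
    define u where "u = \<psi> t w"
    have u: "u \<in> C" unfolding u_def using operator_linear_onD(1)[OF lin t(1) w] .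
    define v where "v = hscale H (-1) u"
    have v: "v \<in> C" using u by (simp add: v_def closed)
    have "Re (hip H v v + hip H (\<psi> t w) v + hip H (\<psi> (star t) v) w + hip H w w) \<ge> 0"
      using cp_two_by_two[OF cp one D t v w] by (simp add: complex_nonneg_Reals_iff)
    also have "hip H (\<psi> (star t) v) w = hip H v u"
      using ucp_hermitian[OF cp one D t(1) v w] by (simp add: u_def)
    finally have "(hnorm H u)\<^sup>2 \<le> (hnorm H w)\<^sup>2"
      using u w by (simp add: v_def ips hnorm_sq flip: u_def)
    thus ?thesis unfolding u_def[symmetric] using hnorm_nonneg[OF w] by (rule power2_le_imp_le)
  qed
  have "hnorm H (\<psi> s w) \<le> (norm s + e) * hnorm H w" if e: "e > 0" for e
  proof -
    define r where "r = norm s + e"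
    have r: "r > 0" "norm s < r" using e by (auto simp: r_def add_nonneg_pos)
    have "hnorm H (\<psi> (scaleC (1 / of_real r) s) w) \<le> hnorm H w"
      by (rule unit) (use s r selfadjoint_subspaceD[OF D] in \<open>auto simp: norm_scaleC norm_divide\<close>)
    moreover have "hnorm H (\<psi> (scaleC (1 / of_real r) s) w) = hnorm H (\<psi> s w) / r"
      using r operator_linear_onD[OF lin s w] by (simp add: hnorm_scale norm_divide)
    ultimately have "hnorm H (\<psi> s w) \<le> r * hnorm H w" using r by (simp add: field_simps)
    thus ?thesis by (simp only: r_def)
  qed
  hence lim: "\<forall>\<^sub>F e in at_right (0::real). hnorm H (\<psi> s w) \<le> (norm s + e) * hnorm H w"
    by (rule eventually_mono[OF eventually_at_right_less])
  have "((\<lambda>e. (norm s + e) * hnorm H w) \<longlongrightarrow> (norm s + 0) * hnorm H w) (at_right (0::real))"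
    by (intro tendsto_intros)
  from tendsto_lowerbound[OF this lim] show ?thesis by simp
qed

text \<open>Rank-one matrices \<open>star (b i) * b j\<close> test complete positivity. Working with them avoids the deeper fact
that sums of positive matrices are positive in the sense of \<open>positive_matrix\<close>.\<close>

lemma cp_gram:
  fixes n :: nat
  assumes cp: "cp_map UNIV H \<psi>" and v: "\<And>i. i < n \<Longrightarrow> v i \<in> C"
  shows "0 \<le> (\<Sum>i<n. \<Sum>j<n. Re (hip H (\<psi> (star (b i) * b j) (v j)) (v i)))"
proof -
  have "positive_matrix n (\<lambda>i j. star (b i) * b j)"
    unfolding positive_matrix_def
  proof (rule exI[of _ "\<lambda>k i. if k = 0 then b i else 0"], intro allI impI)
    fix i j assume "i < n" "j < n"
    have "(\<Sum>k<n. star (if k = 0 then b i else 0) * (if k = 0 then b j else 0)) =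
        (\<Sum>k<n. if k = 0 then star (b i) * b j else 0)" by (intro sum.cong) auto
    also have "\<dots> = star (b i) * b j" using \<open>i < n\<close> by simp
    finally show "star (b i) * b j = (\<Sum>k<n. star (if k = 0 then b i else 0) * (if k = 0 then b j else 0))" ..
  qed
  hence "(\<Sum>i<n. \<Sum>j<n. hip H (\<psi> (star (b i) * b j) (v j)) (v i)) \<in> \<real>\<^sub>\<ge>\<^sub>0"
    using v by (intro cp_mapD[OF cp]) auto
  hence "0 \<le> Re (\<Sum>i<n. \<Sum>j<n. hip H (\<psi> (star (b i) * b j) (v j)) (v i))"
    by (simp add: complex_nonneg_Reals_iff)
  thus ?thesis by simp
qed

primrec partial_sum :: "(nat \<Rightarrow> 'v) \<Rightarrow> nat \<Rightarrow> 'v" where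
  "partial_sum f 0 = hzero H"
| "partial_sum f (Suc m) = hadd H (partial_sum f m) (f m)"

lemma partial_sum_closed: "(\<And>j. j < m \<Longrightarrow> f j \<in> C) \<Longrightarrow> partial_sum f m \<in> C"
  by (induction m) (auto simp: closed)

lemma ip_partial_sum:
  assumes "y \<in> C"
  shows "(\<And>j. j < m \<Longrightarrow> f j \<in> C) \<Longrightarrow> hip H (partial_sum f m) y = (\<Sum>j<m. hip H (f j) y)"
    "(\<And>j. j < m \<Longrightarrow> f j \<in> C) \<Longrightarrow> hip H y (partial_sum f m) = (\<Sum>j<m. hip H y (f j))"
  by (induction m) (use assms in \<open>auto simp: ips partial_sum_closed\<close>)

text \<open>For a representation, the quadratic form of \<open>b\<^sup>* b\<close> at \<open>v\<close> is the sum over \<open>k\<close> of the squared norms of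
\<open>s k\<close>, the sum over \<open>j\<close> of \<open>\<pi> (b k j) (v j)\<close>.\<close>

lemma representation_cp:
  fixes \<pi> :: "'a::unital_cstar_algebra \<Rightarrow> 'v \<Rightarrow> 'v"
  assumes rep: "representation H \<pi>"
  shows "cp_map UNIV H \<pi>"
  unfolding cp_map_def
proof (intro conjI allI impI)
  show lin: "operator_linear_on UNIV H \<pi>" using rep by (simp add: representation_def)
  note L = operator_linear_onD[OF lin UNIV_I]
  fix n :: nat and a :: "nat \<Rightarrow> nat \<Rightarrow> 'a" and v :: "nat \<Rightarrow> 'v"
  assume "(\<forall>i<n. \<forall>j<n. a i j \<in> UNIV) \<and> positive_matrix n a" and v: "\<forall>i<n. v i \<in> C"
  then obtain b where b: "\<And>i j. i < n \<Longrightarrow> j < n \<Longrightarrow> a i j = (\<Sum>k<n. star (b k i) * b k j)"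
    unfolding positive_matrix_def by blast
  have zero: "\<pi> 0 x = hzero H" if "x \<in> C" for x
    using L(5)[OF that, of 0 0] by (simp add: scale_zero L(1) that)
  have sum1: "hip H (\<pi> (\<Sum>k\<in>I. f k) x) y = (\<Sum>k\<in>I. hip H (\<pi> (f k) x) y)"
    if "x \<in> C" "y \<in> C" for I :: "nat set" and f x y
    using that by (induction I rule: infinite_finite_induct) (auto simp: zero L ips)
  define s where "s k = partial_sum (\<lambda>j. \<pi> (b k j) (v j)) n" for k
  have s: "s k \<in> C" for k
    unfolding s_def by (rule partial_sum_closed) (use v L in auto)
  have sum2: "hip H (s k) y = (\<Sum>j<n. hip H (\<pi> (b k j) (v j)) y)"
    and sum3: "hip H y (s k) = (\<Sum>j<n. hip H y (\<pi> (b k j) (v j)))" if "y \<in> C" for k y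
    unfolding s_def by (rule ip_partial_sum[OF that]; use v L in auto)+
  have "(\<Sum>i<n. \<Sum>j<n. hip H (\<pi> (a i j) (v j)) (v i)) =
      (\<Sum>i<n. \<Sum>j<n. \<Sum>k<n. hip H (\<pi> (b k j) (v j)) (\<pi> (b k i) (v i)))"
  proof (intro sum.cong refl)
    fix i j assume "i \<in> {..<n}" "j \<in> {..<n}"
    hence ij: "i < n" "j < n" "v i \<in> C" "v j \<in> C" using v by auto
    have "hip H (\<pi> (a i j) (v j)) (v i) = (\<Sum>k<n. hip H (\<pi> (star (b k i) * b k j) (v j)) (v i))"
      using ij by (simp add: b sum1)
    also have "\<dots> = (\<Sum>k<n. hip H (\<pi> (b k j) (v j)) (\<pi> (b k i) (v i)))"
      using rep ij L(1) unfolding representation_def by (intro sum.cong refl) simp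
    finally show "hip H (\<pi> (a i j) (v j)) (v i) = (\<Sum>k<n. hip H (\<pi> (b k j) (v j)) (\<pi> (b k i) (v i)))" .
  qed
  also have "\<dots> = (\<Sum>i<n. \<Sum>k<n. \<Sum>j<n. hip H (\<pi> (b k j) (v j)) (\<pi> (b k i) (v i)))"
    by (intro sum.cong refl sum.swap)
  also have "\<dots> = (\<Sum>i<n. \<Sum>k<n. hip H (s k) (\<pi> (b k i) (v i)))"
    using v by (intro sum.cong refl) (auto simp: sum2 L)
  also have "\<dots> = (\<Sum>k<n. \<Sum>i<n. hip H (s k) (\<pi> (b k i) (v i)))" by (rule sum.swap)
  also have "\<dots> = (\<Sum>k<n. hip H (s k) (s k))" by (simp add: sum3 s)
  also have "\<dots> = complex_of_real (\<Sum>k<n. (hnorm H (s k))\<^sup>2)" by (simp add: ip_self s)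
  finally show "(\<Sum>i<n. \<Sum>j<n. hip H (\<pi> (a i j) (v j)) (v i)) \<in> \<real>\<^sub>\<ge>\<^sub>0"
    by (simp add: complex_nonneg_Reals_iff sum_nonneg)
qed

end

section \<open>Formal sums and duality for extensions\<close>

instantiation poly_mapping :: (type, real_vector) real_vector
begin

definition scaleR_poly_mapping :: "real \<Rightarrow> ('a \<Rightarrow>\<^sub>0 'b) \<Rightarrow> ('a \<Rightarrow>\<^sub>0 'b)" where
  "scaleR_poly_mapping r f = Poly_Mapping.map (\<lambda>x. r *\<^sub>R x) f"

lemma lookup_scaleR [simp]: "Poly_Mapping.lookup (r *\<^sub>R f) k = r *\<^sub>R Poly_Mapping.lookup f k"
  by (simp add: scaleR_poly_mapping_def map.rep_eq when_def)

instance
  by standard (auto intro!: poly_mapping_eqI simp: lookup_add scaleR_add_left scaleR_add_right)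

end

text \<open>A finitely supported function with values in the algebra stands for a formal sum of terms \<open>a \<otimes> k\<close>; the
index \<open>k\<close> will be a pair of vectors.\<close>

definition pairing :: "('k \<Rightarrow> 'a::real_vector \<Rightarrow> real) \<Rightarrow> ('k \<Rightarrow>\<^sub>0 'a) \<Rightarrow> real" where
  "pairing g v = (\<Sum>k\<in>Poly_Mapping.keys v. g k (Poly_Mapping.lookup v k))"

lemma pairing_superset:
  assumes "\<And>k. linear (g k)" "finite K" "Poly_Mapping.keys v \<subseteq> K"
  shows "pairing g v = (\<Sum>k\<in>K. g k (Poly_Mapping.lookup v k))"
  unfolding pairing_def
  by (rule sum.mono_neutral_left) (use assms linear_0 in \<open>auto simp: in_keys_iff\<close>)

lemma linear_pairing:
  fixes g :: "'k \<Rightarrow> 'a::real_vector \<Rightarrow> real"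
  assumes g: "\<And>k. linear (g k)"
  shows "linear (pairing g)"
proof (rule linearI)
  fix u v :: "'k \<Rightarrow>\<^sub>0 'a"
  let ?K = "Poly_Mapping.keys u \<union> Poly_Mapping.keys v"
  have "Poly_Mapping.keys (u + v) \<subseteq> ?K" by (rule keys_add)
  hence "pairing g (u + v) = (\<Sum>k\<in>?K. g k (Poly_Mapping.lookup (u + v) k))" by (intro pairing_superset g) auto
  also have "\<dots> = (\<Sum>k\<in>?K. g k (Poly_Mapping.lookup u k)) + (\<Sum>k\<in>?K. g k (Poly_Mapping.lookup v k))"
    by (simp add: lookup_add linear_add[OF g] sum.distrib)
  also have "\<dots> = pairing g u + pairing g v"
    by (intro arg_cong2[where f = "(+)"] pairing_superset[symmetric] g) auto
  finally show "pairing g (u + v) = pairing g u + pairing g v" .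
next
  fix r :: real and u :: "'k \<Rightarrow>\<^sub>0 'a"
  have "pairing g (r *\<^sub>R u) = (\<Sum>k\<in>Poly_Mapping.keys u. g k (Poly_Mapping.lookup (r *\<^sub>R u) k))"
    by (rule pairing_superset[OF g]) (auto simp: in_keys_iff)
  thus "pairing g (r *\<^sub>R u) = r *\<^sub>R pairing g u"
    by (simp add: pairing_def linear_scale[OF g] sum_distrib_left)
qed

lemma pairing_single:
  assumes "\<And>k. linear (g k)"
  shows "pairing g (Poly_Mapping.single k a) = g k a"
  using linear_0[OF assms] by (simp add: pairing_def)

lemma single_scaleR: "Poly_Mapping.single k (r *\<^sub>R a) = r *\<^sub>R Poly_Mapping.single k a"
  by (rule poly_mapping_eqI) (simp add: lookup_single when_def)

lemma formal_sum_induct [case_names single add]: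
  assumes "\<And>k a. P (Poly_Mapping.single k a)" "\<And>u v. P u \<Longrightarrow> P v \<Longrightarrow> P (u + v)"
  shows "P (v :: 'k \<Rightarrow>\<^sub>0 'a::ab_group_add)"
proof -
  have "P (\<Sum>k\<in>K. Poly_Mapping.single k (Poly_Mapping.lookup v k))" if "finite K" for K
    using that
  proof (induction K)
    case empty
    show ?case using assms(1)[of undefined 0] by simp
  qed (auto intro: assms)
  moreover have "v = (\<Sum>k\<in>Poly_Mapping.keys v. Poly_Mapping.single k (Poly_Mapping.lookup v k))"
    by (rule poly_mapping_eqI) (simp add: lookup_sum lookup_single when_def in_keys_iff)
  ultimately show ?thesis using finite_keys by metis
qed

text \<open>The formal sums that are nonnegative on unital completely positive maps for a reason that involves finitely many
vectors. Each of the last four rules contains a relation together with its negative, since \<open>a\<close> is arbitrary: linearity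
in the first vector, hermitian symmetry (which gives conjugate linearity in the second vector), and vanishing off the carrier.
Keeping the relations in the cone, instead of dividing by them, is what makes membership transferable to the
fibers.\<close>

inductive_set positive_cone :: "'v hilbert \<Rightarrow> ('v \<times> 'v \<Rightarrow>\<^sub>0 'a::unital_cstar_algebra) set" for H :: "'v hilbert" where
  cone_add: "u \<in> positive_cone H \<Longrightarrow> v \<in> positive_cone H \<Longrightarrow> u + v \<in> positive_cone H"
| cone_scale: "u \<in> positive_cone H \<Longrightarrow> 0 \<le> r \<Longrightarrow> r *\<^sub>R u \<in> positive_cone H"
| cone_gram: "(\<And>i. i < (n::nat) \<Longrightarrow> v i \<in> hcarrier H) \<Longrightarrow>
    (\<Sum>i<n. \<Sum>j<n. Poly_Mapping.single (v j, v i) (star (b i) * b j)) \<in> positive_cone H"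
| cone_linear_add: "\<eta> \<in> hcarrier H \<Longrightarrow> \<eta>' \<in> hcarrier H \<Longrightarrow> \<xi> \<in> hcarrier H \<Longrightarrow>
    Poly_Mapping.single (hadd H \<eta> \<eta>', \<xi>) a - Poly_Mapping.single (\<eta>, \<xi>) a - Poly_Mapping.single (\<eta>', \<xi>) a \<in> positive_cone H"
| cone_linear_scale: "\<eta> \<in> hcarrier H \<Longrightarrow> \<xi> \<in> hcarrier H \<Longrightarrow>
    Poly_Mapping.single (hscale H c \<eta>, \<xi>) a - Poly_Mapping.single (\<eta>, \<xi>) (scaleC c a) \<in> positive_cone H"
| cone_hermitian: "\<eta> \<in> hcarrier H \<Longrightarrow> \<xi> \<in> hcarrier H \<Longrightarrow>
    Poly_Mapping.single (\<eta>, \<xi>) a - Poly_Mapping.single (\<xi>, \<eta>) (star a) \<in> positive_cone H"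
| cone_off_carrier: "\<eta> \<notin> hcarrier H \<or> \<xi> \<notin> hcarrier H \<Longrightarrow> Poly_Mapping.single (\<eta>, \<xi>) a \<in> positive_cone H"

definition evaluation :: "'v hilbert \<Rightarrow> ('a::unital_cstar_algebra \<Rightarrow> 'v \<Rightarrow> 'v) \<Rightarrow> ('v \<times> 'v) \<Rightarrow> 'a \<Rightarrow> real" where
  "evaluation H \<psi> k a = (if fst k \<in> hcarrier H \<and> snd k \<in> hcarrier H
     then Re (hip H (\<psi> a (fst k)) (snd k)) else 0)"

context hilbert_space
begin

lemma linear_evaluation:
  assumes "operator_linear_on UNIV H \<psi>"
  shows "linear (evaluation H \<psi> k)"
  using operator_linear_onD[OF assms UNIV_I]
  by (intro linearI) (auto simp: evaluation_def ips scaleR_eq_scaleC)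

text \<open>For maps on \<open>H\<close> itself all generators are nonnegative by complete positivity and symmetry.\<close>

lemma cone_nonneg:
  assumes cp: "cp_map UNIV H \<psi>" and one: "\<psi> 1 = (\<lambda>v\<in>C. v)" and u: "u \<in> positive_cone H"
  shows "0 \<le> pairing (evaluation H \<psi>) u"
proof -
  have lin: "operator_linear_on UNIV H \<psi>" using cp by (simp add: cp_map_def)
  note L = operator_linear_onD[OF lin UNIV_I]
  note P = linear_pairing[OF linear_evaluation[OF lin]]
  note S = pairing_single[OF linear_evaluation[OF lin]]
  have E: "\<eta> \<in> C \<Longrightarrow> \<xi> \<in> C \<Longrightarrow> evaluation H \<psi> (\<eta>, \<xi>) a = Re (hip H (\<psi> a \<eta>) \<xi>)"
    "\<eta> \<notin> C \<or> \<xi> \<notin> C \<Longrightarrow> evaluation H \<psi> (\<eta>, \<xi>) a = 0" for \<eta> \<xi> a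
    by (auto simp: evaluation_def)
  show ?thesis using u
  proof induction
    case (cone_gram n v b)
    have "pairing (evaluation H \<psi>) (\<Sum>i<n. \<Sum>j<n. Poly_Mapping.single (v j, v i) (star (b i) * b j))
        = (\<Sum>i<n. \<Sum>j<n. Re (hip H (\<psi> (star (b i) * b j) (v j)) (v i)))"
      using cone_gram by (simp add: linear_sum[OF P] S E)
    also have "\<dots> \<ge> 0" by (rule cp_gram[OF cp cone_gram])
    finally show ?case .
  next
    case (cone_hermitian \<eta> \<xi> a)
    have "hip H (\<psi> (star a) \<xi>) \<eta> = hip H \<xi> (\<psi> a \<eta>)"
      by (rule ucp_hermitian[OF cp one selfadjoint_subspace_UNIV UNIV_I]) fact+
    also have "\<dots> = cnj (hip H (\<psi> a \<eta>) \<xi>)"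
      by (rule ip_commute) (use cone_hermitian L in auto)
    finally have "hip H (\<psi> (star a) \<xi>) \<eta> = cnj (hip H (\<psi> a \<eta>) \<xi>)" .
    thus ?case using cone_hermitian by (simp add: linear_diff[OF P] S E)
  qed (auto simp: linear_add[OF P] linear_diff[OF P] linear_scale[OF P] S E L ips)
qed


lemma evaluation_eq:
  "\<eta> \<in> C \<Longrightarrow> \<xi> \<in> C \<Longrightarrow> evaluation H \<psi> (\<eta>, \<xi>) a = Re (hip H (\<psi> a \<eta>) \<xi>)"
  by (simp add: evaluation_def)

text \<open>A quadratic form estimate: the Gram element of \<open>(a, -1)\<close> at \<open>(\<eta>, \<xi>)\<close> contains \<open>- 2 a \<otimes> (\<eta>, \<xi>)\<close> up to
symmetry, and \<open>star a * a\<close> is completed to the scalar \<open>(norm a + 1)\<^sup>2\<close>. Thus scalar coefficients dominate every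
formal sum.\<close>

lemma single_majorant:
  fixes a :: "'a::unital_cstar_algebra"
  assumes "\<eta> \<in> C" "\<xi> \<in> C"
  shows "(1/2) *\<^sub>R (Poly_Mapping.single (\<eta>, \<eta>) ((norm a + 1)\<^sup>2 *\<^sub>R 1) + Poly_Mapping.single (\<xi>, \<xi>) 1)
    - Poly_Mapping.single (\<eta>, \<xi>) a \<in> positive_cone H"
proof -
  let ?s = "Poly_Mapping.single :: _ \<Rightarrow> 'a \<Rightarrow> _"
  obtain c where c: "star a * a + star c * c = (norm a + 1)\<^sup>2 *\<^sub>R 1"
    using complete_square_to_scalar[of a "norm a + 1"] by auto
  define v where "v i = (if i = (0::nat) then \<eta> else \<xi>)" for i
  define b where "b i = (if i = (0::nat) then a else - 1)" for i
  have "(\<Sum>i<2. \<Sum>j<2. ?s (v j, v i) (star (b i) * b j)) \<in> positive_cone H"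
    by (rule cone_gram) (use assms in \<open>auto simp: v_def\<close>)
  hence 1: "?s (\<eta>, \<eta>) (star a * a) - ?s (\<xi>, \<eta>) (star a) - ?s (\<eta>, \<xi>) a + ?s (\<xi>, \<xi>) 1 \<in> positive_cone H"
    by (simp add: numeral_2_eq_2 v_def b_def star_minus single_uminus algebra_simps)
  have "(\<Sum>i<(1::nat). \<Sum>j<(1::nat). ?s (\<eta>, \<eta>) (star c * c)) \<in> positive_cone H"
    using cone_gram[of 1 "\<lambda>_. \<eta>" H "\<lambda>_. c"] assms by simp
  hence 2: "?s (\<eta>, \<eta>) (star c * c) \<in> positive_cone H" by simp
  have 3: "?s (\<xi>, \<eta>) (star a) - ?s (\<eta>, \<xi>) a \<in> positive_cone H"
    using cone_hermitian[OF assms(2,1), of "star a"] by (simp add: star_star)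
  have "(1/2) *\<^sub>R ((?s (\<eta>, \<eta>) (star a * a) - ?s (\<xi>, \<eta>) (star a) - ?s (\<eta>, \<xi>) a + ?s (\<xi>, \<xi>) 1)
      + ?s (\<eta>, \<eta>) (star c * c) + (?s (\<xi>, \<eta>) (star a) - ?s (\<eta>, \<xi>) a)) \<in> positive_cone H"
    by (intro cone_scale cone_add 1 2 3) simp
  also have "(?s (\<eta>, \<eta>) (star a * a) - ?s (\<xi>, \<eta>) (star a) - ?s (\<eta>, \<xi>) a + ?s (\<xi>, \<xi>) 1)
      + ?s (\<eta>, \<eta>) (star c * c) + (?s (\<xi>, \<eta>) (star a) - ?s (\<eta>, \<xi>) a)
      = (?s (\<eta>, \<eta>) ((norm a + 1)\<^sup>2 *\<^sub>R 1) + ?s (\<xi>, \<xi>) 1) - 2 *\<^sub>R ?s (\<eta>, \<xi>) a"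
    unfolding c[symmetric] single_add by (simp add: scaleR_2)
  also have "(1/2) *\<^sub>R \<dots> = (1/2) *\<^sub>R (?s (\<eta>, \<eta>) ((norm a + 1)\<^sup>2 *\<^sub>R 1) + ?s (\<xi>, \<xi>) 1) - ?s (\<eta>, \<xi>) a"
    by (simp add: scaleR_right_diff_distrib)
  finally show ?thesis .
qed

text \<open>The functional gives a form \<open>G a\<close> for every \<open>a\<close>, whose imaginary part is recovered from \<open>\<i> a\<close>. The
relations in the cone make it sesquilinear, the majorants by scalars make it bounded, and the Riesz representation
theorem turns it into an operator. Positivity on Gram elements is complete positivity.\<close>

lemma positive_functional_represented:
  fixes F :: "('v \<times> 'v \<Rightarrow>\<^sub>0 'a::unital_cstar_algebra) \<Rightarrow> real"
  assumes F: "linear F" and pos: "\<And>u. u \<in> positive_cone H \<Longrightarrow> 0 \<le> F u"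
    and unit: "\<And>v r. v \<in> C \<Longrightarrow> F (Poly_Mapping.single (v, v) (r *\<^sub>R 1)) = r * (hnorm H v)\<^sup>2"
  obtains \<psi> where "cp_map UNIV H \<psi>"
    "\<And>a \<eta> \<xi>. \<eta> \<in> C \<Longrightarrow> \<xi> \<in> C \<Longrightarrow> F (Poly_Mapping.single (\<eta>, \<xi>) a) = Re (hip H (\<psi> a \<eta>) \<xi>)"
proof -
  define f where "f \<eta> \<xi> a = F (Poly_Mapping.single (\<eta>, \<xi>) a)" for \<eta> \<xi> a
  define G where "G a \<eta> \<xi> = Complex (f \<eta> \<xi> a) (- f \<eta> \<xi> (scaleC \<i> a))" for a \<eta> \<xi>
  note Fd = linear_diff[OF F] and Fa = linear_add[OF F] and Fs = linear_scale[OF F]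
  have f_add: "f \<eta> \<xi> (a + b) = f \<eta> \<xi> a + f \<eta> \<xi> b" for \<eta> \<xi> a b
    by (simp add: f_def single_add Fa)
  have f_scale: "f \<eta> \<xi> (r *\<^sub>R a) = r * f \<eta> \<xi> a" for \<eta> \<xi> a r
    by (simp add: f_def single_scaleR Fs)
  have f_minus: "f \<eta> \<xi> (- a) = - f \<eta> \<xi> a" for \<eta> \<xi> a
    using f_scale[of \<eta> \<xi> "-1" a] by simp
  have f_sum: "f \<eta> \<xi> (\<Sum>k\<in>K. g k) = (\<Sum>k\<in>K. f \<eta> \<xi> (g k))" for \<eta> \<xi> g and K :: "nat set"
    using f_scale[of \<eta> \<xi> 0] by (induction K rule: infinite_finite_induct) (auto simp: f_add)
  \<comment> \<open>the cone contains both signs of each relation, because \<open>a\<close> may be replaced by \<open>- a\<close>\<close>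
  have f_left: "f (hadd H \<eta> \<eta>') \<xi> a = f \<eta> \<xi> a + f \<eta>' \<xi> a" if "\<eta> \<in> C" "\<eta>' \<in> C" "\<xi> \<in> C" for \<eta> \<eta>' \<xi> a
    using pos[OF cone_linear_add[OF that, of a]] pos[OF cone_linear_add[OF that, of "- a"]]
    unfolding Fd f_def[symmetric] f_minus by simp
  have f_left_scale: "f (hscale H c \<eta>) \<xi> a = f \<eta> \<xi> (scaleC c a)" if "\<eta> \<in> C" "\<xi> \<in> C" for \<eta> \<xi> a c
    using pos[OF cone_linear_scale[OF that, of c a]] pos[OF cone_linear_scale[OF that, of c "- a"]]
    unfolding Fd f_def[symmetric] scaleC_minus_right f_minus by simp
  have f_herm: "f \<xi> \<eta> (star a) = f \<eta> \<xi> a" if "\<eta> \<in> C" "\<xi> \<in> C" for \<eta> \<xi> a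
    using pos[OF cone_hermitian[OF that, of a]] pos[OF cone_hermitian[OF that, of "- a"]]
    unfolding Fd f_def[symmetric] star_minus f_minus by simp
  have scaleC_split: "scaleC c a = Re c *\<^sub>R a + Im c *\<^sub>R scaleC \<i> a" for c and a :: 'a
    unfolding scaleR_eq_scaleC scaleC_scaleC scaleC_add_left[symmetric]
    by (rule arg_cong[of _ _ "\<lambda>c. scaleC c a"]) (simp add: complex_eq_iff)
  have G_add: "G (a + b) \<eta> \<xi> = G a \<eta> \<xi> + G b \<eta> \<xi>" for a b \<eta> \<xi>
    by (simp add: G_def f_add scaleC_add_right complex_eq_iff)
  have f_i: "f \<eta> \<xi> (scaleC c a) = Re c * f \<eta> \<xi> a + Im c * f \<eta> \<xi> (scaleC \<i> a)" for \<eta> \<xi> c a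
    by (subst scaleC_split) (simp only: f_add f_scale)
  have G_scale: "G (scaleC c a) \<eta> \<xi> = c * G a \<eta> \<xi>" for a c \<eta> \<xi>
    using f_i[of \<eta> \<xi> c a] f_i[of \<eta> \<xi> "\<i> * c" a] by (simp add: G_def scaleC_scaleC complex_eq_iff)
  have G_left: "G a (hadd H \<eta> \<eta>') \<xi> = G a \<eta> \<xi> + G a \<eta>' \<xi>" if "\<eta> \<in> C" "\<eta>' \<in> C" "\<xi> \<in> C" for \<eta> \<eta>' \<xi> a
    by (simp add: G_def f_left[OF that] complex_eq_iff)
  have G_left_scale: "G a (hscale H c \<eta>) \<xi> = c * G a \<eta> \<xi>" if "\<eta> \<in> C" "\<xi> \<in> C" for \<eta> \<xi> a c
  proof -
    have "G a (hscale H c \<eta>) \<xi> = G (scaleC c a) \<eta> \<xi>"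
      by (simp add: G_def f_left_scale[OF that] scaleC_scaleC mult.commute)
    thus ?thesis by (simp only: G_scale)
  qed
  have G_herm: "G (star a) \<xi> \<eta> = cnj (G a \<eta> \<xi>)" if "\<eta> \<in> C" "\<xi> \<in> C" for \<eta> \<xi> a
  proof -
    have "f \<xi> \<eta> (scaleC \<i> (star a)) = f \<xi> \<eta> (star (- scaleC \<i> a))"
      by (simp add: star_minus star_scaleC)
    also have "\<dots> = - f \<eta> \<xi> (scaleC \<i> a)" by (simp only: f_herm[OF that] f_minus)
    finally show ?thesis by (simp add: G_def f_herm[OF that] complex_eq_iff)
  qed
  have G_right: "G a \<eta> (hadd H \<xi> \<xi>') = G a \<eta> \<xi> + G a \<eta> \<xi>'" if "\<eta> \<in> C" "\<xi> \<in> C" "\<xi>' \<in> C" for \<eta> \<xi> \<xi>' a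
  proof -
    have "G (star (star a)) \<eta> (hadd H \<xi> \<xi>') = cnj (G (star a) (hadd H \<xi> \<xi>') \<eta>)"
      by (rule G_herm) (use that add_closed in auto)
    also have "\<dots> = cnj (G (star a) \<xi> \<eta>) + cnj (G (star a) \<xi>' \<eta>)"
      using G_left that by simp
    also have "\<dots> = G (star (star a)) \<eta> \<xi> + G (star (star a)) \<eta> \<xi>'"
      using G_herm that by metis
    finally show ?thesis by (simp only: star_star)
  qed
  have G_right_scale: "G a \<eta> (hscale H c \<xi>) = cnj c * G a \<eta> \<xi>" if "\<eta> \<in> C" "\<xi> \<in> C" for \<eta> \<xi> a c
  proof -
    have "G (star (star a)) \<eta> (hscale H c \<xi>) = cnj (G (star a) (hscale H c \<xi>) \<eta>)"
      by (rule G_herm) (use that scale_closed in auto)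
    also have "\<dots> = cnj c * cnj (G (star a) \<xi> \<eta>)"
      using G_left_scale that by simp
    also have "\<dots> = cnj c * G (star (star a)) \<eta> \<xi>"
      using G_herm that by metis
    finally show ?thesis by (simp only: star_star)
  qed
  define k where "k a = ((norm a + 1)\<^sup>2 + 1) / 2" for a :: 'a
  have f_bound: "f \<eta> \<xi> a \<le> ((norm a + 1)\<^sup>2 * (hnorm H \<eta>)\<^sup>2 + (hnorm H \<xi>)\<^sup>2) / 2" if "\<eta> \<in> C" "\<xi> \<in> C" for \<eta> \<xi> a
  proof -
    have "0 \<le> (1/2) * (F (Poly_Mapping.single (\<eta>, \<eta>) ((norm a + 1)\<^sup>2 *\<^sub>R 1)) + F (Poly_Mapping.single (\<xi>, \<xi>) 1)) - f \<eta> \<xi> a"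
      using pos[OF single_majorant[OF that, of a]] by (simp add: Fd Fs Fa f_def)
    thus ?thesis using unit[of \<eta> "(norm a + 1)\<^sup>2"] unit[of \<xi> 1] that by simp
  qed
  have G_unit_bound: "cmod (G a \<eta> \<xi>) \<le> k a" if "\<eta> \<in> C" "\<xi> \<in> C" "hnorm H \<eta> = 1" "hnorm H \<xi> = 1" for \<eta> \<xi> a
  proof -
    \<comment> \<open>a unimodular factor rotates the form to its absolute value, because only real parts are bounded by the functional\<close>
    define c where "c = (if G a \<eta> \<xi> = 0 then 1 else of_real (cmod (G a \<eta> \<xi>)) / G a \<eta> \<xi>)"
    have c: "cmod c = 1" "c * G a \<eta> \<xi> = complex_of_real (cmod (G a \<eta> \<xi>))"
      by (auto simp: c_def norm_divide)
    have "cmod (G a \<eta> \<xi>) = Re (G a (hscale H c \<eta>) \<xi>)"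
      by (simp add: G_left_scale[OF that(1,2)] c(2))
    also have "\<dots> = f (hscale H c \<eta>) \<xi> a" by (simp add: G_def)
    also have "\<dots> \<le> k a"
      using f_bound[of "hscale H c \<eta>" \<xi> a] that c(1) by (simp add: hnorm_scale scale_closed k_def)
    finally show ?thesis .
  qed
  have G_bound: "cmod (G a \<eta> \<xi>) \<le> k a * hnorm H \<eta> * hnorm H \<xi>" if "\<eta> \<in> C" "\<xi> \<in> C" for \<eta> \<xi> a
  proof (cases "hnorm H \<eta> = 0 \<or> hnorm H \<xi> = 0")
    case True
    hence "\<eta> = hscale H 0 \<eta> \<or> \<xi> = hscale H 0 \<xi>"
      using that hnorm_eq_zero scale_zero by metis
    hence "G a \<eta> \<xi> = 0" using G_left_scale[OF that, of a 0] G_right_scale[OF that, of a 0] by auto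
    thus ?thesis using True by auto
  next
    case False
    define \<eta>1 \<xi>1 where "\<eta>1 = hscale H (1 / of_real (hnorm H \<eta>)) \<eta>" and "\<xi>1 = hscale H (1 / of_real (hnorm H \<xi>)) \<xi>"
    have pos: "hnorm H \<eta> > 0" "hnorm H \<xi> > 0" using False hnorm_nonneg that by (auto simp: less_le)
    have C1: "\<eta>1 \<in> C" "\<xi>1 \<in> C" using that scale_closed by (auto simp: \<eta>1_def \<xi>1_def)
    have N1: "hnorm H \<eta>1 = 1" "hnorm H \<xi>1 = 1"
      using pos that by (simp_all add: \<eta>1_def \<xi>1_def hnorm_scale norm_divide)
    have "G a \<eta>1 \<xi>1 = G a \<eta> \<xi> / (of_real (hnorm H \<eta>) * of_real (hnorm H \<xi>))"
      using that C1 by (simp add: \<eta>1_def \<xi>1_def G_left_scale G_right_scale scale_closed)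
    hence "cmod (G a \<eta>1 \<xi>1) = cmod (G a \<eta> \<xi>) / (hnorm H \<eta> * hnorm H \<xi>)"
      using pos by (simp add: norm_divide norm_mult)
    with G_unit_bound[OF C1 N1, of a] pos show ?thesis by (simp add: field_simps)
  qed
  have "\<exists>y\<in>C. \<forall>\<xi>\<in>C. G a \<eta> \<xi> = hip H y \<xi>" if \<eta>: "\<eta> \<in> C" for a \<eta>
    by (rule riesz_representation[of "G a \<eta>" "k a * hnorm H \<eta>"])
      (use \<eta> G_right G_right_scale G_bound in auto)
  hence ex: "\<exists>y. y \<in> C \<and> (\<forall>\<xi>\<in>C. G a \<eta> \<xi> = hip H y \<xi>)" if "\<eta> \<in> C" for a \<eta>
    using that by blast
  define g where "g a \<eta> = (SOME y. y \<in> C \<and> (\<forall>\<xi>\<in>C. G a \<eta> \<xi> = hip H y \<xi>))" for a \<eta>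
  have g: "g a \<eta> \<in> C" "\<xi> \<in> C \<Longrightarrow> hip H (g a \<eta>) \<xi> = G a \<eta> \<xi>" if "\<eta> \<in> C" for a \<eta> \<xi>
    using someI_ex[OF ex[OF that, of a]] by (auto simp: g_def)
  define \<psi> where "\<psi> a = (\<lambda>\<eta>\<in>C. g a \<eta>)" for a
  have \<psi>: "\<eta> \<in> C \<Longrightarrow> \<psi> a \<eta> \<in> C" "\<eta> \<in> C \<Longrightarrow> \<xi> \<in> C \<Longrightarrow> hip H (\<psi> a \<eta>) \<xi> = G a \<eta> \<xi>" for a \<eta> \<xi>
    using g by (auto simp: \<psi>_def)
  have "\<psi> a \<in> bounded_operators H" for a
  proof -
    have "hnorm H (\<psi> a v) \<le> k a * hnorm H v" if v: "v \<in> C" for v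
    proof (cases "hnorm H (\<psi> a v) = 0")
      case True
      thus ?thesis using v hnorm_nonneg[OF v] by (simp add: k_def)
    next
      case False
      have "(hnorm H (\<psi> a v))\<^sup>2 = cmod (hip H (\<psi> a v) (\<psi> a v))"
        using \<psi>(1)[OF v] by (simp add: ip_self norm_power)
      also have "\<dots> \<le> k a * hnorm H v * hnorm H (\<psi> a v)"
        using \<psi>[OF v] G_bound[OF v] by simp
      finally show ?thesis using False hnorm_nonneg[OF \<psi>(1)[OF v, of a]] by (simp add: power2_eq_square)
    qed
    moreover have "\<psi> a (hadd H v w) = hadd H (\<psi> a v) (\<psi> a w)" if "v \<in> C" "w \<in> C" for v w
      by (rule eq_by_ip) (use that \<psi> closed in \<open>auto simp: G_left ips\<close>)
    moreover have "\<psi> a (hscale H c v) = hscale H c (\<psi> a v)" if "v \<in> C" for v c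
      by (rule eq_by_ip) (use that \<psi> closed in \<open>auto simp: G_left_scale ips\<close>)
    moreover have "\<psi> a \<in> C \<rightarrow>\<^sub>E C" unfolding \<psi>_def using g(1) by auto
    ultimately show ?thesis by (auto simp: bounded_operators_def)
  qed
  moreover have "\<psi> (a + b) v = hadd H (\<psi> a v) (\<psi> b v)" if "v \<in> C" for a b v
    by (rule eq_by_ip) (use that \<psi> closed in \<open>auto simp: G_add ips\<close>)
  moreover have "\<psi> (scaleC c a) v = hscale H c (\<psi> a v)" if "v \<in> C" for a c v
    by (rule eq_by_ip) (use that \<psi> closed in \<open>auto simp: G_scale ips\<close>)
  ultimately have lin: "operator_linear_on UNIV H \<psi>" by (simp add: operator_linear_on_def)
  have cp: "cp_map UNIV H \<psi>"
    unfolding cp_map_def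
  proof (intro conjI allI impI lin)
    fix n :: nat and a :: "nat \<Rightarrow> nat \<Rightarrow> 'a" and v :: "nat \<Rightarrow> 'v"
    assume "(\<forall>i<n. \<forall>j<n. a i j \<in> UNIV) \<and> positive_matrix n a" and v: "\<forall>i<n. v i \<in> C"
    then obtain b where b: "\<And>i j. i < n \<Longrightarrow> j < n \<Longrightarrow> a i j = (\<Sum>m<n. star (b m i) * b m j)"
      unfolding positive_matrix_def by blast
    have st: "star (a i j) = a j i" if "i < n" "j < n" for i j
      using that by (simp add: b star_sum star_mult star_star)
    define z where "z = (\<Sum>i<n. \<Sum>j<n. hip H (\<psi> (a i j) (v j)) (v i))"
    have z: "z = (\<Sum>i<n. \<Sum>j<n. G (a i j) (v j) (v i))"
      unfolding z_def using v by (intro sum.cong refl) (simp add: \<psi>)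
    have "cnj z = (\<Sum>i<n. \<Sum>j<n. G (a j i) (v i) (v j))"
      unfolding z cnj_sum using v by (intro sum.cong refl) (simp add: st flip: G_herm)
    also have "\<dots> = z" unfolding z by (rule sum.swap)
    finally have im: "Im z = 0" by (metis complex_cnj_cancel_iff cnj.simps(2) neg_equal_zero)
    have "Re z = (\<Sum>i<n. \<Sum>j<n. f (v j) (v i) (a i j))" by (simp add: z G_def)
    also have "\<dots> = (\<Sum>i<n. \<Sum>j<n. \<Sum>m<n. f (v j) (v i) (star (b m i) * b m j))"
      by (intro sum.cong refl) (simp add: b f_sum)
    also have "\<dots> = (\<Sum>i<n. \<Sum>m<n. \<Sum>j<n. f (v j) (v i) (star (b m i) * b m j))"
      by (intro sum.cong refl sum.swap)
    also have "\<dots> = (\<Sum>m<n. \<Sum>i<n. \<Sum>j<n. f (v j) (v i) (star (b m i) * b m j))"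
      by (rule sum.swap)
    also have "\<dots> = (\<Sum>m<n. F (\<Sum>i<n. \<Sum>j<n. Poly_Mapping.single (v j, v i) (star (b m i) * b m j)))"
      by (simp add: f_def linear_sum[OF F])
    also have "\<dots> \<ge> 0" by (intro sum_nonneg pos cone_gram) (use v in auto)
    finally show "z \<in> \<real>\<^sub>\<ge>\<^sub>0" using im by (simp add: complex_nonneg_Reals_iff)
  qed
  show ?thesis by (rule that[OF cp]) (simp add: \<psi> G_def f_def)
qed

text \<open>The infimum of the values at \<open>\<pi>\<close> of the \<open>S\<close>-valued sums that dominate \<open>v\<close> is a sublinear functional
\<open>p\<close> of \<open>v\<close>. A linear \<open>F \<le> p\<close> that attains \<open>p\<close> at \<open>a \<otimes> (\<eta>, \<xi>)\<close> is positive and agrees with \<open>\<pi>\<close> on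
\<open>S\<close>-valued sums, so it is represented by an extension. By uniqueness this extension is \<open>\<pi>\<close>, and the infimum is
\<open>Re \<langle>\<pi>(a) \<eta>, \<xi>\<rangle>\<close>.\<close>

theorem extension_duality:
  fixes S :: "'a::unital_cstar_algebra set"
  assumes S: "selfadjoint_subspace S" and cp: "cp_map UNIV H \<pi>" and one: "\<pi> 1 = (\<lambda>v\<in>C. v)"
    and uniq: "\<And>\<psi>. cp_extension S H \<pi> \<psi> \<Longrightarrow> \<psi> = \<pi>"
    and \<eta>: "\<eta> \<in> C" "\<xi> \<in> C" and e: "e > 0"
  obtains \<sigma> where "\<And>k. Poly_Mapping.lookup \<sigma> k \<in> S" "\<sigma> - Poly_Mapping.single (\<eta>, \<xi>) a \<in> positive_cone H"
    "pairing (evaluation H \<pi>) \<sigma> < Re (hip H (\<pi> a \<eta>) \<xi>) + e"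
proof -
  have lin: "operator_linear_on UNIV H \<pi>" using cp by (simp add: cp_map_def)
  note L = operator_linear_onD[OF lin UNIV_I]
  define f where "f = pairing (evaluation H \<pi>)"
  have f: "linear f" unfolding f_def by (rule linear_pairing[OF linear_evaluation[OF lin]])
  have f_single: "f (Poly_Mapping.single k a) = evaluation H \<pi> k a" for k a
    unfolding f_def by (rule pairing_single[OF linear_evaluation[OF lin]])
  have f_pos: "0 \<le> f u" if "u \<in> positive_cone H" for u
    unfolding f_def by (rule cone_nonneg[OF cp one that])
  define W where "W = {\<sigma> :: 'v \<times> 'v \<Rightarrow>\<^sub>0 'a. \<forall>k. Poly_Mapping.lookup \<sigma> k \<in> S}"
  note SD = selfadjoint_subspaceD[OF S]
  have W_add: "u \<in> W \<Longrightarrow> v \<in> W \<Longrightarrow> u + v \<in> W" for u v using SD by (simp add: W_def lookup_add)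
  have W_scale: "u \<in> W \<Longrightarrow> r *\<^sub>R u \<in> W" for u r using SD by (simp add: W_def)
  have W_single: "b \<in> S \<Longrightarrow> Poly_Mapping.single k b \<in> W" for k b
    using SD by (simp add: W_def lookup_single when_def)
  have W0: "0 \<in> W" using SD by (simp add: W_def)
  define A where "A v = {\<sigma>\<in>W. \<sigma> - v \<in> positive_cone H}" for v
  have A_add: "\<sigma> + \<tau> \<in> A (u + v)" if "\<sigma> \<in> A u" "\<tau> \<in> A v" for \<sigma> \<tau> u v
  proof -
    have "(\<sigma> - u) + (\<tau> - v) \<in> positive_cone H" using that by (intro cone_add) (auto simp: A_def)
    thus ?thesis using that W_add by (simp add: A_def algebra_simps)
  qed
  have A_scale: "r *\<^sub>R \<sigma> \<in> A (r *\<^sub>R u)" if "\<sigma> \<in> A u" "r > 0" for r \<sigma> u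
  proof -
    have "r *\<^sub>R (\<sigma> - u) \<in> positive_cone H" using that by (intro cone_scale) (auto simp: A_def)
    thus ?thesis using that W_scale by (simp add: A_def scaleR_right_diff_distrib)
  qed
  have A_ne: "\<exists>\<sigma>. \<sigma> \<in> A v" for v
  proof (induction v rule: formal_sum_induct)
    case (single k b)
    obtain x y where k: "k = (x, y)" by (cases k)
    show ?case
    proof (cases "x \<in> C \<and> y \<in> C")
      case True
      have "(1/2) *\<^sub>R (Poly_Mapping.single (x, x) ((norm b + 1)\<^sup>2 *\<^sub>R 1) + Poly_Mapping.single (y, y) 1) \<in> W"
        by (intro W_scale W_add W_single SD)
      with True single_majorant[of x y b] show ?thesis unfolding k A_def by blast
    next
      case False
      hence "Poly_Mapping.single (x, y) (- b) \<in> positive_cone H" by (intro cone_off_carrier) auto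
      thus ?thesis unfolding k A_def using W0 by (intro exI[of _ 0]) (simp add: single_uminus)
    qed
  next
    case (add u v)
    thus ?case using A_add by blast
  qed
  define p where "p v = (INF \<sigma>\<in>A v. f \<sigma>)" for v
  have A_ge: "f v \<le> f \<sigma>" if "\<sigma> \<in> A v" for v \<sigma>
    using f_pos[of "\<sigma> - v"] that by (simp add: A_def linear_diff[OF f])
  have bdd: "bdd_below (f ` A v)" for v using A_ge by (intro bdd_belowI2) auto
  have p_le: "p v \<le> f \<sigma>" if "\<sigma> \<in> A v" for v \<sigma> unfolding p_def by (rule cINF_lower[OF bdd that])
  have p_ge: "m \<le> p v" if "\<And>\<sigma>. \<sigma> \<in> A v \<Longrightarrow> m \<le> f \<sigma>" for m v
    unfolding p_def by (rule cINF_greatest) (use A_ne that in auto)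
  have p_half: "p (r *\<^sub>R v) \<le> r * p v" if r: "r > 0" for r v
  proof -
    have "p (r *\<^sub>R v) / r \<le> p v"
    proof (rule p_ge)
      fix \<sigma> assume "\<sigma> \<in> A v"
      from p_le[OF A_scale[OF this r]] show "p (r *\<^sub>R v) / r \<le> f \<sigma>"
        using r by (simp add: linear_scale[OF f] field_simps)
    qed
    thus ?thesis using r by (simp add: field_simps)
  qed
  have sl: "sublinear p"
    unfolding sublinear_def
  proof (intro conjI allI impI)
    fix u v
    have "p (u + v) - p u \<le> p v"
    proof (rule p_ge)
      fix \<tau> assume \<tau>: "\<tau> \<in> A v"
      have "p (u + v) - f \<tau> \<le> p u"
      proof (rule p_ge)
        fix \<sigma> assume "\<sigma> \<in> A u"
        from p_le[OF A_add[OF this \<tau>]] show "p (u + v) - f \<tau> \<le> f \<sigma>" by (simp add: linear_add[OF f])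
      qed
      thus "p (u + v) - p u \<le> f \<tau>" by simp
    qed
    thus "p (u + v) \<le> p u + p v" by simp
  next
    fix r :: real and v assume r: "0 < r"
    have "p ((1/r) *\<^sub>R (r *\<^sub>R v)) \<le> (1/r) * p (r *\<^sub>R v)" by (rule p_half) (use r in simp)
    hence "r * p v \<le> p (r *\<^sub>R v)" using r by (simp add: field_simps)
    with p_half[OF r] show "p (r *\<^sub>R v) = r * p v" by (intro antisym)
  qed
  let ?w = "Poly_Mapping.single (\<eta>, \<xi>) a"
  obtain F where F: "linear F" "\<And>v. F v \<le> p v" "F ?w = p ?w"
    using hahn_banach_attained[OF sl] by blast
  have zero_cone: "0 \<in> positive_cone H" using cone_gram[of 0 "\<lambda>_. \<eta>" H "\<lambda>_. 0"] by simp
  have F_pos: "0 \<le> F u" if "u \<in> positive_cone H" for u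
  proof -
    have "0 \<in> A (- u)" using that W0 by (simp add: A_def)
    hence "F (- u) \<le> 0" using F(2)[of "-u"] p_le linear_0[OF f] by (metis order_trans)
    thus ?thesis by (simp add: linear_neg[OF F(1)])
  qed
  have F_W: "F u = f u" if u: "u \<in> W" for u
  proof (rule antisym)
    have le: "F v \<le> f v" if "v \<in> W" for v
    proof -
      have "v \<in> A v" using that zero_cone by (simp add: A_def)
      from p_le[OF this] F(2)[of v] show ?thesis by (rule order_trans[rotated])
    qed
    show "F u \<le> f u" by (rule le[OF u])
    show "f u \<le> F u" using le[OF W_scale[OF u, of "-1"]]
      by (simp add: linear_neg[OF F(1)] linear_neg[OF f])
  qed
  have "F (Poly_Mapping.single (v, v) (r *\<^sub>R 1)) = r * (hnorm H v)\<^sup>2" if v: "v \<in> C" for v r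
    using v L one by (simp add: F_W W_single SD f_single evaluation_eq scaleR_eq_scaleC ips ip_self)
  then obtain \<psi> where \<psi>: "cp_map UNIV H \<psi>"
      "\<And>b x y. x \<in> C \<Longrightarrow> y \<in> C \<Longrightarrow> F (Poly_Mapping.single (x, y) b) = Re (hip H (\<psi> b x) y)"
    using positive_functional_represented[OF F(1) F_pos] by blast
  have lin': "operator_linear_on UNIV H \<psi>" using \<psi>(1) by (simp add: cp_map_def)
  note L' = operator_linear_onD[OF lin' UNIV_I]
  have "\<psi> s = \<pi> s" if s: "s \<in> S" for s
  proof (rule extensionalityI[of _ C])
    fix x assume x: "x \<in> C"
    show "\<psi> s x = \<pi> s x"
    proof (rule eq_real_ip)
      fix y assume y: "y \<in> C"
      show "Re (hip H (\<psi> s x) y) = Re (hip H (\<pi> s x) y)"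
        using \<psi>(2)[OF x y, of s] F_W[OF W_single[OF s]] by (simp add: f_single evaluation_eq x y)
    qed (use L L' x in auto)
  qed (use L L' zero_closed in auto)
  hence "cp_extension S H \<pi> \<psi>" using \<psi>(1) by (simp add: cp_extension_def)
  hence "\<psi> = \<pi>" by (rule uniq)
  hence "p ?w = Re (hip H (\<pi> a \<eta>) \<xi>)" using \<psi>(2)[OF \<eta>] F(3) by simp
  hence "\<not> Re (hip H (\<pi> a \<eta>) \<xi>) + e \<le> p ?w" using e by simp
  then obtain \<sigma> where "\<sigma> \<in> A ?w" "f \<sigma> < Re (hip H (\<pi> a \<eta>) \<xi>) + e"
    using p_ge not_le by metis
  thus ?thesis using that by (auto simp: A_def W_def f_def)
qed

end

section \<open>Representations of a dense subalgebra\<close>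

text \<open>Closing a countable set under countably many operations keeps it countable. It is used for rational
combinations of sections and for rational polynomials in the operator system.\<close>

inductive_set operation_closure :: "'b set \<Rightarrow> ('i \<Rightarrow> 'b \<Rightarrow> 'b \<Rightarrow> 'b) \<Rightarrow> 'b set"
  for G :: "'b set" and f :: "'i \<Rightarrow> 'b \<Rightarrow> 'b \<Rightarrow> 'b" where
  base: "g \<in> G \<Longrightarrow> g \<in> operation_closure G f"
| step: "a \<in> operation_closure G f \<Longrightarrow> b \<in> operation_closure G f \<Longrightarrow> f i a b \<in> operation_closure G f"

lemma countable_operation_closure:
  fixes f :: "'i::countable \<Rightarrow> 'b \<Rightarrow> 'b \<Rightarrow> 'b"
  assumes "countable G"
  shows "countable (operation_closure G f)"
proof -
  define K where "K = rec_nat G (\<lambda>_ A. A \<union> (\<lambda>(i, a, b). f i a b) ` (UNIV \<times> A \<times> A))"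
  have K: "K 0 = G" "K (Suc n) = K n \<union> (\<lambda>(i, a, b). f i a b) ` (UNIV \<times> K n \<times> K n)" for n
    by (simp_all add: K_def)
  have mono: "m \<le> n \<Longrightarrow> K m \<subseteq> K n" for m n by (rule lift_Suc_mono_le) (auto simp: K)
  have "countable (K n)" for n by (induction n) (auto simp: K assms)
  moreover have "operation_closure G f \<subseteq> (\<Union>n. K n)"
  proof
    fix x assume "x \<in> operation_closure G f"
    thus "x \<in> (\<Union>n. K n)"
    proof induction
      case (base g)
      hence "g \<in> K 0" by (simp add: K)
      thus ?case by blast
    next
      case (step a b i)
      then obtain m n where "a \<in> K m" "b \<in> K n" by blast
      hence "a \<in> K (max m n)" "b \<in> K (max m n)" using mono[of m "max m n"] mono[of n "max m n"] by auto
      hence "(\<lambda>(i, a, b). f i a b) (i, a, b) \<in> K (Suc (max m n))" unfolding K by blast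
      hence "f i a b \<in> K (Suc (max m n))" by simp
      thus ?case by blast
    qed
  qed
  ultimately show ?thesis using countable_subset by (metis countable_UN countableI_type)
qed

definition of_rat_pair :: "rat \<times> rat \<Rightarrow> complex" where
  "of_rat_pair q = Complex (of_rat (fst q)) (of_rat (snd q))"

lemma closure_of_rat_pair: "closure (range of_rat_pair) = UNIV"
proof -
  have "\<exists>y\<in>range of_rat_pair. dist y z < e" if e: "e > 0" for z and e :: real
  proof -
    obtain r where r: "Re z < of_rat r" "of_rat r < Re z + e/2" using of_rat_dense[of "Re z" "Re z + e/2"] e by auto
    obtain s where s: "Im z < of_rat s" "of_rat s < Im z + e/2" using of_rat_dense[of "Im z" "Im z + e/2"] e by auto
    have "dist (of_rat_pair (r, s)) z \<le> \<bar>of_rat r - Re z\<bar> + \<bar>of_rat s - Im z\<bar>"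
      unfolding dist_norm using cmod_le[of "of_rat_pair (r, s) - z"] by (simp add: of_rat_pair_def)
    also have "\<dots> < e" using r s by simp
    finally show ?thesis by blast
  qed
  thus ?thesis by (auto simp: closure_approachable)
qed

context pre_hilbert_space
begin

lemma ip_tendsto:
  assumes v: "\<And>k::nat. v k \<in> C" "x \<in> C" "(\<lambda>k. hnorm H (sub (v k) x)) \<longlonglongrightarrow> 0"
    and w: "\<And>k. w k \<in> C" "y \<in> C" "(\<lambda>k. hnorm H (sub (w k) y)) \<longlonglongrightarrow> 0"
  shows "(\<lambda>k. hip H (v k) (w k)) \<longlonglongrightarrow> hip H x y"
proof (rule LIM_zero_cancel, rule Lim_null_comparison[OF always_eventually[OF allI]])
  fix k
  have "hip H (v k) (w k) - hip H x y = hip H (sub (v k) x) (sub (w k) y) + hip H x (sub (w k) y) + hip H (sub (v k) x) y"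
    using v w by (simp add: ips)
  also have "norm \<dots> \<le> norm (hip H (sub (v k) x) (sub (w k) y)) + norm (hip H x (sub (w k) y)) + norm (hip H (sub (v k) x) y)"
    by (intro norm_triangle_le add_mono order_refl norm_triangle_ineq)
  also have "\<dots> \<le> hnorm H (sub (v k) x) * hnorm H (sub (w k) y) + hnorm H x * hnorm H (sub (w k) y) + hnorm H (sub (v k) x) * hnorm H y"
    by (intro add_mono cauchy_schwarz closed v w)
  finally show "norm (hip H (v k) (w k) - hip H x y) \<le> hnorm H (sub (v k) x) * hnorm H (sub (w k) y) + hnorm H x * hnorm H (sub (w k) y) + hnorm H (sub (v k) x) * hnorm H y" .
next
  have "(\<lambda>k. hnorm H (sub (v k) x) * hnorm H (sub (w k) y) + hnorm H x * hnorm H (sub (w k) y) + hnorm H (sub (v k) x) * hnorm H y) \<longlonglongrightarrow> 0 * 0 + hnorm H x * 0 + 0 * hnorm H y"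
    by (intro tendsto_intros v w)
  thus "(\<lambda>k. hnorm H (sub (v k) x) * hnorm H (sub (w k) y) + hnorm H x * hnorm H (sub (w k) y) + hnorm H (sub (v k) x) * hnorm H y) \<longlonglongrightarrow> 0"
    by simp
qed

lemma sub_const_tendsto: "x \<in> C \<Longrightarrow> (\<lambda>k::nat. hnorm H (sub x x)) \<longlonglongrightarrow> 0"
  by (simp add: sub_self)

lemma eq_if_sub_le:
  assumes "y \<in> C" "z \<in> C" "\<And>e. e > 0 \<Longrightarrow> hnorm H (sub y z) \<le> e * K"
  shows "y = z"
proof -
  have "((\<lambda>e. e * K) \<longlongrightarrow> 0 * K) (at_right (0::real))" by (intro tendsto_intros)
  moreover have "\<forall>\<^sub>F e in at_right (0::real). hnorm H (sub y z) \<le> e * K"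
    by (rule eventually_mono[OF eventually_at_right_less assms(3)])
  ultimately have "hnorm H (sub y z) \<le> 0 * K" by (rule tendsto_lowerbound) simp
  hence "hnorm H (sub y z) = 0" using hnorm_nonneg[OF sub_closed[OF assms(1,2)]] by simp
  hence "sub y z = hzero H" by (rule hnorm_eq_zero[OF sub_closed[OF assms(1,2)]])
  thus ?thesis using assms sub_zero_imp_eq by blast
qed

end

context hilbert_space
begin

text \<open>Contractivity makes the action of the dense algebra well defined and extends it to all \<open>a\<close> by continuity.
The relation \<open>R\<close> takes the place of a function on the dense algebra, so that well-definedness is a consequence and
not an assumption. The algebraic identities pass to the limit in inner products; for products one factor is moved to
the other side by the adjoint.\<close>

lemma extend_dense_representation:
  fixes R :: "('a::unital_cstar_algebra \<times> ('v \<Rightarrow> 'v)) set"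
  assumes op: "\<And>a T. (a, T) \<in> R \<Longrightarrow> T \<in> bounded_operators H"
    and bound: "\<And>a T v. (a, T) \<in> R \<Longrightarrow> v \<in> C \<Longrightarrow> hnorm H (T v) \<le> norm a * hnorm H v"
    and add: "\<And>a T b U. (a, T) \<in> R \<Longrightarrow> (b, U) \<in> R \<Longrightarrow> \<exists>W. (a + b, W) \<in> R \<and> (\<forall>v\<in>C. W v = hadd H (T v) (U v))"
    and mult: "\<And>a T b U. (a, T) \<in> R \<Longrightarrow> (b, U) \<in> R \<Longrightarrow> \<exists>W. (a * b, W) \<in> R \<and> (\<forall>v\<in>C. W v = T (U v))"
    and scale: "\<And>a T q. (a, T) \<in> R \<Longrightarrow> \<exists>W. (scaleC (of_rat_pair q) a, W) \<in> R \<and> (\<forall>v\<in>C. W v = hscale H (of_rat_pair q) (T v))"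
    and star: "\<And>a T. (a, T) \<in> R \<Longrightarrow> \<exists>W. (star a, W) \<in> R \<and> (\<forall>v\<in>C. \<forall>w\<in>C. hip H (W v) w = hip H v (T w))"
    and one: "\<exists>T. (1, T) \<in> R \<and> (\<forall>v\<in>C. T v = v)"
    and dense: "closure (fst ` R) = UNIV"
  obtains \<rho> where "representation H \<rho>"
    "\<And>a b T v. (b, T) \<in> R \<Longrightarrow> v \<in> C \<Longrightarrow> hnorm H (sub (\<rho> a v) (T v)) \<le> norm (a - b) * hnorm H v"
proof -
  have cl: "T v \<in> C" if "(a, T) \<in> R" "v \<in> C" for a T v
    using op[OF that(1)] that(2) by (auto simp: bounded_operators_def)
  have lin: "T (hadd H v w) = hadd H (T v) (T w)" "T (hscale H c v) = hscale H c (T v)"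
    if "(a, T) \<in> R" "v \<in> C" "w \<in> C" for a T v w c
    using op[OF that(1)] that(2,3) by (auto simp: bounded_operators_def)
  have diff: "hnorm H (sub (T v) (U v)) \<le> norm (a - b) * hnorm H v" if aTbU: "(a, T) \<in> R" "(b, U) \<in> R" "v \<in> C" for a T b U v
  proof -
    have m1: "of_rat_pair (-1, 0) = -1" by (simp add: of_rat_pair_def complex_eq_iff)
    obtain W where W: "(scaleC (-1) b, W) \<in> R" "\<forall>v\<in>C. W v = hscale H (-1) (U v)"
      using scale[OF aTbU(2), of "(-1, 0)"] unfolding m1 by blast
    obtain V where V: "(a + scaleC (-1) b, V) \<in> R" "\<forall>v\<in>C. V v = hadd H (T v) (W v)"
      using add[OF aTbU(1) W(1)] by blast
    have "V v = sub (T v) (U v)" using V(2) W(2) aTbU(3) by (simp add: sub_def)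
    moreover have "a + scaleC (-1) b = a - b" by simp
    ultimately show ?thesis using bound[OF V(1) aTbU(3)] by simp
  qed
  have seq: "\<exists>r. \<forall>k. r k \<in> R \<and> norm (fst (r k) - a) \<le> (1/2)^k" for a
  proof -
    have "\<exists>p. p \<in> R \<and> norm (fst p - a) \<le> (1/2)^k" for k :: nat
    proof -
      have "a \<in> closure (fst ` R)" using dense by simp
      hence "\<forall>e>0. \<exists>y\<in>fst ` R. dist y a < e" by (simp only: closure_approachable)
      hence "\<exists>y\<in>fst ` R. dist y a < (1/2)^k" by (rule allE[of _ "(1/2)^k"]) simp
      then obtain p where "p \<in> R" "dist (fst p) a < (1/2)^k" by blast
      thus ?thesis by (intro exI[of _ p]) (simp add: dist_norm)
    qed
    thus ?thesis by metis
  qed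
  have ex: "\<exists>y\<in>C. \<forall>b T. (b, T) \<in> R \<longrightarrow> hnorm H (sub y (T v)) \<le> norm (a - b) * hnorm H v" if v: "v \<in> C" for a v
  proof -
    obtain r where r: "\<And>k. r k \<in> R" "\<And>k. norm (fst (r k) - a) \<le> (1/2)^k" using seq by metis
    have rR: "(fst (r k), snd (r k)) \<in> R" for k using r(1) by simp
    have rC: "snd (r k) v \<in> C" for k by (rule cl[OF rR v])
    have st: "hnorm H (sub (snd (r k) v) (snd (r (Suc k)) v)) \<le> (2 * (1/2)^k) * hnorm H v" for k
    proof -
      have "norm (fst (r k) - fst (r (Suc k))) \<le> norm (fst (r k) - a) + norm (fst (r (Suc k)) - a)"
        using norm_triangle_ineq4[of "fst (r k) - a" "fst (r (Suc k)) - a"] by simp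
      also have "\<dots> \<le> (1/2)^k + (1/2)^Suc k" by (intro add_mono r)
      also have "\<dots> \<le> 2 * (1/2)^k" by simp
      finally show ?thesis
        using diff[OF rR rR v, of k "Suc k"] hnorm_nonneg[OF v] by (meson mult_right_mono order_trans)
    qed
    have "summable (\<lambda>k. (2 * (1/2)^k) * hnorm H v)"
      by (intro summable_mult2 summable_mult summable_geometric) simp
    then obtain y where y: "y \<in> C" "(\<lambda>k. hnorm H (sub (snd (r k) v) y)) \<longlonglongrightarrow> 0"
      using summable_limit[of "\<lambda>k. snd (r k) v", OF rC st] by blast
    have "hnorm H (sub y (T v)) \<le> norm (a - b) * hnorm H v" if bT: "(b, T) \<in> R" for b T
    proof -
      have "hnorm H (sub y (T v)) \<le> hnorm H (sub (snd (r k) v) y) + (norm (a - b) + (1/2)^k) * hnorm H v" for k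
      proof -
        have "hnorm H (sub y (T v)) \<le> hnorm H (sub y (snd (r k) v)) + hnorm H (sub (snd (r k) v) (T v))"
          by (intro sub_triangle y rC cl[OF bT v])
        also have "hnorm H (sub y (snd (r k) v)) = hnorm H (sub (snd (r k) v) y)"
          by (intro sub_commute y rC)
        also have "hnorm H (sub (snd (r k) v) (T v)) \<le> norm (fst (r k) - b) * hnorm H v"
          by (rule diff[OF rR bT v])
        also have "norm (fst (r k) - b) \<le> norm (a - b) + (1/2)^k"
          using norm_triangle_ineq[of "fst (r k) - a" "a - b"] r(2)[of k] by simp
        finally show ?thesis using hnorm_nonneg[OF v] by (simp add: mult_right_mono)
      qed
      moreover have "(\<lambda>k. hnorm H (sub (snd (r k) v) y) + (norm (a - b) + (1/2)^k) * hnorm H v)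
          \<longlonglongrightarrow> 0 + (norm (a - b) + 0) * hnorm H v"
        by (intro tendsto_intros y LIMSEQ_power_zero) simp
      ultimately show ?thesis using LIMSEQ_le_const[of _ _ "hnorm H (sub y (T v))"] by fastforce
    qed
    with y(1) show ?thesis by blast
  qed
  define \<rho> where "\<rho> a = (\<lambda>v\<in>C. SOME y. y \<in> C \<and> (\<forall>b T. (b, T) \<in> R \<longrightarrow> hnorm H (sub y (T v)) \<le> norm (a - b) * hnorm H v))" for a
  have \<rho>: "\<rho> a v \<in> C" "\<And>b T. (b, T) \<in> R \<Longrightarrow> hnorm H (sub (\<rho> a v) (T v)) \<le> norm (a - b) * hnorm H v"
    if v: "v \<in> C" for a v
  proof -
    have "\<exists>y. y \<in> C \<and> (\<forall>b T. (b, T) \<in> R \<longrightarrow> hnorm H (sub y (T v)) \<le> norm (a - b) * hnorm H v)"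
      using ex[OF v] by blast
    from someI_ex[OF this] show "\<rho> a v \<in> C" "\<And>b T. (b, T) \<in> R \<Longrightarrow> hnorm H (sub (\<rho> a v) (T v)) \<le> norm (a - b) * hnorm H v"
      using v by (auto simp: \<rho>_def)
  qed
  have conv: "(\<lambda>k. hnorm H (sub (T k v) (\<rho> a v))) \<longlonglongrightarrow> 0"
    if R: "\<And>k::nat. (b k, T k) \<in> R" and b: "b \<longlonglongrightarrow> a" and v: "v \<in> C" for b T a v
  proof (rule Lim_null_comparison[OF always_eventually[OF allI]])
    show "norm (hnorm H (sub (T k v) (\<rho> a v))) \<le> norm (a - b k) * hnorm H v" for k
      using \<rho>(2)[OF v R, of a k] sub_commute[OF cl[OF R v] \<rho>(1)[OF v], of k a]
        hnorm_nonneg[OF sub_closed[OF cl[OF R v] \<rho>(1)[OF v]], of k a] by simp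
    have "(\<lambda>k. norm (a - b k) * hnorm H v) \<longlonglongrightarrow> norm (a - a) * hnorm H v"
      by (intro tendsto_intros b)
    thus "(\<lambda>k. norm (a - b k) * hnorm H v) \<longlonglongrightarrow> 0" by simp
  qed
  have conv_ip: "(\<lambda>k. hip H (T k v) w) \<longlonglongrightarrow> hip H (\<rho> a v) w"
    if R: "\<And>k::nat. (b k, T k) \<in> R" and b: "b \<longlonglongrightarrow> a" and v: "v \<in> C" "w \<in> C" for b T a v w
    by (rule ip_tendsto[of "\<lambda>k. T k v" _ "\<lambda>_. w"])
      (use conv[of b T, OF R b v(1)] sub_const_tendsto v \<rho>(1) cl[OF R] in auto)
  have approx: "\<exists>b T. (\<forall>k::nat. (b k, T k) \<in> R) \<and> b \<longlonglongrightarrow> a" for a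
  proof -
    obtain r where r: "\<And>k. r k \<in> R" "\<And>k. norm (fst (r k) - a) \<le> (1/2)^k" using seq by metis
    have "(\<lambda>k. fst (r k)) \<longlonglongrightarrow> a"
      by (rule LIM_zero_cancel, rule Lim_null_comparison[OF always_eventually[OF allI[OF r(2)]]])
        (rule LIMSEQ_power_zero, simp)
    thus ?thesis using r(1) by (intro exI[of _ "\<lambda>k. fst (r k)"] exI[of _ "\<lambda>k. snd (r k)"]) simp
  qed
  have \<rho>_bounded: "\<rho> a \<in> bounded_operators H" for a
  proof -
    obtain b T where bT: "\<And>k. (b k, T k) \<in> R" and b: "b \<longlonglongrightarrow> a" using approx by metis
    note lims = conv_ip[of b T, OF bT b]
    have "\<rho> a (hadd H v w) = hadd H (\<rho> a v) (\<rho> a w)" if vw: "v \<in> C" "w \<in> C" for v w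
    proof (rule eq_by_ip)
      fix u assume u: "u \<in> C"
      have "(\<lambda>k. hip H (T k v) u + hip H (T k w) u) \<longlonglongrightarrow> hip H (\<rho> a v) u + hip H (\<rho> a w) u"
        by (intro tendsto_add lims vw u)
      moreover have "hip H (T k v) u + hip H (T k w) u = hip H (T k (hadd H v w)) u" for k
        using lin(1)[OF bT vw] cl[OF bT] vw u by (simp add: ips)
      ultimately have "hip H (\<rho> a (hadd H v w)) u = hip H (\<rho> a v) u + hip H (\<rho> a w) u"
        using lims[OF add_closed[OF vw] u] by (simp add: LIMSEQ_unique)
      thus "hip H (\<rho> a (hadd H v w)) u = hip H (hadd H (\<rho> a v) (\<rho> a w)) u" using \<rho>(1) vw u by (simp add: ips)
    qed (use vw \<rho>(1) closed in auto)
    moreover have "\<rho> a (hscale H c v) = hscale H c (\<rho> a v)" if v: "v \<in> C" for c v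
    proof (rule eq_by_ip)
      fix u assume u: "u \<in> C"
      have "(\<lambda>k. c * hip H (T k v) u) \<longlonglongrightarrow> c * hip H (\<rho> a v) u"
        by (intro tendsto_mult_left lims v u)
      moreover have "c * hip H (T k v) u = hip H (T k (hscale H c v)) u" for k
        using lin(2)[OF bT v v] cl[OF bT] v u by (simp add: ips)
      ultimately have "(\<lambda>k. hip H (T k (hscale H c v)) u) \<longlonglongrightarrow> c * hip H (\<rho> a v) u" by simp
      hence "hip H (\<rho> a (hscale H c v)) u = c * hip H (\<rho> a v) u"
        by (rule LIMSEQ_unique[OF lims[OF scale_closed[OF v] u]])
      thus "hip H (\<rho> a (hscale H c v)) u = hip H (hscale H c (\<rho> a v)) u" using \<rho>(1) v u by (simp add: ips)
    qed (use v \<rho>(1) closed in auto)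
    moreover have "hnorm H (\<rho> a v) \<le> (norm (a - b 0) + norm (b 0)) * hnorm H v" if v: "v \<in> C" for v
    proof -
      have "hnorm H (\<rho> a v) \<le> hnorm H (T 0 v) + hnorm H (sub (\<rho> a v) (T 0 v))"
        using hnorm_sub_diff[OF \<rho>(1)[OF v] cl[OF bT v], of a 0] by linarith
      thus ?thesis using \<rho>(2)[OF v bT, of a 0] bound[OF bT v, of 0] by (simp add: distrib_right)
    qed
    moreover have "\<rho> a \<in> C \<rightarrow>\<^sub>E C" using \<rho>(1) by (auto simp: \<rho>_def)
    ultimately show ?thesis unfolding bounded_operators_def by blast
  qed
  have \<rho>_add: "\<rho> (a + a') v = hadd H (\<rho> a v) (\<rho> a' v)" if v: "v \<in> C" for a a' v
  proof (rule eq_by_ip)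
    fix u assume u: "u \<in> C"
    obtain b T where bT: "\<And>k. (b k, T k) \<in> R" and b: "b \<longlonglongrightarrow> a" using approx by metis
    obtain b' T' where bT': "\<And>k. (b' k, T' k) \<in> R" and b': "b' \<longlonglongrightarrow> a'" using approx by metis
    have "\<forall>k. \<exists>W. (b k + b' k, W) \<in> R \<and> (\<forall>v\<in>C. W v = hadd H (T k v) (T' k v))"
      using add[OF bT bT'] by blast
    then obtain W where W: "\<And>k. (b k + b' k, W k) \<in> R" "\<And>k v. v \<in> C \<Longrightarrow> W k v = hadd H (T k v) (T' k v)" by metis
    have "(\<lambda>k. hip H (W k v) u) \<longlonglongrightarrow> hip H (\<rho> (a + a') v) u"
      by (rule conv_ip[OF W(1) tendsto_add[OF b b'] v u])
    moreover have "(\<lambda>k. hip H (T k v) u + hip H (T' k v) u) \<longlonglongrightarrow> hip H (\<rho> a v) u + hip H (\<rho> a' v) u"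
      by (intro tendsto_add conv_ip[OF bT b v u] conv_ip[OF bT' b' v u])
    moreover have "hip H (W k v) u = hip H (T k v) u + hip H (T' k v) u" for k
      using cl[OF bT v] cl[OF bT' v] v u by (simp add: W(2) ips)
    ultimately have "hip H (\<rho> (a + a') v) u = hip H (\<rho> a v) u + hip H (\<rho> a' v) u" by (simp add: LIMSEQ_unique)
    thus "hip H (\<rho> (a + a') v) u = hip H (hadd H (\<rho> a v) (\<rho> a' v)) u" using \<rho>(1) v u by (simp add: ips)
  qed (use v \<rho>(1) closed in auto)
  have \<rho>_scale: "\<rho> (scaleC c a) v = hscale H c (\<rho> a v)" if v: "v \<in> C" for a c v
  proof (rule eq_by_ip)
    fix u assume u: "u \<in> C"
    obtain b T where bT: "\<And>k. (b k, T k) \<in> R" and b: "b \<longlonglongrightarrow> a" using approx by metis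
    have "c \<in> closure (range of_rat_pair)" using closure_of_rat_pair by simp
    then obtain z where z: "\<And>k. z k \<in> range of_rat_pair" "z \<longlonglongrightarrow> c" unfolding closure_sequential by metis
    have "\<forall>k. \<exists>q. z k = of_rat_pair q" using z(1) by blast
    then obtain q where q: "\<And>k. z k = of_rat_pair (q k)" by metis
    have "\<forall>k. \<exists>W. (scaleC (z k) (b k), W) \<in> R \<and> (\<forall>v\<in>C. W v = hscale H (z k) (T k v))"
      unfolding q using scale[OF bT] by blast
    then obtain W where W: "\<And>k. (scaleC (z k) (b k), W k) \<in> R" "\<And>k v. v \<in> C \<Longrightarrow> W k v = hscale H (z k) (T k v)" by metis
    have "(\<lambda>k. scaleC (z k) (b k)) \<longlonglongrightarrow> scaleC c a"
    proof (rule LIM_zero_cancel, rule Lim_null_comparison[OF always_eventually[OF allI]])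
      fix k
      have "scaleC (z k) (b k) - scaleC c a = scaleC (z k) (b k - a) + scaleC (z k - c) a"
        using scaleC_add_left[of "z k - c" c a] by (simp add: scaleC_diff_right)
      thus "norm (scaleC (z k) (b k) - scaleC c a) \<le> cmod (z k) * norm (b k - a) + cmod (z k - c) * norm a"
        using norm_triangle_ineq[of "scaleC (z k) (b k - a)" "scaleC (z k - c) a"] by (simp add: norm_scaleC)
    next
      have "(\<lambda>k. cmod (z k) * norm (b k - a) + cmod (z k - c) * norm a) \<longlonglongrightarrow> cmod c * norm (a - a) + cmod (c - c) * norm a"
        by (intro tendsto_intros b z)
      thus "(\<lambda>k. cmod (z k) * norm (b k - a) + cmod (z k - c) * norm a) \<longlonglongrightarrow> 0" by simp
    qed
    from conv_ip[OF W(1) this v u] have "(\<lambda>k. hip H (W k v) u) \<longlonglongrightarrow> hip H (\<rho> (scaleC c a) v) u" .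
    moreover have "(\<lambda>k. z k * hip H (T k v) u) \<longlonglongrightarrow> c * hip H (\<rho> a v) u"
      by (intro tendsto_mult z conv_ip[OF bT b v u])
    moreover have "hip H (W k v) u = z k * hip H (T k v) u" for k
      using cl[OF bT v] v u by (simp add: W(2) ips)
    ultimately have "hip H (\<rho> (scaleC c a) v) u = c * hip H (\<rho> a v) u" by (simp add: LIMSEQ_unique)
    thus "hip H (\<rho> (scaleC c a) v) u = hip H (hscale H c (\<rho> a v)) u" using \<rho>(1) v u by (simp add: ips)
  qed (use v \<rho>(1) closed in auto)
  have star_tendsto: "(\<lambda>k. star (b k)) \<longlonglongrightarrow> star a" if "b \<longlonglongrightarrow> a" for b :: "nat \<Rightarrow> 'a" and a
    by (rule bounded_linear.tendsto[OF bounded_linear_star that])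
  have \<rho>_star: "hip H (\<rho> (star a) v) w = hip H v (\<rho> a w)" if v: "v \<in> C" "w \<in> C" for a v w
  proof -
    obtain b T where bT: "\<And>k. (b k, T k) \<in> R" and b: "b \<longlonglongrightarrow> a" using approx by metis
    have "\<forall>k. \<exists>W. (star (b k), W) \<in> R \<and> (\<forall>v\<in>C. \<forall>w\<in>C. hip H (W v) w = hip H v (T k w))"
      using star[OF bT] by blast
    then obtain W where W: "\<And>k. (star (b k), W k) \<in> R" "\<And>k v w. v \<in> C \<Longrightarrow> w \<in> C \<Longrightarrow> hip H (W k v) w = hip H v (T k w)" by metis
    have "(\<lambda>k. hip H (W k v) w) \<longlonglongrightarrow> hip H (\<rho> (star a) v) w"
      by (rule conv_ip[OF W(1) star_tendsto[OF b] v])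
    moreover have "(\<lambda>k. hip H v (T k w)) \<longlonglongrightarrow> hip H v (\<rho> a w)"
      by (rule ip_tendsto[of "\<lambda>_. v" _ "\<lambda>k. T k w"])
        (use conv[of b T, OF bT b v(2)] sub_const_tendsto v \<rho>(1) cl[OF bT] in auto)
    ultimately show ?thesis using W(2)[OF v] by (simp add: LIMSEQ_unique)
  qed
  have \<rho>_mult: "\<rho> (a * a') v = \<rho> a (\<rho> a' v)" if v: "v \<in> C" for a a' v
  proof (rule eq_by_ip)
    fix u assume u: "u \<in> C"
    obtain b T where bT: "\<And>k. (b k, T k) \<in> R" and b: "b \<longlonglongrightarrow> a" using approx by metis
    obtain b' T' where bT': "\<And>k. (b' k, T' k) \<in> R" and b': "b' \<longlonglongrightarrow> a'" using approx by metis
    have "\<forall>k. \<exists>W. (b k * b' k, W) \<in> R \<and> (\<forall>v\<in>C. W v = T k (T' k v))"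
      using mult[OF bT bT'] by blast
    then obtain W where W: "\<And>k. (b k * b' k, W k) \<in> R" "\<And>k v. v \<in> C \<Longrightarrow> W k v = T k (T' k v)" by metis
    have "\<forall>k. \<exists>W. (star (b k), W) \<in> R \<and> (\<forall>v\<in>C. \<forall>w\<in>C. hip H (W v) w = hip H v (T k w))"
      using star[OF bT] by blast
    then obtain V where V: "\<And>k. (star (b k), V k) \<in> R" "\<And>k v w. v \<in> C \<Longrightarrow> w \<in> C \<Longrightarrow> hip H (V k v) w = hip H v (T k w)" by metis
    have 1: "(\<lambda>k. hip H (W k v) u) \<longlonglongrightarrow> hip H (\<rho> (a * a') v) u"
      by (rule conv_ip[OF W(1) tendsto_mult[OF b b'] v u])
    have 2: "(\<lambda>k. hip H (T' k v) (V k u)) \<longlonglongrightarrow> hip H (\<rho> a' v) (\<rho> (star a) u)"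
      by (rule ip_tendsto[of "\<lambda>k. T' k v" _ "\<lambda>k. V k u"])
        (use conv[of b' T', OF bT' b' v] conv[of "\<lambda>k. star (b k)" V, OF V(1) star_tendsto[OF b] u] u v \<rho>(1) cl[OF bT'] cl[OF V(1)] in auto)
    have "hip H (W k v) u = hip H (T' k v) (V k u)" for k
    proof -
      have "hip H (V k u) (T' k v) = hip H u (T k (T' k v))" by (rule V(2)[OF u cl[OF bT' v]])
      hence "cnj (hip H (V k u) (T' k v)) = cnj (hip H u (T k (T' k v)))" by simp
      thus ?thesis unfolding W(2)[OF v]
        using ip_commute[OF cl[OF V(1) u] cl[OF bT' v], of k k] ip_commute[OF u cl[OF bT cl[OF bT' v]], of k k] by simp
    qed
    with 1 2 have "hip H (\<rho> (a * a') v) u = hip H (\<rho> a' v) (\<rho> (star a) u)" by (simp add: LIMSEQ_unique)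
    also have "\<dots> = hip H (\<rho> (star (star a)) (\<rho> a' v)) u" by (rule \<rho>_star[symmetric]) (use \<rho>(1) v u in auto)
    finally show "hip H (\<rho> (a * a') v) u = hip H (\<rho> a (\<rho> a' v)) u" by (simp add: star_star)
  qed (use v \<rho>(1) in auto)
  have "\<rho> 1 = (\<lambda>v\<in>C. v)"
  proof (rule extensionalityI[of _ C])
    fix v assume v: "v \<in> C"
    obtain T where T: "(1, T) \<in> R" "\<forall>v\<in>C. T v = v" using one by blast
    have "hnorm H (sub (\<rho> 1 v) v) \<le> 0" using \<rho>(2)[OF v T(1), of 1] T(2) v by simp
    hence "\<rho> 1 v = v" by (intro eq_if_sub_le[where K = 0] \<rho>(1)[OF v] v) simp
    thus "\<rho> 1 v = (\<lambda>v\<in>C. v) v" using v by simp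
  qed (simp_all add: \<rho>_def)
  hence "representation H \<rho>"
    unfolding representation_def operator_linear_on_def
    using \<rho>_bounded \<rho>_add \<rho>_scale \<rho>_mult \<rho>_star by simp
  thus ?thesis using that \<rho>(2) by blast
qed

end

section \<open>Sections of a standard Hilbert bundle\<close>

context pre_hilbert_space
begin

lemma hclosed_span_minimal:
  assumes K: "hsubspace H K" "A \<subseteq> K"
    and lim: "\<And>v. v \<in> C \<Longrightarrow> (\<And>e. e > 0 \<Longrightarrow> \<exists>k\<in>K. hnorm H (sub v k) < e) \<Longrightarrow> v \<in> K"
  shows "hclosed_span H A \<subseteq> K"
proof
  fix v assume "v \<in> hclosed_span H A"
  hence v: "v \<in> M.mtopology closure_of \<Inter>{V. hsubspace H V \<and> A \<subseteq> V}" by (simp add: hclosed_span_def)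
  have sub_K: "\<Inter>{V. hsubspace H V \<and> A \<subseteq> V} \<subseteq> K" using K by blast
  have vC: "v \<in> C" using v by (simp add: M.metric_closure_of)
  have KC: "K \<subseteq> C" using K by (simp add: hsubspace_def)
  show "v \<in> K"
  proof (rule lim[OF vC])
    fix e :: real assume "e > 0"
    then obtain k where k: "k \<in> \<Inter>{V. hsubspace H V \<and> A \<subseteq> V}" "k \<in> M.mball v e"
      using v unfolding M.metric_closure_of by blast
    have "k \<in> K" using k(1) sub_K by blast
    moreover have "hdist H v k < e" using k(2) by (simp add: M.in_mball)
    ultimately show "\<exists>k\<in>K. hnorm H (sub v k) < e" using vC KC by (intro bexI[of _ k]) (auto simp: hdist_sub)
  qed
qed

text \<open>The orthogonal complement of \<open>w\<close> is a closed subspace.\<close>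

lemma total_orthogonal_zero:
  assumes tot: "hclosed_span H A = C" and A: "A \<subseteq> C" and w: "w \<in> C" "\<And>a. a \<in> A \<Longrightarrow> hip H a w = 0"
  shows "w = hzero H"
proof -
  define K where "K = {v\<in>C. hip H v w = 0}"
  have "hclosed_span H A \<subseteq> K"
  proof (rule hclosed_span_minimal)
    show "hsubspace H K" using w(1) by (auto simp: hsubspace_def K_def ips)
    show "A \<subseteq> K" using A w by (auto simp: K_def)
    fix v assume v: "v \<in> C" and *: "\<And>e. e > 0 \<Longrightarrow> \<exists>k\<in>K. hnorm H (sub v k) < e"
    have "cmod (hip H v w) \<le> e" if "e > 0" for e
    proof -
      have "e / (hnorm H w + 1) > 0" using that hnorm_nonneg[OF w(1)] by simp
      then obtain k where k: "k \<in> K" "hnorm H (sub v k) < e / (hnorm H w + 1)" using * by blast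
      have "hip H v w = hip H (sub v k) w" using k(1) v w(1) by (simp add: K_def ips)
      also have "cmod \<dots> \<le> hnorm H (sub v k) * hnorm H w"
        by (rule cauchy_schwarz) (use k v w in \<open>auto simp: K_def sub_closed\<close>)
      also have "\<dots> \<le> e / (hnorm H w + 1) * (hnorm H w + 1)"
        using k(2) hnorm_nonneg[OF w(1)] that by (intro mult_mono) auto
      also have "\<dots> = e" using hnorm_nonneg[OF w(1)] by simp
      finally show ?thesis .
    qed
    hence "cmod (hip H v w) \<le> 0" by (rule field_le_epsilon[of _ 0, simplified])
    thus "v \<in> K" using v by (simp add: K_def)
  qed
  hence "hip H w w = 0" using tot w(1) by (auto simp: K_def)
  thus ?thesis by (rule ip_definite[OF w(1)])
qed

end

locale hilbert_bundle_measure = standard_hilbert_bundle X B + prob_space \<mu>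
  for X :: "'x measure" and B :: "('x, 'h) hilbert_bundle" and \<mu> :: "'x measure" +
  assumes sets_eq: "sets \<mu> = sets X" and base_standard: "standard_borel_space X"
begin

lemma space_eq: "space \<mu> = space X"
  using sets_eq by (rule sets_eq_imp_space_eq)

lemma measurable_eq: "measurable \<mu> N = measurable X N"
  by (rule measurable_cong_sets) (simp_all add: sets_eq)

abbreviation "F \<equiv> fiber B"
abbreviation "sections \<equiv> borel_sections X B"
abbreviation "L2 \<equiv> L2_sections \<mu> B"
abbreviation "D \<equiv> direct_integral \<mu> B"

lemma fiber_simps [simp]:
  "hzero (F x) = bzero B x" "hadd (F x) = badd B" "hscale (F x) = bscale B" "hip (F x) = bip B"
  by (simp_all add: fiber_def)

lemma fiber_carrier: "h \<in> hcarrier (F x) \<longleftrightarrow> h \<in> space (btotal B) \<and> bproj B h = x"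
  by (simp add: fiber_def)

lemma fiber_hilbert_space: "x \<in> space X \<Longrightarrow> hilbert_space (F x)"
  by (rule fiber_hilbert)

lemma section_in_fiber: "\<xi> \<in> sections \<Longrightarrow> x \<in> space X \<Longrightarrow> \<xi> x \<in> hcarrier (F x)"
  by (auto simp: borel_sections_def fiber_carrier measurable_space)

lemma sectionI:
  assumes "\<xi> \<in> X \<rightarrow>\<^sub>M btotal B" "\<And>x. x \<in> space X \<Longrightarrow> \<xi> x \<in> hcarrier (F x)"
  shows "\<xi> \<in> sections"
  using assms by (auto simp: borel_sections_def fiber_carrier)

lemma section_measurable: "\<xi> \<in> sections \<Longrightarrow> \<xi> \<in> X \<rightarrow>\<^sub>M btotal B"
  by (simp add: borel_sections_def)

lemma pair_measurable:
  assumes f: "f \<in> N \<rightarrow>\<^sub>M btotal B" and g: "g \<in> N \<rightarrow>\<^sub>M btotal B"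
    and fg: "\<And>y. y \<in> space N \<Longrightarrow> bproj B (f y) = bproj B (g y)"
  shows "(\<lambda>y. (f y, g y)) \<in> N \<rightarrow>\<^sub>M same_fiber_pairs B"
  unfolding same_fiber_pairs_def
  by (rule measurable_restrict_space2) (use f g fg in \<open>auto intro!: measurable_Pair\<close>)

lemma bip_measurable_gen:
  assumes "f \<in> N \<rightarrow>\<^sub>M btotal B" "g \<in> N \<rightarrow>\<^sub>M btotal B"
    "\<And>y. y \<in> space N \<Longrightarrow> bproj B (f y) = bproj B (g y)"
  shows "(\<lambda>y. bip B (f y) (g y)) \<in> borel_measurable N"
  using measurable_compose[OF pair_measurable[OF assms] ip_measurable] by simp

lemma section_add:
  assumes "\<xi> \<in> sections" "\<eta> \<in> sections"
  shows "(\<lambda>x. badd B (\<xi> x) (\<eta> x)) \<in> sections"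
proof (rule sectionI)
  have "(\<lambda>x. (\<xi> x, \<eta> x)) \<in> X \<rightarrow>\<^sub>M same_fiber_pairs B"
    by (rule pair_measurable) (use assms in \<open>auto simp: borel_sections_def\<close>)
  from measurable_compose[OF this add_measurable]
  show "(\<lambda>x. badd B (\<xi> x) (\<eta> x)) \<in> X \<rightarrow>\<^sub>M btotal B" by simp
  fix x assume x: "x \<in> space X"
  interpret hilbert_space "F x" by (rule fiber_hilbert_space[OF x])
  show "badd B (\<xi> x) (\<eta> x) \<in> hcarrier (F x)"
    using add_closed assms section_in_fiber x by simp
qed

lemma section_scale:
  assumes "\<xi> \<in> sections" "f \<in> borel_measurable X"
  shows "(\<lambda>x. bscale B (f x) (\<xi> x)) \<in> sections"
proof (rule sectionI)
  have "(\<lambda>x. (f x, \<xi> x)) \<in> X \<rightarrow>\<^sub>M borel \<Otimes>\<^sub>M btotal B"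
    using assms section_measurable by (intro measurable_Pair) auto
  from measurable_compose[OF this scale_measurable]
  show "(\<lambda>x. bscale B (f x) (\<xi> x)) \<in> X \<rightarrow>\<^sub>M btotal B" by simp
  fix x assume x: "x \<in> space X"
  interpret hilbert_space "F x" by (rule fiber_hilbert_space[OF x])
  show "bscale B (f x) (\<xi> x) \<in> hcarrier (F x)"
    using scale_closed assms section_in_fiber x by simp
qed

lemma section_ip:
  assumes "\<xi> \<in> sections" "\<eta> \<in> sections"
  shows "(\<lambda>x. bip B (\<xi> x) (\<eta> x)) \<in> borel_measurable X"
  by (rule bip_measurable_gen) (use assms in \<open>auto simp: borel_sections_def\<close>)

lemma section_norm:
  assumes "\<xi> \<in> sections"
  shows "(\<lambda>x. hnorm (F x) (\<xi> x)) \<in> borel_measurable X"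
  unfolding hnorm_def using section_ip[OF assms assms] by simp

definition basic_section :: "nat \<Rightarrow> 'x \<Rightarrow> 'h" where
  "basic_section = (SOME \<xi>. (\<forall>n. \<xi> n \<in> sections) \<and>
     (\<forall>x\<in>space X. hclosed_span (F x) (range (\<lambda>n. \<xi> n x)) = hcarrier (F x)))"

lemma basic_section: "basic_section n \<in> sections"
  "x \<in> space X \<Longrightarrow> hclosed_span (F x) (range (\<lambda>n. basic_section n x)) = hcarrier (F x)"
  using someI_ex[OF total_sections] unfolding basic_section_def by blast+

lemma section_cong:
  assumes "\<xi> \<in> sections" "\<And>x. x \<in> space X \<Longrightarrow> \<xi> x = \<eta> x"
  shows "\<eta> \<in> sections"
  using assms measurable_cong[of X \<xi> \<eta> "btotal B"] by (auto simp: borel_sections_def)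

lemma section_zero: "bzero B \<in> sections"
proof (rule section_cong)
  show "(\<lambda>x. bscale B 0 (basic_section 0 x)) \<in> sections" by (rule section_scale[OF basic_section(1)]) simp
  fix x assume x: "x \<in> space X"
  interpret hilbert_space "F x" by (rule fiber_hilbert_space[OF x])
  show "bscale B 0 (basic_section 0 x) = bzero B x" using scale_zero section_in_fiber[OF basic_section(1) x] by simp
qed

text \<open>The base point and the coordinates against a total sequence of sections are countably many Borel functions on
the total space that separate points, so by Blackwell's theorem they generate its Borel structure.\<close>

lemma section_by_coordinates:
  assumes f: "\<And>x. x \<in> space X \<Longrightarrow> \<eta> x \<in> hcarrier (F x)"
    and ip: "\<And>n. (\<lambda>x. bip B (\<eta> x) (basic_section n x)) \<in> borel_measurable X"
  shows "\<eta> \<in> sections"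
proof (rule sectionI[OF _ f])
  obtain T where T: "completely_metrizable_space T" "separable_space T" "topspace T = space X"
      "sets X = sigma_sets (topspace T) {U. openin T U}"
    using base_standard unfolding standard_borel_space_def by blast
  have mT: "metrizable_space T" using T(1) by (rule completely_metrizable_imp_metrizable_space)
  obtain \<W> where \<W>: "countable \<W>" "\<And>V. V \<in> \<W> \<Longrightarrow> openin T V"
      "\<And>U x. openin T U \<Longrightarrow> x \<in> U \<Longrightarrow> \<exists>V\<in>\<W>. x \<in> V \<and> V \<subseteq> U"
    using second_countable_separable_metrizable[OF mT T(2)] unfolding second_countable_def by metis
  have \<W>_sets: "V \<in> sets X" if "V \<in> \<W>" for V
    unfolding T(4) by (rule sigma_sets.Basic) (use \<W>(2) that in simp)
  obtain \<V> :: "complex set set" where \<V>: "countable \<V>" "topological_basis \<V>"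
    using ex_countable_basis by blast
  let ?Z = "btotal B"
  define base where "base V = {h \<in> space ?Z. bproj B h \<in> V}" for V
  define coord where "coord n V = {h \<in> space ?Z. bip B h (basic_section n (bproj B h)) \<in> V}" for n V
  define \<U> where "\<U> = insert (space ?Z) (base ` \<W> \<union> (\<lambda>(n, V). coord n V) ` (UNIV \<times> \<V>))"
  have cU: "countable \<U>" unfolding \<U>_def using \<W>(1) \<V>(1) by auto
  have base_sets: "base V \<in> sets ?Z" if "V \<in> sets X" for V
  proof -
    have "base V = bproj B -` V \<inter> space ?Z" by (auto simp: base_def)
    thus ?thesis using measurable_sets[OF proj_measurable that] by simp
  qed
  have coord_sets: "coord n V \<in> sets ?Z" if "open V" for n V
  proof -
    have ts: "(\<lambda>h. basic_section n (bproj B h)) \<in> ?Z \<rightarrow>\<^sub>M ?Z"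
      by (rule measurable_compose[OF proj_measurable section_measurable[OF basic_section(1)]])
    have "(\<lambda>h. bip B h (basic_section n (bproj B h))) \<in> borel_measurable ?Z"
    proof (rule bip_measurable_gen[OF measurable_ident_sets[OF refl] ts])
      fix h assume "h \<in> space ?Z"
      hence "bproj B h \<in> space X" using proj_measurable by (rule measurable_space[rotated])
      thus "bproj B h = bproj B (basic_section n (bproj B h))"
        using section_in_fiber[OF basic_section(1), of "bproj B h" n] by (simp add: fiber_carrier)
    qed
    hence "(\<lambda>h. bip B h (basic_section n (bproj B h))) -` V \<inter> space ?Z \<in> sets ?Z"
      using that by (intro measurable_sets[of _ _ borel]) auto
    moreover have "coord n V = (\<lambda>h. bip B h (basic_section n (bproj B h))) -` V \<inter> space ?Z"
      by (auto simp: coord_def)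
    ultimately show ?thesis by simp
  qed
  have \<U>_sets: "W \<in> sets ?Z" if "W \<in> \<U>" for W
    using that base_sets \<W>_sets coord_sets topological_basis_open[OF \<V>(2)] by (auto simp: \<U>_def)
  define U where "U = from_nat_into \<U>"
  have rU: "range U = \<U>"
    unfolding U_def by (rule range_from_nat_into[OF _ cU]) (simp add: \<U>_def)
  have sets_Z: "sets ?Z = sigma_sets (space ?Z) (range U)"
  proof (rule countable_separating_generates[OF standard_borel_total])
    show "U n \<in> sets ?Z" for n using \<U>_sets rU by blast
    fix h k assume h: "h \<in> space ?Z" and k: "k \<in> space ?Z" and ne: "h \<noteq> k"
    have hX: "bproj B h \<in> space X" "bproj B k \<in> space X"
      using h k proj_measurable by (auto intro: measurable_space)
    have "\<exists>W\<in>\<U>. (h \<in> W) \<noteq> (k \<in> W)"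
    proof (cases "bproj B h = bproj B k")
      case False
      have "Hausdorff_space T" using mT by (rule metrizable_imp_Hausdorff_space)
      then obtain V V' where V: "openin T V" "openin T V'" "bproj B h \<in> V" "bproj B k \<in> V'" "disjnt V V'"
        using False hX unfolding Hausdorff_space_def T(3) by blast
      obtain W where W: "W \<in> \<W>" "bproj B h \<in> W" "W \<subseteq> V" using \<W>(3)[OF V(1,3)] by blast
      have "bproj B k \<notin> W" using W(3) V(4,5) by (auto simp: disjnt_def)
      hence "(h \<in> base W) \<noteq> (k \<in> base W)" using h W(2) by (simp add: base_def)
      moreover have "base W \<in> \<U>" using W(1) by (simp add: \<U>_def)
      ultimately show ?thesis by blast
    next
      case True
      define x where "x = bproj B h"
      have x: "x \<in> space X" using hX by (simp add: x_def)
      interpret hilbert_space "F x" by (rule fiber_hilbert_space[OF x])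
      have hk: "h \<in> hcarrier (F x)" "k \<in> hcarrier (F x)" using h k True by (auto simp: fiber_carrier x_def)
      have tx: "basic_section n x \<in> hcarrier (F x)" for n by (rule section_in_fiber[OF basic_section(1) x])
      have "\<exists>n. bip B h (basic_section n x) \<noteq> bip B k (basic_section n x)"
      proof (rule ccontr)
        assume nt: "\<not> ?thesis"
        have "hip (F x) (basic_section n x) (sub h k) = 0" for n
        proof -
          have "bip B (basic_section n x) h = cnj (bip B h (basic_section n x))" "bip B (basic_section n x) k = cnj (bip B k (basic_section n x))"
            using ip_commute[OF hk(1) tx] ip_commute[OF hk(2) tx] by simp_all
          thus ?thesis using ip_sub_right[OF tx hk] nt by simp
        qed
        hence "sub h k = hzero (F x)"
          using tx hk by (intro total_orthogonal_zero[OF basic_section(2)[OF x]]) (auto simp: sub_closed)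
        thus False using ne sub_zero_imp_eq hk by blast
      qed
      then obtain n where n: "bip B h (basic_section n x) \<noteq> bip B k (basic_section n x)" by blast
      obtain V where V: "open V" "bip B h (basic_section n x) \<in> V" "bip B k (basic_section n x) \<notin> V"
        using t1_space[OF n] by blast
      obtain W where W: "W \<in> \<V>" "bip B h (basic_section n x) \<in> W" "W \<subseteq> V"
        using topological_basisE[OF \<V>(2) V(1,2)] by metis
      have "(h \<in> coord n W) \<noteq> (k \<in> coord n W)"
        using W V(3) h True by (auto simp: coord_def x_def)
      moreover have "coord n W \<in> \<U>" using W(1) by (force simp: \<U>_def)
      ultimately show ?thesis by blast
    qed
    thus "\<exists>n. (h \<in> U n) \<noteq> (k \<in> U n)" using rU by (metis imageE)
  qed
  show "\<eta> \<in> X \<rightarrow>\<^sub>M ?Z"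
  proof (rule measurable_sigma_sets[OF sets_Z])
    show "range U \<subseteq> Pow (space ?Z)" using \<U>_sets sets.sets_into_space unfolding rU by blast
    show \<eta>Z: "\<eta> \<in> space X \<rightarrow> space ?Z" using f by (auto simp: fiber_carrier)
    fix W assume "W \<in> range U"
    hence "W = space ?Z \<or> (\<exists>V\<in>\<W>. W = base V) \<or> (\<exists>n. \<exists>V\<in>\<V>. W = coord n V)"
      unfolding rU \<U>_def by auto
    thus "\<eta> -` W \<inter> space X \<in> sets X"
    proof (elim disjE bexE exE)
      assume "W = space ?Z"
      hence "\<eta> -` W \<inter> space X = space X" using \<eta>Z by auto
      thus ?thesis by simp
    next
      fix V assume V: "V \<in> \<W>" "W = base V"
      have "\<eta> -` W \<inter> space X = V \<inter> space X" using f by (auto simp: V(2) base_def fiber_carrier)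
      thus ?thesis using \<W>_sets[OF V(1)] by simp
    next
      fix n V assume V: "V \<in> \<V>" "W = coord n V"
      have "\<eta> -` W \<inter> space X = (\<lambda>x. bip B (\<eta> x) (basic_section n x)) -` V \<inter> space X"
        using f by (auto simp: V(2) coord_def fiber_carrier)
      thus ?thesis using ip[of n] topological_basis_open[OF \<V>(2) V(1)]
        by (metis borel_open measurable_sets)
    qed
  qed
qed


subsection \<open>Square-integrable sections and their classes\<close>

lemma L2_iff: "\<xi> \<in> L2 \<longleftrightarrow> \<xi> \<in> sections \<and> integrable \<mu> (\<lambda>x. (hnorm (F x) (\<xi> x))\<^sup>2)"
  by (simp add: L2_sections_def borel_sections_def measurable_eq space_eq)

lemma L2_section: "\<xi> \<in> L2 \<Longrightarrow> \<xi> \<in> sections"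
  by (simp add: L2_iff)

lemma L2_in_fiber: "\<xi> \<in> L2 \<Longrightarrow> x \<in> space X \<Longrightarrow> \<xi> x \<in> hcarrier (F x)"
  by (rule section_in_fiber[OF L2_section])

lemma L2_dominated:
  assumes \<zeta>: "\<zeta> \<in> sections" and g: "integrable \<mu> g"
    and le: "\<And>x. x \<in> space X \<Longrightarrow> (hnorm (F x) (\<zeta> x))\<^sup>2 \<le> g x"
  shows "\<zeta> \<in> L2"
  unfolding L2_iff
proof (intro conjI \<zeta> Bochner_Integration.integrable_bound[OF g] AE_I2)
  show "(\<lambda>x. (hnorm (F x) (\<zeta> x))\<^sup>2) \<in> borel_measurable \<mu>"
    using section_norm[OF \<zeta>] by (simp add: measurable_eq)
  show "norm ((hnorm (F x) (\<zeta> x))\<^sup>2) \<le> norm (g x)" if "x \<in> space \<mu>" for x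
    using le[of x] that by (simp add: space_eq)
qed

lemma L2_scale:
  assumes "\<xi> \<in> L2" "f \<in> borel_measurable X" "\<And>x. x \<in> space X \<Longrightarrow> cmod (f x) \<le> K"
  shows "(\<lambda>x. bscale B (f x) (\<xi> x)) \<in> L2"
proof (rule L2_dominated)
  show "(\<lambda>x. bscale B (f x) (\<xi> x)) \<in> sections" by (rule section_scale[OF L2_section[OF assms(1)] assms(2)])
  show "integrable \<mu> (\<lambda>x. K\<^sup>2 * (hnorm (F x) (\<xi> x))\<^sup>2)" using assms(1) by (simp add: L2_iff)
  fix x assume x: "x \<in> space X"
  interpret hilbert_space "F x" by (rule fiber_hilbert_space[OF x])
  have "hnorm (F x) (bscale B (f x) (\<xi> x)) = cmod (f x) * hnorm (F x) (\<xi> x)"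
    using hnorm_scale[OF L2_in_fiber[OF assms(1) x]] by simp
  thus "(hnorm (F x) (bscale B (f x) (\<xi> x)))\<^sup>2 \<le> K\<^sup>2 * (hnorm (F x) (\<xi> x))\<^sup>2"
    using assms(3)[OF x] by (auto simp: power_mult_distrib intro!: mult_right_mono power_mono)
qed

lemma L2_scale_const: "\<xi> \<in> L2 \<Longrightarrow> (\<lambda>x. bscale B c (\<xi> x)) \<in> L2"
  by (rule L2_scale[where K = "cmod c"]) auto

lemma L2_add:
  assumes "\<xi> \<in> L2" "\<eta> \<in> L2"
  shows "(\<lambda>x. badd B (\<xi> x) (\<eta> x)) \<in> L2"
proof (rule L2_dominated)
  show "(\<lambda>x. badd B (\<xi> x) (\<eta> x)) \<in> sections" by (intro section_add L2_section assms)
  show "integrable \<mu> (\<lambda>x. 2 * (hnorm (F x) (\<xi> x))\<^sup>2 + 2 * (hnorm (F x) (\<eta> x))\<^sup>2)"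
    using assms by (simp add: L2_iff)
  fix x assume x: "x \<in> space X"
  interpret hilbert_space "F x" by (rule fiber_hilbert_space[OF x])
  show "(hnorm (F x) (badd B (\<xi> x) (\<eta> x)))\<^sup>2 \<le> 2 * (hnorm (F x) (\<xi> x))\<^sup>2 + 2 * (hnorm (F x) (\<eta> x))\<^sup>2"
    using parallelogram[OF assms[THEN L2_in_fiber[OF _ x]]] zero_le_power2[of "hnorm (F x) (sub (\<xi> x) (\<eta> x))"]
    by (simp only: fiber_simps)
qed

lemma L2_zero: "bzero B \<in> L2"
proof (rule L2_dominated[OF section_zero])
  show "integrable \<mu> (\<lambda>x. 0 :: real)" by simp
  fix x assume x: "x \<in> space X"
  interpret hilbert_space "F x" by (rule fiber_hilbert_space[OF x])
  show "(hnorm (F x) (bzero B x))\<^sup>2 \<le> 0" using hnorm_zero by simp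
qed

lemma L2_ip:
  assumes "\<xi> \<in> L2" "\<eta> \<in> L2"
  shows "integrable \<mu> (\<lambda>x. bip B (\<xi> x) (\<eta> x))"
proof (rule Bochner_Integration.integrable_bound[where f = "\<lambda>x. (hnorm (F x) (\<xi> x))\<^sup>2 + (hnorm (F x) (\<eta> x))\<^sup>2"])
  show "integrable \<mu> (\<lambda>x. (hnorm (F x) (\<xi> x))\<^sup>2 + (hnorm (F x) (\<eta> x))\<^sup>2)"
    using assms by (simp add: L2_iff)
  show "(\<lambda>x. bip B (\<xi> x) (\<eta> x)) \<in> borel_measurable \<mu>"
    using section_ip[OF assms[THEN L2_section]] by (simp add: measurable_eq)
  show "AE x in \<mu>. norm (bip B (\<xi> x) (\<eta> x)) \<le> norm ((hnorm (F x) (\<xi> x))\<^sup>2 + (hnorm (F x) (\<eta> x))\<^sup>2)"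
  proof (rule AE_I2)
    fix x assume "x \<in> space \<mu>"
    hence x: "x \<in> space X" by (simp add: space_eq)
    interpret hilbert_space "F x" by (rule fiber_hilbert_space[OF x])
    have "norm (bip B (\<xi> x) (\<eta> x)) \<le> hnorm (F x) (\<xi> x) * hnorm (F x) (\<eta> x)"
      using cauchy_schwarz[OF assms[THEN L2_in_fiber[OF _ x]]] by simp
    also have "\<dots> \<le> (hnorm (F x) (\<xi> x))\<^sup>2 + (hnorm (F x) (\<eta> x))\<^sup>2"
    proof -
      have "a * b \<le> a\<^sup>2 + b\<^sup>2" for a b :: real
      proof -
        have "0 \<le> (a - b)\<^sup>2" "0 \<le> (a + b)\<^sup>2" by simp_all
        thus ?thesis by (simp add: power2_sum power2_diff)
      qed
      thus ?thesis .
    qed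
    finally show "norm (bip B (\<xi> x) (\<eta> x)) \<le> norm ((hnorm (F x) (\<xi> x))\<^sup>2 + (hnorm (F x) (\<eta> x))\<^sup>2)" by simp
  qed
qed

abbreviation cls :: "('x \<Rightarrow> 'h) \<Rightarrow> ('x \<Rightarrow> 'h) set" where "cls \<equiv> ae_class \<mu> B"

lemma cls_mem: "\<eta> \<in> cls \<xi> \<longleftrightarrow> \<xi> \<in> L2 \<and> \<eta> \<in> L2 \<and> (AE x in \<mu>. \<xi> x = \<eta> x)"
  by (simp add: ae_equal_def)

lemma equiv_ae_equal: "equiv L2 (ae_equal \<mu> B)"
proof (rule equivI)
  show "trans (ae_equal \<mu> B)"
  proof (rule transI)
    fix \<xi> \<eta> \<zeta> assume "(\<xi>, \<eta>) \<in> ae_equal \<mu> B" "(\<eta>, \<zeta>) \<in> ae_equal \<mu> B"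
    hence *: "\<xi> \<in> L2" "\<zeta> \<in> L2" "AE x in \<mu>. \<xi> x = \<eta> x" "AE x in \<mu>. \<eta> x = \<zeta> x"
      by (auto simp: ae_equal_def)
    from *(3,4) have "AE x in \<mu>. \<xi> x = \<zeta> x" by eventually_elim simp
    with * show "(\<xi>, \<zeta>) \<in> ae_equal \<mu> B" by (simp add: ae_equal_def)
  qed
qed (auto simp: ae_equal_def refl_on_def sym_def eq_commute)

lemma D_carrier: "hcarrier D = L2 // ae_equal \<mu> B"
  by (simp add: direct_integral_def)

lemma cls_in_D: "\<xi> \<in> L2 \<Longrightarrow> cls \<xi> \<in> hcarrier D"
  unfolding D_carrier by (rule quotientI)

lemma cls_eq: "\<xi> \<in> L2 \<Longrightarrow> \<eta> \<in> L2 \<Longrightarrow> cls \<xi> = cls \<eta> \<longleftrightarrow> (AE x in \<mu>. \<xi> x = \<eta> x)"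
  using eq_equiv_class_iff[OF equiv_ae_equal, of \<xi> \<eta>] by (simp add: ae_equal_def)

lemma D_rep:
  assumes "u \<in> hcarrier D"
  shows "ae_rep u \<in> L2" "cls (ae_rep u) = u"
proof -
  obtain \<xi> where \<xi>: "\<xi> \<in> L2" "u = cls \<xi>" using assms unfolding D_carrier by (auto elim: quotientE)
  have "\<xi> \<in> u" using \<xi> cls_mem[of \<xi> \<xi>] by simp
  hence "ae_rep u \<in> u" unfolding ae_rep_def by (rule someI[of "\<lambda>\<xi>. \<xi> \<in> u"])
  hence *: "ae_rep u \<in> L2" "AE x in \<mu>. \<xi> x = ae_rep u x" using \<xi> cls_mem[of "ae_rep u" \<xi>] by auto
  show "ae_rep u \<in> L2" by (rule *(1))
  show "cls (ae_rep u) = u" using cls_eq[OF \<xi>(1) *(1)] *(2) \<xi>(2) by simp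
qed

lemma rep_cls: "\<xi> \<in> L2 \<Longrightarrow> AE x in \<mu>. ae_rep (cls \<xi>) x = \<xi> x"
  using D_rep[OF cls_in_D, of \<xi>] cls_eq[of "ae_rep (cls \<xi>)" \<xi>] by blast

lemma D_simps [simp]:
  "hzero D = cls (bzero B)" by (simp add: direct_integral_def)

lemma D_add:
  assumes "\<xi> \<in> L2" "\<eta> \<in> L2"
  shows "hadd D (cls \<xi>) (cls \<eta>) = cls (\<lambda>x. badd B (\<xi> x) (\<eta> x))"
proof -
  have "cls (\<lambda>x. badd B (ae_rep (cls \<xi>) x) (ae_rep (cls \<eta>) x)) = cls (\<lambda>x. badd B (\<xi> x) (\<eta> x))"
  proof (subst cls_eq)
    show "AE x in \<mu>. badd B (ae_rep (cls \<xi>) x) (ae_rep (cls \<eta>) x) = badd B (\<xi> x) (\<eta> x)"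
      using rep_cls[OF assms(1)] rep_cls[OF assms(2)] by eventually_elim simp
  qed (intro L2_add D_rep cls_in_D assms)+
  thus ?thesis by (simp add: direct_integral_def)
qed

lemma D_scale:
  assumes "\<xi> \<in> L2"
  shows "hscale D c (cls \<xi>) = cls (\<lambda>x. bscale B c (\<xi> x))"
proof -
  have "cls (\<lambda>x. bscale B c (ae_rep (cls \<xi>) x)) = cls (\<lambda>x. bscale B c (\<xi> x))"
  proof (subst cls_eq)
    show "AE x in \<mu>. bscale B c (ae_rep (cls \<xi>) x) = bscale B c (\<xi> x)"
      using rep_cls[OF assms(1)] by eventually_elim simp
  qed (intro L2_scale_const D_rep cls_in_D assms)+
  thus ?thesis by (simp add: direct_integral_def)
qed

lemma D_ip:
  assumes "\<xi> \<in> L2" "\<eta> \<in> L2"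
  shows "hip D (cls \<xi>) (cls \<eta>) = (\<integral>x. bip B (\<xi> x) (\<eta> x) \<partial>\<mu>)"
proof -
  have "(\<integral>x. bip B (ae_rep (cls \<xi>) x) (ae_rep (cls \<eta>) x) \<partial>\<mu>) = (\<integral>x. bip B (\<xi> x) (\<eta> x) \<partial>\<mu>)"
  proof (rule integral_cong_AE)
    show "AE x in \<mu>. bip B (ae_rep (cls \<xi>) x) (ae_rep (cls \<eta>) x) = bip B (\<xi> x) (\<eta> x)"
      using rep_cls[OF assms(1)] rep_cls[OF assms(2)] by eventually_elim simp
  qed (intro borel_measurable_integrable L2_ip D_rep cls_in_D assms)+
  thus ?thesis by (simp add: direct_integral_def)
qed

lemma D_E:
  assumes "u \<in> hcarrier D" obtains \<xi> where "\<xi> \<in> L2" "u = cls \<xi>"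
  using D_rep[OF assms] that by metis

lemma cls_cong:
  assumes "\<xi> \<in> L2" "\<eta> \<in> L2" "\<And>x. x \<in> space X \<Longrightarrow> \<xi> x = \<eta> x"
  shows "cls \<xi> = cls \<eta>"
  using cls_eq[OF assms(1,2)] assms(3) by (auto intro!: AE_I2 simp: space_eq)

lemma norm_sq_integral:
  assumes "\<xi> \<in> L2"
  shows "hip D (cls \<xi>) (cls \<xi>) = complex_of_real (\<integral>x. (hnorm (F x) (\<xi> x))\<^sup>2 \<partial>\<mu>)"
    "(hnorm D (cls \<xi>))\<^sup>2 = (\<integral>x. (hnorm (F x) (\<xi> x))\<^sup>2 \<partial>\<mu>)"
proof -
  have "hip D (cls \<xi>) (cls \<xi>) = (\<integral>x. bip B (\<xi> x) (\<xi> x) \<partial>\<mu>)" by (rule D_ip[OF assms assms])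
  also have "\<dots> = (\<integral>x. complex_of_real ((hnorm (F x) (\<xi> x))\<^sup>2) \<partial>\<mu>)"
  proof (rule Bochner_Integration.integral_cong[OF refl])
    fix x assume "x \<in> space \<mu>"
    hence x: "x \<in> space X" by (simp add: space_eq)
    interpret hilbert_space "F x" by (rule fiber_hilbert_space[OF x])
    show "bip B (\<xi> x) (\<xi> x) = complex_of_real ((hnorm (F x) (\<xi> x))\<^sup>2)"
      using ip_self[OF L2_in_fiber[OF assms x]] by simp
  qed
  also have "\<dots> = complex_of_real (\<integral>x. (hnorm (F x) (\<xi> x))\<^sup>2 \<partial>\<mu>)" by (rule integral_complex_of_real)
  finally show *: "hip D (cls \<xi>) (cls \<xi>) = complex_of_real (\<integral>x. (hnorm (F x) (\<xi> x))\<^sup>2 \<partial>\<mu>)" .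
  show "(hnorm D (cls \<xi>))\<^sup>2 = (\<integral>x. (hnorm (F x) (\<xi> x))\<^sup>2 \<partial>\<mu>)"
    unfolding hnorm_def * by (simp add: hnorm_def[symmetric])
qed

text \<open>All identities hold pointwise for representing sections.\<close>

lemma pre_hilbert_D: "pre_hilbert_space D"
proof
  note L = L2_add L2_scale_const L2_zero
  show "hzero D \<in> hcarrier D" using L cls_in_D by simp
  show "hadd D v w \<in> hcarrier D" if "v \<in> hcarrier D" "w \<in> hcarrier D" for v w
    using that by (auto elim!: D_E simp: D_add L cls_in_D)
  show "hscale D c v \<in> hcarrier D" if "v \<in> hcarrier D" for c v
    using that by (auto elim!: D_E simp: D_scale L cls_in_D)
  show "hadd D (hadd D u v) w = hadd D u (hadd D v w)"
    if "u \<in> hcarrier D" "v \<in> hcarrier D" "w \<in> hcarrier D" for u v w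
  proof -
    note t = that
    obtain \<xi> where 1: "\<xi> \<in> L2" "u = cls \<xi>" by (rule D_E[OF t(1)])
    obtain \<eta> where 2: "\<eta> \<in> L2" "v = cls \<eta>" by (rule D_E[OF t(2)])
    obtain \<zeta> where 3: "\<zeta> \<in> L2" "w = cls \<zeta>" by (rule D_E[OF t(3)])
    note * = 1 2 3
    show ?thesis unfolding * D_add[OF *(1,3)] D_add[OF *(3,5)] D_add[OF L(1)[OF *(1,3)] *(5)]
      D_add[OF *(1) L(1)[OF *(3,5)]]
      by (intro cls_cong L *)
        (use hilbert_space.add_assoc[OF fiber_hilbert_space] L2_in_fiber[OF *(1)] L2_in_fiber[OF *(3)] L2_in_fiber[OF *(5)] in simp)
  qed
  show "hadd D v w = hadd D w v" if "v \<in> hcarrier D" "w \<in> hcarrier D" for v w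
  proof -
    note t = that
    obtain \<xi> where 1: "\<xi> \<in> L2" "v = cls \<xi>" by (rule D_E[OF t(1)])
    obtain \<eta> where 2: "\<eta> \<in> L2" "w = cls \<eta>" by (rule D_E[OF t(2)])
    note * = 1 2
    show ?thesis unfolding * D_add[OF *(1,3)] D_add[OF *(3,1)]
      by (intro cls_cong L *) (use hilbert_space.add_commute[OF fiber_hilbert_space] L2_in_fiber[OF *(1)] L2_in_fiber[OF *(3)] in simp)
  qed
  show "hadd D (hzero D) v = v" if "v \<in> hcarrier D" for v
  proof -
    note t = that
    obtain \<xi> where *: "\<xi> \<in> L2" "v = cls \<xi>" by (rule D_E[OF t(1)])
    show ?thesis unfolding * D_simps D_add[OF L(3) *(1)]
      by (intro cls_cong L *) (use hilbert_space.add_zero[OF fiber_hilbert_space] L2_in_fiber[OF *(1)] in simp)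
  qed
  show "hadd D v (hscale D (-1) v) = hzero D" if "v \<in> hcarrier D" for v
  proof -
    note t = that
    obtain \<xi> where *: "\<xi> \<in> L2" "v = cls \<xi>" by (rule D_E[OF t(1)])
    show ?thesis unfolding * D_simps D_scale[OF *(1)] D_add[OF *(1) L(2)[OF *(1)]]
      by (intro cls_cong L *) (use hilbert_space.add_inverse[OF fiber_hilbert_space] L2_in_fiber[OF *(1)] in simp)
  qed
  show "hscale D c (hadd D v w) = hadd D (hscale D c v) (hscale D c w)"
    if "v \<in> hcarrier D" "w \<in> hcarrier D" for v w c
  proof -
    note t = that
    obtain \<xi> where 1: "\<xi> \<in> L2" "v = cls \<xi>" by (rule D_E[OF t(1)])
    obtain \<eta> where 2: "\<eta> \<in> L2" "w = cls \<eta>" by (rule D_E[OF t(2)])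
    note * = 1 2
    show ?thesis unfolding * D_add[OF *(1,3)] D_scale[OF *(1)] D_scale[OF *(3)] D_scale[OF L(1)[OF *(1,3)]]
        D_add[OF L(2)[OF *(1)] L(2)[OF *(3)]]
      by (intro cls_cong L *) (use hilbert_space.scale_add_right[OF fiber_hilbert_space] L2_in_fiber[OF *(1)] L2_in_fiber[OF *(3)] in simp)
  qed
  show "hscale D (c + d) v = hadd D (hscale D c v) (hscale D d v)" if "v \<in> hcarrier D" for v c d
  proof -
    note t = that
    obtain \<xi> where *: "\<xi> \<in> L2" "v = cls \<xi>" by (rule D_E[OF t(1)])
    show ?thesis unfolding * D_scale[OF *(1)] D_add[OF L(2)[OF *(1)] L(2)[OF *(1)]]
      by (intro cls_cong L *) (use hilbert_space.scale_add_left[OF fiber_hilbert_space] L2_in_fiber[OF *(1)] in simp)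
  qed
  show "hscale D c (hscale D d v) = hscale D (c * d) v" if "v \<in> hcarrier D" for v c d
  proof -
    note t = that
    obtain \<xi> where *: "\<xi> \<in> L2" "v = cls \<xi>" by (rule D_E[OF t(1)])
    show ?thesis unfolding * D_scale[OF *(1)] D_scale[OF L(2)[OF *(1)]]
      by (intro cls_cong L *) (use hilbert_space.scale_scale[OF fiber_hilbert_space] L2_in_fiber[OF *(1)] in simp)
  qed
  show "hscale D 1 v = v" if "v \<in> hcarrier D" for v
  proof -
    note t = that
    obtain \<xi> where *: "\<xi> \<in> L2" "v = cls \<xi>" by (rule D_E[OF t(1)])
    show ?thesis unfolding * D_scale[OF *(1)]
      by (intro cls_cong L *) (use hilbert_space.scale_one[OF fiber_hilbert_space] L2_in_fiber[OF *(1)] in simp)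
  qed
  show "hip D (hadd D u v) w = hip D u w + hip D v w"
    if "u \<in> hcarrier D" "v \<in> hcarrier D" "w \<in> hcarrier D" for u v w
  proof -
    note t = that
    obtain \<xi> where 1: "\<xi> \<in> L2" "u = cls \<xi>" by (rule D_E[OF t(1)])
    obtain \<eta> where 2: "\<eta> \<in> L2" "v = cls \<eta>" by (rule D_E[OF t(2)])
    obtain \<zeta> where 3: "\<zeta> \<in> L2" "w = cls \<zeta>" by (rule D_E[OF t(3)])
    note * = 1 2 3
    have "hip D (hadd D u v) w = (\<integral>x. bip B (badd B (\<xi> x) (\<eta> x)) (\<zeta> x) \<partial>\<mu>)"
      by (simp add: * D_add D_ip L)
    also have "\<dots> = (\<integral>x. bip B (\<xi> x) (\<zeta> x) + bip B (\<eta> x) (\<zeta> x) \<partial>\<mu>)"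
      by (rule Bochner_Integration.integral_cong[OF refl])
        (use hilbert_space.ip_add_left[OF fiber_hilbert_space] L2_in_fiber[OF *(1)] L2_in_fiber[OF *(3)] L2_in_fiber[OF *(5)] in \<open>simp add: space_eq\<close>)
    also have "\<dots> = hip D u w + hip D v w"
      using Bochner_Integration.integral_add[OF L2_ip[OF *(1,5)] L2_ip[OF *(3,5)]] by (simp add: * D_ip)
    finally show ?thesis .
  qed
  show "hip D (hscale D c v) w = c * hip D v w" if "v \<in> hcarrier D" "w \<in> hcarrier D" for v w c
  proof -
    note t = that
    obtain \<xi> where 1: "\<xi> \<in> L2" "v = cls \<xi>" by (rule D_E[OF t(1)])
    obtain \<eta> where 2: "\<eta> \<in> L2" "w = cls \<eta>" by (rule D_E[OF t(2)])
    note * = 1 2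
    have "hip D (hscale D c v) w = (\<integral>x. bip B (bscale B c (\<xi> x)) (\<eta> x) \<partial>\<mu>)"
      by (simp add: * D_scale D_ip L)
    also have "\<dots> = (\<integral>x. c * bip B (\<xi> x) (\<eta> x) \<partial>\<mu>)"
      by (rule Bochner_Integration.integral_cong[OF refl])
        (use hilbert_space.ip_scale_left[OF fiber_hilbert_space] L2_in_fiber[OF *(1)] L2_in_fiber[OF *(3)] in \<open>simp add: space_eq\<close>)
    also have "\<dots> = c * hip D v w" by (simp add: * D_ip)
    finally show ?thesis .
  qed
  show "hip D w v = cnj (hip D v w)" if "v \<in> hcarrier D" "w \<in> hcarrier D" for v w
  proof -
    note t = that
    obtain \<xi> where 1: "\<xi> \<in> L2" "v = cls \<xi>" by (rule D_E[OF t(1)])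
    obtain \<eta> where 2: "\<eta> \<in> L2" "w = cls \<eta>" by (rule D_E[OF t(2)])
    note * = 1 2
    have "hip D w v = (\<integral>x. cnj (bip B (\<xi> x) (\<eta> x)) \<partial>\<mu>)"
      unfolding * D_ip[OF *(3,1)]
    proof (rule Bochner_Integration.integral_cong[OF refl])
      fix x assume "x \<in> space \<mu>"
      hence x: "x \<in> space X" by (simp add: space_eq)
      show "bip B (\<eta> x) (\<xi> x) = cnj (bip B (\<xi> x) (\<eta> x))"
        using hilbert_space.ip_commute[OF fiber_hilbert_space[OF x] L2_in_fiber[OF *(1) x] L2_in_fiber[OF *(3) x]]
        by (simp only: fiber_simps)
    qed
    thus ?thesis by (simp add: * D_ip)
  qed
  show "hip D v v \<in> \<real>\<^sub>\<ge>\<^sub>0" if "v \<in> hcarrier D" for v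
  proof -
    note t = that
    obtain \<xi> where *: "\<xi> \<in> L2" "v = cls \<xi>" by (rule D_E[OF t(1)])
    show ?thesis unfolding * norm_sq_integral(1)[OF *(1)] by (simp add: complex_nonneg_Reals_iff)
  qed
  show "v = hzero D" if "v \<in> hcarrier D" "hip D v v = 0" for v
  proof -
    note t = that
    obtain \<xi> where *: "\<xi> \<in> L2" "v = cls \<xi>" by (rule D_E[OF t(1)])
    have "(\<integral>x. (hnorm (F x) (\<xi> x))\<^sup>2 \<partial>\<mu>) = 0"
      using that(2) norm_sq_integral(1)[OF *(1)] * by simp
    hence "AE x in \<mu>. (hnorm (F x) (\<xi> x))\<^sup>2 = 0"
      using integral_nonneg_eq_0_iff_AE[of \<mu> "\<lambda>x. (hnorm (F x) (\<xi> x))\<^sup>2"] *(1) by (simp add: L2_iff)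
    moreover have "AE x in \<mu>. x \<in> space \<mu>" by (rule AE_space)
    ultimately have "AE x in \<mu>. \<xi> x = bzero B x"
    proof eventually_elim
      case (elim x)
      hence x: "x \<in> space X" by (simp add: space_eq)
      interpret hilbert_space "F x" by (rule fiber_hilbert_space[OF x])
      show ?case using hnorm_eq_zero[OF L2_in_fiber[OF *(1) x]] elim by simp
    qed
    thus ?thesis using cls_eq[OF *(1) L(3)] * by simp
  qed
qed

end

section \<open>Completeness of the direct integral\<close>

lemma (in pre_hilbert_space) hilbert_space_if_complete:
  assumes "M.mcomplete" shows "hilbert_space H"
  by (rule hilbert_space.intro)
    (fact zero_closed add_closed scale_closed add_assoc add_commute add_zero add_inverse scale_add_right scale_add_left scale_scale scale_one ip_add_left ip_scale_left ip_commute ip_nonneg ip_definite assms)+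

context hilbert_bundle_measure
begin

lemma L2_cong: "\<xi> \<in> L2 \<Longrightarrow> (\<And>x. x \<in> space X \<Longrightarrow> \<xi> x = \<eta> x) \<Longrightarrow> \<eta> \<in> L2"
proof -
  assume *: "\<xi> \<in> L2" "\<And>x. x \<in> space X \<Longrightarrow> \<xi> x = \<eta> x"
  have "integrable \<mu> (\<lambda>x. (hnorm (F x) (\<xi> x))\<^sup>2) = integrable \<mu> (\<lambda>x. (hnorm (F x) (\<eta> x))\<^sup>2)"
    by (rule Bochner_Integration.integrable_cong[OF refl]) (use * in \<open>simp add: space_eq\<close>)
  with * show ?thesis using section_cong[of \<xi> \<eta>] by (simp add: L2_iff)
qed

definition diff where "diff \<xi> \<eta> x = badd B (\<xi> x) (bscale B (-1) (\<eta> x))"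

lemma diff_sub: "x \<in> space X \<Longrightarrow> diff \<xi> \<eta> x = pre_hilbert_space.sub (F x) (\<xi> x) (\<eta> x)"
proof -
  assume x: "x \<in> space X"
  interpret hilbert_space "F x" by (rule fiber_hilbert_space[OF x])
  show ?thesis by (simp add: diff_def sub_def)
qed

lemma diff_section: "\<xi> \<in> sections \<Longrightarrow> \<eta> \<in> sections \<Longrightarrow> diff \<xi> \<eta> \<in> sections"
  unfolding diff_def by (intro section_add section_scale) auto

lemma diff_L2: "\<xi> \<in> L2 \<Longrightarrow> \<eta> \<in> L2 \<Longrightarrow> diff \<xi> \<eta> \<in> L2"
  unfolding diff_def by (intro L2_add L2_scale_const)

lemma dist_sq:
  assumes "\<xi> \<in> L2" "\<eta> \<in> L2"
  shows "(hdist D (cls \<xi>) (cls \<eta>))\<^sup>2 = (\<integral>x. (hnorm (F x) (diff \<xi> \<eta> x))\<^sup>2 \<partial>\<mu>)"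
proof -
  have "hdist D (cls \<xi>) (cls \<eta>) = hnorm D (hadd D (cls \<xi>) (hscale D (-1) (cls \<eta>)))"
    using assms cls_in_D by (simp add: hdist_def)
  also have "hadd D (cls \<xi>) (hscale D (-1) (cls \<eta>)) = cls (diff \<xi> \<eta>)"
    unfolding D_scale[OF assms(2)] D_add[OF assms(1) L2_scale_const[OF assms(2)]]
    by (rule cls_cong) (use assms L2_add L2_scale_const diff_L2 in \<open>auto simp: diff_def\<close>)
  finally show ?thesis by (simp only: norm_sq_integral(2)[OF diff_L2[OF assms]])
qed

lemma nn_dist_sq:
  assumes "\<xi> \<in> L2" "\<eta> \<in> L2"
  shows "(\<integral>\<^sup>+x. ennreal ((hnorm (F x) (diff \<xi> \<eta> x))\<^sup>2) \<partial>\<mu>) = ennreal ((hdist D (cls \<xi>) (cls \<eta>))\<^sup>2)"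
  unfolding dist_sq[OF assms] by (rule nn_integral_eq_integral) (use diff_L2[OF assms] in \<open>auto simp: L2_iff\<close>)

lemma hdist_D_nonneg: "0 \<le> hdist D u v"
proof -
  interpret PD: pre_hilbert_space D by (rule pre_hilbert_D)
  show ?thesis by (rule PD.M.nonneg)
qed

lemma norm_measurable: "\<xi> \<in> sections \<Longrightarrow> (\<lambda>x. hnorm (F x) (\<xi> x)) \<in> borel_measurable \<mu>"
  using section_norm by (simp add: measurable_eq)

text \<open>The Riesz-Fischer argument. The increments are summable in almost every fiber, so the sections converge there;
the limit is Borel because its coordinates are, and Fatou's lemma gives the distances.\<close>

lemma pointwise_limit:
  assumes \<xi>: "\<And>k::nat. \<xi> k \<in> L2"
    and fast: "\<And>k m. k \<le> m \<Longrightarrow> hdist D (cls (\<xi> k)) (cls (\<xi> m)) \<le> (1/4)^k"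
  obtains \<eta> where "\<eta> \<in> L2" "\<And>k. hdist D (cls (\<xi> k)) (cls \<eta>) \<le> (1/4)^k"
proof -
  define d where "d k x = hnorm (F x) (diff (\<xi> k) (\<xi> (Suc k)) x)" for k x
  have d_meas: "d k \<in> borel_measurable \<mu>" for k
    unfolding d_def by (intro norm_measurable diff_section L2_section \<xi>)
  define g where "g x = suminf (\<lambda>k. ennreal (2^k * (d k x)\<^sup>2))" for x
  have g_meas: "g \<in> borel_measurable \<mu>" unfolding g_def using d_meas by measurable
  have "(\<integral>\<^sup>+x. ennreal (2^k * (d k x)\<^sup>2) \<partial>\<mu>) \<le> ennreal ((1/8)^k)" for k
  proof -
    have "(\<integral>\<^sup>+x. ennreal (2^k * (d k x)\<^sup>2) \<partial>\<mu>) = (\<integral>\<^sup>+x. ennreal (2^k) * ennreal ((d k x)\<^sup>2) \<partial>\<mu>)"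
      by (simp add: ennreal_mult)
    also have "\<dots> = ennreal (2^k) * (\<integral>\<^sup>+x. ennreal ((d k x)\<^sup>2) \<partial>\<mu>)"
      using d_meas by (intro nn_integral_cmult) measurable
    also have "(\<integral>\<^sup>+x. ennreal ((d k x)\<^sup>2) \<partial>\<mu>) = ennreal ((hdist D (cls (\<xi> k)) (cls (\<xi> (Suc k))))\<^sup>2)"
      unfolding d_def by (rule nn_dist_sq[OF \<xi> \<xi>])
    also have "ennreal (2^k) * \<dots> \<le> ennreal (2^k) * ennreal (((1/4)^k)\<^sup>2)"
    proof (intro mult_left_mono ennreal_leI power_mono)
      show "hdist D (cls (\<xi> k)) (cls (\<xi> (Suc k))) \<le> (1/4)^k" by (rule fast) simp
      show "0 \<le> hdist D (cls (\<xi> k)) (cls (\<xi> (Suc k)))" by (rule hdist_D_nonneg)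
    qed simp
    also have "\<dots> = ennreal (2^k * ((1/4)^k)\<^sup>2)" by (simp add: ennreal_mult)
    also have "2^k * ((1/4)^k)\<^sup>2 = ((1/8)^k :: real)"
    proof -
      have "2^k * ((1/4)^k)\<^sup>2 = (2 * (1/4) * (1/4) :: real)^k"
        by (simp only: power2_eq_square power_mult_distrib mult.assoc)
      thus ?thesis by simp
    qed
    finally show ?thesis .
  qed
  hence "suminf (\<lambda>k. \<integral>\<^sup>+x. ennreal (2^k * (d k x)\<^sup>2) \<partial>\<mu>) \<le> suminf (\<lambda>k. ennreal ((1/8)^k))"
    by (intro suminf_le summableI)
  also have "suminf (\<lambda>k. ennreal ((1/8)^k)) < \<infinity>"
  proof -
    have "summable (\<lambda>k. (1/8::real)^k)" by (rule summable_geometric) simp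
    hence "suminf (\<lambda>k. ennreal ((1/8)^k)) = ennreal (suminf (\<lambda>k. (1/8)^k))" by (rule suminf_ennreal2[rotated]) simp
    thus ?thesis by (simp only: ennreal_less_top infinity_ennreal_def)
  qed
  finally have "(\<integral>\<^sup>+x. g x \<partial>\<mu>) \<noteq> \<infinity>"
    unfolding g_def using d_meas by (subst nn_integral_suminf) auto
  hence AE_g: "AE x in \<mu>. g x \<noteq> \<infinity>" using nn_integral_PInf_AE[OF g_meas] by blast
  \<comment> \<open>on the complement of \<open>G\<close>, a null set, the limit section is set to zero\<close>
  define G where "G = {x \<in> space X. g x \<noteq> \<infinity>}"
  have G_sets: "G \<in> sets X"
  proof -
    have "G = space \<mu> - g -` {\<infinity>} \<inter> space \<mu>" by (auto simp: G_def space_eq)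
    also have "\<dots> \<in> sets \<mu>" using g_meas by measurable
    finally show ?thesis by (simp add: sets_eq)
  qed
  have AE_G: "AE x in \<mu>. x \<in> G" using AE_g AE_space[of \<mu>] by eventually_elim (simp add: G_def space_eq)
  have lim_ex: "\<exists>y. y \<in> hcarrier (F x) \<and> (\<lambda>k. hnorm (F x) (pre_hilbert_space.sub (F x) (\<xi> k x) y)) \<longlonglongrightarrow> 0"
    if "x \<in> G" for x
  proof -
    have x: "x \<in> space X" "g x \<noteq> \<infinity>" using that by (auto simp: G_def)
    interpret hilbert_space "F x" by (rule fiber_hilbert_space[OF x(1)])
    have "summable (\<lambda>k. 2^k * (d k x)\<^sup>2)"
      by (rule summable_suminf_not_top) (use x(2) in \<open>auto simp: g_def\<close>)
    hence s: "summable (\<lambda>k. (1/2)^k + 2^k * (d k x)\<^sup>2)"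
      by (intro summable_add summable_geometric) auto
    have "hnorm (F x) (sub (\<xi> k x) (\<xi> (Suc k) x)) \<le> (1/2)^k + 2^k * (d k x)\<^sup>2" for k
    proof -
      \<comment> \<open>this turns integrable weighted squares into summable norms\<close>
      have "a \<le> (1/2)^k + 2^k * a\<^sup>2" for a :: real
      proof -
        define q p :: real where "q = 2^k" and "p = (1/2)^k"
        have qp: "q * p = 1" "q > 0" by (simp_all add: q_def p_def power_mult_distrib[symmetric])
        have "0 \<le> q * (a - p)\<^sup>2" using qp(2) by simp
        also have "\<dots> = q * a\<^sup>2 - 2 * a * (q * p) + (q * p) * p"
          by (simp add: power2_diff power2_eq_square algebra_simps)
        also have "\<dots> = q * a\<^sup>2 - 2 * a + p" unfolding qp by simp
        finally have "2 * a \<le> 2^k * a\<^sup>2 + (1/2)^k" by (simp add: q_def p_def)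
        moreover have "0 \<le> 2^k * a\<^sup>2 + (1/2)^k" by simp
        ultimately show ?thesis by linarith
      qed
      thus ?thesis by (simp add: d_def diff_sub[OF x(1)])
    qed
    from summable_limit[of "\<lambda>k. \<xi> k x", OF L2_in_fiber[OF \<xi> x(1)] this s]
    show ?thesis by blast
  qed
  define \<eta> where "\<eta> x = (if x \<in> G then SOME y. y \<in> hcarrier (F x) \<and>
      (\<lambda>k. hnorm (F x) (pre_hilbert_space.sub (F x) (\<xi> k x) y)) \<longlonglongrightarrow> 0 else bzero B x)" for x
  have \<eta>G: "\<eta> x \<in> hcarrier (F x)" "(\<lambda>k. hnorm (F x) (pre_hilbert_space.sub (F x) (\<xi> k x) (\<eta> x))) \<longlonglongrightarrow> 0"
    if "x \<in> G" for x
    using someI_ex[OF lim_ex[OF that]] that by (auto simp: \<eta>_def)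
  have \<eta>F: "\<eta> x \<in> hcarrier (F x)" if "x \<in> space X" for x
    using \<eta>G(1)[of x] section_in_fiber[OF section_zero that] by (auto simp: \<eta>_def)
  have \<eta>_sec: "\<eta> \<in> sections"
  proof (rule section_by_coordinates[OF \<eta>F])
    fix n
    define \<xi>' where "\<xi>' k x = bscale B (indicator G x) (\<xi> k x)" for k x
    have "(\<lambda>x. indicator G x :: complex) \<in> borel_measurable X" using G_sets by measurable
    hence sec: "\<xi>' k \<in> sections" for k
      unfolding \<xi>'_def by (intro section_scale L2_section \<xi>)
    show "(\<lambda>x. bip B (\<eta> x) (basic_section n x)) \<in> borel_measurable X"
    proof (rule borel_measurable_LIMSEQ_metric)
      show "(\<lambda>x. bip B (\<xi>' k x) (basic_section n x)) \<in> borel_measurable X" for k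
        by (rule section_ip[OF sec basic_section(1)])
      fix x assume x: "x \<in> space X"
      interpret hilbert_space "F x" by (rule fiber_hilbert_space[OF x])
      note fx = section_in_fiber[OF basic_section(1) x, of n]
      show "(\<lambda>k. bip B (\<xi>' k x) (basic_section n x)) \<longlonglongrightarrow> bip B (\<eta> x) (basic_section n x)"
      proof (cases "x \<in> G")
        case True
        have e: "\<xi>' k x = \<xi> k x" for k
          using True scale_one[OF L2_in_fiber[OF \<xi> x]] by (simp add: \<xi>'_def)
        have bd: "norm (bip B (\<xi> k x) (basic_section n x) - bip B (\<eta> x) (basic_section n x))
            \<le> hnorm (F x) (sub (\<xi> k x) (\<eta> x)) * hnorm (F x) (basic_section n x)" for k
          using cauchy_schwarz[OF sub_closed[OF L2_in_fiber[OF \<xi> x] \<eta>F[OF x]] fx, of k]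
            ip_sub_left[OF L2_in_fiber[OF \<xi> x] \<eta>F[OF x] fx, of k] by simp
        show ?thesis unfolding e
          by (rule LIM_zero_cancel, rule Lim_null_comparison[OF always_eventually[OF allI[OF bd]]])
            (rule tendsto_mult_left_zero[OF \<eta>G(2)[OF True]])
      next
        case False
        have "\<xi>' k x = bzero B x" for k
          using False scale_zero[OF L2_in_fiber[OF \<xi> x]] by (simp add: \<xi>'_def)
        thus ?thesis using False by (simp add: \<eta>_def)
      qed
    qed
  qed
  have fatou: "(\<integral>\<^sup>+x. ennreal ((hnorm (F x) (diff (\<xi> k) \<eta> x))\<^sup>2) \<partial>\<mu>) \<le> ennreal (((1/4)^k)\<^sup>2)" for k
  proof -
    have "(\<integral>\<^sup>+x. ennreal ((hnorm (F x) (diff (\<xi> k) \<eta> x))\<^sup>2) \<partial>\<mu>) =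
        (\<integral>\<^sup>+x. liminf (\<lambda>m. ennreal ((hnorm (F x) (diff (\<xi> k) (\<xi> m) x))\<^sup>2)) \<partial>\<mu>)"
    proof (rule nn_integral_cong_AE, use AE_G in eventually_elim)
      fix x assume xG: "x \<in> G"
      hence x: "x \<in> space X" by (simp add: G_def)
      interpret hilbert_space "F x" by (rule fiber_hilbert_space[OF x])
      note C1 = L2_in_fiber[OF \<xi> x]
      have bd: "norm (hnorm (F x) (sub (\<xi> k x) (\<xi> m x)) - hnorm (F x) (sub (\<xi> k x) (\<eta> x)))
          \<le> hnorm (F x) (sub (\<xi> m x) (\<eta> x))" for m
      proof -
        have "hnorm (F x) (sub (\<xi> k x) (\<xi> m x)) \<le> hnorm (F x) (sub (\<xi> k x) (\<eta> x)) + hnorm (F x) (sub (\<eta> x) (\<xi> m x))"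
          by (intro sub_triangle C1 \<eta>F x)
        moreover have "hnorm (F x) (sub (\<xi> k x) (\<eta> x)) \<le> hnorm (F x) (sub (\<xi> k x) (\<xi> m x)) + hnorm (F x) (sub (\<xi> m x) (\<eta> x))"
          by (intro sub_triangle C1 \<eta>F x)
        moreover have "hnorm (F x) (sub (\<eta> x) (\<xi> m x)) = hnorm (F x) (sub (\<xi> m x) (\<eta> x))"
          by (intro sub_commute C1 \<eta>F x)
        ultimately show ?thesis by simp
      qed
      have "(\<lambda>m. hnorm (F x) (sub (\<xi> k x) (\<xi> m x))) \<longlonglongrightarrow> hnorm (F x) (sub (\<xi> k x) (\<eta> x))"
        by (rule LIM_zero_cancel, rule Lim_null_comparison[OF always_eventually[OF allI[OF bd]] \<eta>G(2)[OF xG]])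
      hence "(\<lambda>m. ennreal ((hnorm (F x) (sub (\<xi> k x) (\<xi> m x)))\<^sup>2)) \<longlonglongrightarrow> ennreal ((hnorm (F x) (sub (\<xi> k x) (\<eta> x)))\<^sup>2)"
        by (intro tendsto_ennrealI tendsto_power)
      from lim_imp_Liminf[OF _ this]
      show "ennreal ((hnorm (F x) (diff (\<xi> k) \<eta> x))\<^sup>2) = liminf (\<lambda>m. ennreal ((hnorm (F x) (diff (\<xi> k) (\<xi> m) x))\<^sup>2))"
        by (simp add: diff_sub[OF x])
    qed
    also have "\<dots> \<le> liminf (\<lambda>m. \<integral>\<^sup>+x. ennreal ((hnorm (F x) (diff (\<xi> k) (\<xi> m) x))\<^sup>2) \<partial>\<mu>)"
    proof (rule nn_integral_liminf)
      fix m
      have "(\<lambda>x. hnorm (F x) (diff (\<xi> k) (\<xi> m) x)) \<in> borel_measurable \<mu>"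
        by (intro norm_measurable diff_section L2_section \<xi>)
      thus "(\<lambda>x. ennreal ((hnorm (F x) (diff (\<xi> k) (\<xi> m) x))\<^sup>2)) \<in> borel_measurable \<mu>" by measurable
    qed
    also have "\<dots> \<le> ennreal (((1/4)^k)\<^sup>2)"
    proof (rule Liminf_le)
      have "(\<integral>\<^sup>+x. ennreal ((hnorm (F x) (diff (\<xi> k) (\<xi> m) x))\<^sup>2) \<partial>\<mu>) \<le> ennreal (((1/4)^k)\<^sup>2)" if "m \<ge> k" for m
        unfolding nn_dist_sq[OF \<xi> \<xi>]
        by (intro ennreal_leI power_mono fast[OF that] hdist_D_nonneg)
      thus "\<forall>\<^sub>F m in sequentially. (\<integral>\<^sup>+x. ennreal ((hnorm (F x) (diff (\<xi> k) (\<xi> m) x))\<^sup>2) \<partial>\<mu>) \<le> ennreal (((1/4)^k)\<^sup>2)"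
        unfolding eventually_sequentially by blast
    qed simp
    finally show ?thesis .
  qed
  have "diff (\<xi> 0) \<eta> \<in> L2"
    unfolding L2_iff
  proof (rule conjI)
    show sec: "diff (\<xi> 0) \<eta> \<in> sections" by (rule diff_section[OF L2_section[OF \<xi>] \<eta>_sec])
    have m: "(\<lambda>x. (hnorm (F x) (diff (\<xi> 0) \<eta> x))\<^sup>2) \<in> borel_measurable \<mu>"
      by (intro borel_measurable_power norm_measurable sec)
    show "integrable \<mu> (\<lambda>x. (hnorm (F x) (diff (\<xi> 0) \<eta> x))\<^sup>2)"
    proof (rule integrableI_bounded[OF m])
      have "(\<integral>\<^sup>+x. ennreal ((hnorm (F x) (diff (\<xi> 0) \<eta> x))\<^sup>2) \<partial>\<mu>) < \<infinity>"
        using fatou[of 0] by (rule le_less_trans) simp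
      thus "(\<integral>\<^sup>+x. ennreal (norm ((hnorm (F x) (diff (\<xi> 0) \<eta> x))\<^sup>2)) \<partial>\<mu>) < \<infinity>" by simp
    qed
  qed
  hence "diff (\<xi> 0) (diff (\<xi> 0) \<eta>) \<in> L2" by (rule diff_L2[OF \<xi>])
  moreover have "diff (\<xi> 0) (diff (\<xi> 0) \<eta>) x = \<eta> x" if x: "x \<in> space X" for x
  proof -
    interpret hilbert_space "F x" by (rule fiber_hilbert_space[OF x])
    note * = L2_in_fiber[OF \<xi> x, of 0] \<eta>F[OF x]
    show ?thesis
      unfolding diff_sub[OF x]
      by (rule eq_by_ip) (use * in \<open>auto simp: sub_closed ip_sub_left simp del: fiber_simps\<close>)
  qed
  ultimately have \<eta>_L2: "\<eta> \<in> L2" by (rule L2_cong)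
  have "hdist D (cls (\<xi> k)) (cls \<eta>) \<le> (1/4)^k" for k
  proof (rule power2_le_imp_le)
    show "(hdist D (cls (\<xi> k)) (cls \<eta>))\<^sup>2 \<le> ((1/4)^k)\<^sup>2"
      using fatou[of k] unfolding nn_dist_sq[OF \<xi> \<eta>_L2] by (simp add: ennreal_le_iff)
  qed simp
  with \<eta>_L2 show ?thesis using that by blast
qed

theorem hilbert_D: "hilbert_space D"
proof -
  interpret PD: pre_hilbert_space D by (rule pre_hilbert_D)
  have "PD.M.mcomplete"
    unfolding PD.M.mcomplete_def
  proof (intro allI impI)
    fix \<sigma> :: "nat \<Rightarrow> ('x \<Rightarrow> 'h) set" assume C: "PD.M.MCauchy \<sigma>"
    hence \<sigma>: "\<sigma> n \<in> hcarrier D" for n by (auto simp: PD.M.MCauchy_def)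
    have "\<exists>N. \<forall>m\<ge>N. \<forall>n\<ge>N. hdist D (\<sigma> m) (\<sigma> n) < (1/4)^k" for k :: nat
      using C unfolding PD.M.MCauchy_def by (meson zero_less_power zero_less_divide_1_iff zero_less_numeral)
    then obtain N where N: "\<And>k m n. m \<ge> N k \<Longrightarrow> n \<ge> N k \<Longrightarrow> hdist D (\<sigma> m) (\<sigma> n) < (1/4)^k" by metis
    \<comment> \<open>a strictly increasing choice of indices beyond all \<open>N j\<close> with \<open>j \<le> k\<close>\<close>
    define r where "r k = k + (\<Sum>j\<le>k. N j)" for k
    have r: "strict_mono r" by (rule strict_monoI_Suc) (simp add: r_def)
    have rN: "N k \<le> r m" if "k \<le> m" for k m
    proof -
      have "N k \<le> (\<Sum>j\<le>m. N j)" using that by (intro member_le_sum) auto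
      thus ?thesis by (simp add: r_def)
    qed
    define \<xi> where "\<xi> k = ae_rep (\<sigma> (r k))" for k
    have \<xi>: "\<xi> k \<in> L2" "cls (\<xi> k) = \<sigma> (r k)" for k
      using D_rep[OF \<sigma>] by (auto simp: \<xi>_def)
    have "hdist D (cls (\<xi> k)) (cls (\<xi> m)) \<le> (1/4)^k" if "k \<le> m" for k m
      unfolding \<xi>(2) using N[OF rN[OF order_refl] rN[OF that]] by simp
    then obtain \<eta> where \<eta>: "\<eta> \<in> L2" "\<And>k. hdist D (cls (\<xi> k)) (cls \<eta>) \<le> (1/4)^k"
      using pointwise_limit[of \<xi>, OF \<xi>(1)] by blast
    have "limitin PD.M.mtopology (\<sigma> \<circ> r) (cls \<eta>) sequentially"
      unfolding PD.M.limitin_metric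
    proof (intro conjI allI impI cls_in_D \<eta>(1))
      fix e :: real assume "e > 0"
      have "(\<lambda>k. (1/4)^k :: real) \<longlonglongrightarrow> 0" by (rule LIMSEQ_power_zero) simp
      hence "\<forall>\<^sub>F k in sequentially. (1/4)^k < e" using \<open>e > 0\<close> by (rule order_tendstoD)
      thus "\<forall>\<^sub>F k in sequentially. (\<sigma> \<circ> r) k \<in> hcarrier D \<and> hdist D ((\<sigma> \<circ> r) k) (cls \<eta>) < e"
      proof eventually_elim
        case (elim k)
        thus ?case using \<eta>(2)[of k] \<sigma> by (simp add: \<xi>(2))
      qed
    qed
    thus "\<exists>x. limitin PD.M.mtopology \<sigma> x sequentially"
      using PD.M.MCauchy_convergent_subsequence[OF C r] by blast
  qed
  thus ?thesis by (rule PD.hilbert_space_if_complete)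
qed

end

section \<open>Dense families of sections\<close>

context pre_hilbert_space
begin

lemma bounded_operatorsI:
  assumes "T \<in> C \<rightarrow>\<^sub>E C" "\<And>v w. v \<in> C \<Longrightarrow> w \<in> C \<Longrightarrow> T (hadd H v w) = hadd H (T v) (T w)"
    "\<And>c v. v \<in> C \<Longrightarrow> T (hscale H c v) = hscale H c (T v)" "\<And>v. v \<in> C \<Longrightarrow> hnorm H (T v) \<le> K * hnorm H v"
  shows "T \<in> bounded_operators H"
  unfolding bounded_operators_def by (intro CollectI conjI allI ballI exI[of _ K] assms)

lemma bounded_operatorsD:
  assumes "T \<in> bounded_operators H"
  shows "v \<in> C \<Longrightarrow> T v \<in> C" "v \<in> C \<Longrightarrow> w \<in> C \<Longrightarrow> T (hadd H v w) = hadd H (T v) (T w)"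
    "v \<in> C \<Longrightarrow> T (hscale H c v) = hscale H c (T v)" "\<exists>K\<ge>0. \<forall>v\<in>C. hnorm H (T v) \<le> K * hnorm H v"
proof -
  show "v \<in> C \<Longrightarrow> T v \<in> C" "v \<in> C \<Longrightarrow> w \<in> C \<Longrightarrow> T (hadd H v w) = hadd H (T v) (T w)"
    "v \<in> C \<Longrightarrow> T (hscale H c v) = hscale H c (T v)"
    using assms by (auto simp: bounded_operators_def)
  have "\<exists>K. \<forall>v\<in>C. hnorm H (T v) \<le> K * hnorm H v" using assms by (simp add: bounded_operators_def)
  then obtain K where K: "\<And>v. v \<in> C \<Longrightarrow> hnorm H (T v) \<le> K * hnorm H v" by blast
  have "hnorm H (T v) \<le> max K 0 * hnorm H v" if "v \<in> C" for v
    using K[OF that] mult_right_mono[of K "max K 0" "hnorm H v"] hnorm_nonneg[OF that] by simp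
  thus "\<exists>K\<ge>0. \<forall>v\<in>C. hnorm H (T v) \<le> K * hnorm H v" by (intro exI[of _ "max K 0"]) simp
qed

lemma bounded_operators_add:
  assumes T: "T \<in> bounded_operators H" and U: "U \<in> bounded_operators H"
  shows "(\<lambda>v\<in>C. hadd H (T v) (U v)) \<in> bounded_operators H"
proof -
  note t = bounded_operatorsD[OF T] and u = bounded_operatorsD[OF U]
  obtain K where K: "\<And>v. v \<in> C \<Longrightarrow> hnorm H (T v) \<le> K * hnorm H v" using t(4) by blast
  obtain L where L: "\<And>v. v \<in> C \<Longrightarrow> hnorm H (U v) \<le> L * hnorm H v" using u(4) by blast
  show ?thesis
  proof (rule bounded_operatorsI[where K = "K + L"])
    show "(\<lambda>v\<in>C. hadd H (T v) (U v)) \<in> C \<rightarrow>\<^sub>E C" using t(1) u(1) add_closed by auto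
    show "(\<lambda>v\<in>C. hadd H (T v) (U v)) (hadd H v w) = hadd H ((\<lambda>v\<in>C. hadd H (T v) (U v)) v) ((\<lambda>v\<in>C. hadd H (T v) (U v)) w)"
      if "v \<in> C" "w \<in> C" for v w
    proof (rule eq_by_ip)
      fix z assume "z \<in> C"
      thus "hip H ((\<lambda>v\<in>C. hadd H (T v) (U v)) (hadd H v w)) z = hip H (hadd H ((\<lambda>v\<in>C. hadd H (T v) (U v)) v) ((\<lambda>v\<in>C. hadd H (T v) (U v)) w)) z"
        using that t(1-2) u(1-2) by (simp add: ips)
    qed (use that t(1) u(1) in \<open>auto simp: closed\<close>)
    show "(\<lambda>v\<in>C. hadd H (T v) (U v)) (hscale H c v) = hscale H c ((\<lambda>v\<in>C. hadd H (T v) (U v)) v)" if "v \<in> C" for c v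
      using that t(1,3) u(1,3) by (simp add: closed scale_add_right)
    show "hnorm H ((\<lambda>v\<in>C. hadd H (T v) (U v)) v) \<le> (K + L) * hnorm H v" if "v \<in> C" for v
      using hnorm_triangle[OF t(1)[OF that] u(1)[OF that]] K[OF that] L[OF that] that by (simp add: distrib_right)
  qed
qed

lemma bounded_operators_mult:
  assumes T: "T \<in> bounded_operators H" and U: "U \<in> bounded_operators H"
  shows "(\<lambda>v\<in>C. T (U v)) \<in> bounded_operators H"
proof -
  note t = bounded_operatorsD[OF T] and u = bounded_operatorsD[OF U]
  obtain K where K: "K \<ge> 0" "\<And>v. v \<in> C \<Longrightarrow> hnorm H (T v) \<le> K * hnorm H v" using t(4) by blast
  obtain L where L: "\<And>v. v \<in> C \<Longrightarrow> hnorm H (U v) \<le> L * hnorm H v" using u(4) by blast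
  show ?thesis
  proof (rule bounded_operatorsI[where K = "K * L"])
    show "hnorm H ((\<lambda>v\<in>C. T (U v)) v) \<le> (K * L) * hnorm H v" if "v \<in> C" for v
      using K(2)[OF u(1)[OF that]] mult_left_mono[OF L[OF that] K(1)] that by simp
  qed (use t(1-3) u(1-3) in \<open>auto simp: closed\<close>)
qed

lemma bounded_operators_scale:
  assumes T: "T \<in> bounded_operators H"
  shows "(\<lambda>v\<in>C. hscale H c (T v)) \<in> bounded_operators H"
proof -
  note t = bounded_operatorsD[OF T]
  obtain K where K: "\<And>v. v \<in> C \<Longrightarrow> hnorm H (T v) \<le> K * hnorm H v" using t(4) by blast
  show ?thesis
  proof (rule bounded_operatorsI[where K = "cmod c * K"])
    show "(\<lambda>v\<in>C. hscale H c (T v)) (hscale H d v) = hscale H d ((\<lambda>v\<in>C. hscale H c (T v)) v)" if "v \<in> C" for d v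
      using that t(1,3) by (simp add: closed scale_scale mult.commute)
    show "hnorm H ((\<lambda>v\<in>C. hscale H c (T v)) v) \<le> (cmod c * K) * hnorm H v" if "v \<in> C" for v
      using mult_left_mono[OF K[OF that] norm_ge_zero[of c]] t(1)[OF that] that by (simp add: hnorm_scale mult.assoc)
  qed (use t(1-2) in \<open>auto simp: closed scale_add_right\<close>)
qed

end

context hilbert_bundle_measure
begin

subsection \<open>A countable pointwise dense family of square-integrable sections\<close>

definition section_op :: "bool + rat \<times> rat \<Rightarrow> ('x \<Rightarrow> 'h) \<Rightarrow> ('x \<Rightarrow> 'h) \<Rightarrow> 'x \<Rightarrow> 'h" where
  "section_op i \<xi> \<eta> = (case i of Inl _ \<Rightarrow> (\<lambda>x. badd B (\<xi> x) (\<eta> x)) | Inr q \<Rightarrow> (\<lambda>x. bscale B (of_rat_pair q) (\<xi> x)))"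

text \<open>Rational combinations of the total sections, normalized to be bounded. Density in every fiber is stronger than
totality and is needed because norm inequalities, unlike linear identities, do not pass to linear combinations.\<close>

lemma dense_L2_sections:
  obtains e :: "nat \<Rightarrow> 'x \<Rightarrow> 'h" where "\<And>n. e n \<in> L2"
    "\<And>x v \<epsilon>. x \<in> space X \<Longrightarrow> v \<in> hcarrier (F x) \<Longrightarrow> \<epsilon> > 0 \<Longrightarrow> \<exists>n. hnorm (F x) (pre_hilbert_space.sub (F x) v (e n x)) < \<epsilon>"
proof -
  define w where "w n x = complex_of_real (1 / (1 + hnorm (F x) (basic_section n x)))" for n x
  define f where "f n x = bscale B (w n x) (basic_section n x)" for n x
  have w_meas: "w n \<in> borel_measurable X" for n
    unfolding w_def using section_norm[OF basic_section(1), of n] by measurable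
  have f_L2: "f n \<in> L2" for n
  proof (rule L2_dominated)
    show "f n \<in> sections" unfolding f_def by (rule section_scale[OF basic_section(1) w_meas])
    show "integrable \<mu> (\<lambda>x. 1 :: real)" by simp
    fix x assume x: "x \<in> space X"
    interpret hilbert_space "F x" by (rule fiber_hilbert_space[OF x])
    note fx = section_in_fiber[OF basic_section(1) x, of n]
    have "hnorm (F x) (f n x) = hnorm (F x) (basic_section n x) / (1 + hnorm (F x) (basic_section n x))"
    proof -
      have "cmod (w n x) = 1 / (1 + hnorm (F x) (basic_section n x))"
        unfolding w_def norm_of_real using hnorm_nonneg[OF fx] by simp
      thus ?thesis using hnorm_scale[OF fx, of "w n x"] by (simp add: f_def)
    qed
    hence "hnorm (F x) (f n x) \<le> 1" "0 \<le> hnorm (F x) (f n x)" using hnorm_nonneg[OF fx] by simp_all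
    thus "(hnorm (F x) (f n x))\<^sup>2 \<le> 1" by (simp add: power_le_one)
  qed
  define E where "E = operation_closure (range f) section_op"
  have E_L2: "\<xi> \<in> L2" if "\<xi> \<in> E" for \<xi>
    using that unfolding E_def
  proof induction
    case (step \<xi> \<eta> i)
    thus ?case by (cases i) (auto simp: section_op_def L2_add L2_scale_const)
  qed (use f_L2 in auto)
  have E_add: "(\<lambda>x. badd B (\<xi> x) (\<eta> x)) \<in> E" if "\<xi> \<in> E" "\<eta> \<in> E" for \<xi> \<eta>
    using operation_closure.step[of \<xi> "range f" section_op \<eta> "Inl True"] that by (simp add: E_def section_op_def)
  have E_scale: "(\<lambda>x. bscale B (of_rat_pair q) (\<xi> x)) \<in> E" if "\<xi> \<in> E" for \<xi> q
    using operation_closure.step[of \<xi> "range f" section_op \<xi> "Inr q"] that by (simp add: E_def section_op_def)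
  have E_f: "f n \<in> E" for n unfolding E_def by (rule operation_closure.base) simp
  have cE: "countable E" unfolding E_def by (rule countable_operation_closure) simp
  define e where "e = from_nat_into E"
  have rE: "range e = E" unfolding e_def by (rule range_from_nat_into[OF _ cE]) (use E_f in auto)
  show ?thesis
  proof (rule that[of e])
    show "e n \<in> L2" for n using E_L2 rE by blast
    fix x v and \<epsilon> :: real assume x: "x \<in> space X" and v: "v \<in> hcarrier (F x)" and \<epsilon>: "\<epsilon> > 0"
    interpret hilbert_space "F x" by (rule fiber_hilbert_space[OF x])
    have Ex: "\<xi> x \<in> C" if "\<xi> \<in> E" for \<xi> by (rule L2_in_fiber[OF E_L2[OF that] x])
    define K where "K = {u\<in>C. \<forall>\<delta>>0. \<exists>\<xi>\<in>E. hnorm (F x) (sub u (\<xi> x)) < \<delta>}"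
    have K_add: "badd B u u' \<in> K" if u: "u \<in> K" "u' \<in> K" for u u'
    proof -
      have C: "u \<in> C" "u' \<in> C" using u by (auto simp: K_def)
      have "\<exists>\<xi>\<in>E. hnorm (F x) (sub (badd B u u') (\<xi> x)) < \<delta>" if \<delta>: "\<delta> > 0" for \<delta>
      proof -
        have "\<delta>/2 > 0" using \<delta> by simp
        then obtain \<xi> \<eta> where \<xi>: "\<xi> \<in> E" "hnorm (F x) (sub u (\<xi> x)) < \<delta>/2" and \<eta>: "\<eta> \<in> E" "hnorm (F x) (sub u' (\<eta> x)) < \<delta>/2"
          using u unfolding K_def by blast
        have "sub (hadd (F x) u u') (hadd (F x) (\<xi> x) (\<eta> x)) = hadd (F x) (sub u (\<xi> x)) (sub u' (\<eta> x))"
          by (rule eq_by_ip) (use C Ex[OF \<xi>(1)] Ex[OF \<eta>(1)] in \<open>auto simp: ips simp del: fiber_simps\<close>)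
        hence "hnorm (F x) (sub (badd B u u') (badd B (\<xi> x) (\<eta> x))) \<le> hnorm (F x) (sub u (\<xi> x)) + hnorm (F x) (sub u' (\<eta> x))"
          using hnorm_triangle[OF sub_closed[OF C(1) Ex[OF \<xi>(1)]] sub_closed[OF C(2) Ex[OF \<eta>(1)]]] by simp
        also have "\<dots> < \<delta>" using \<xi>(2) \<eta>(2) by simp
        finally show ?thesis using E_add[OF \<xi>(1) \<eta>(1)] by (intro bexI[of _ "\<lambda>x. badd B (\<xi> x) (\<eta> x)"])
      qed
      thus ?thesis using add_closed[OF C] by (simp add: K_def)
    qed
    have K_scale: "bscale B c u \<in> K" if u: "u \<in> K" for c u
    proof -
      have C: "u \<in> C" using u by (auto simp: K_def)
      have "\<exists>\<xi>\<in>E. hnorm (F x) (sub (bscale B c u) (\<xi> x)) < \<delta>" if \<delta>: "\<delta> > 0" for \<delta>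
      proof -
        have "c \<in> closure (range of_rat_pair)" using closure_of_rat_pair by simp
        moreover define \<delta>1 where "\<delta>1 = \<delta> / (2 * (hnorm (F x) u + 1))"
        have d1: "\<delta>1 > 0" using \<delta> hnorm_nonneg[OF C] by (simp add: \<delta>1_def)
        ultimately obtain q where q: "cmod (of_rat_pair q - c) < \<delta>1"
          unfolding closure_approachable dist_norm by blast
        define \<delta>2 where "\<delta>2 = \<delta> / (2 * (cmod (of_rat_pair q) + 1))"
        have d2: "\<delta>2 > 0" using \<delta> by (simp add: \<delta>2_def add_nonneg_pos)
        obtain \<xi> where \<xi>: "\<xi> \<in> E" "hnorm (F x) (sub u (\<xi> x)) < \<delta>2" using u d2 unfolding K_def by blast
        have "sub (hscale (F x) c u) (hscale (F x) (of_rat_pair q) (\<xi> x))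
            = hadd (F x) (hscale (F x) (c - of_rat_pair q) u) (hscale (F x) (of_rat_pair q) (sub u (\<xi> x)))"
          by (rule eq_by_ip) (use C Ex[OF \<xi>(1)] in \<open>auto simp: ips algebra_simps simp del: fiber_simps\<close>)
        hence "hnorm (F x) (sub (bscale B c u) (bscale B (of_rat_pair q) (\<xi> x)))
            \<le> hnorm (F x) (hscale (F x) (c - of_rat_pair q) u) + hnorm (F x) (hscale (F x) (of_rat_pair q) (sub u (\<xi> x)))"
          using hnorm_triangle[OF scale_closed[OF C] scale_closed[OF sub_closed[OF C Ex[OF \<xi>(1)]]]] by simp
        also have "\<dots> = cmod (c - of_rat_pair q) * hnorm (F x) u + cmod (of_rat_pair q) * hnorm (F x) (sub u (\<xi> x))"
          by (simp only: hnorm_scale[OF C] hnorm_scale[OF sub_closed[OF C Ex[OF \<xi>(1)]]])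
        also have "\<dots> \<le> \<delta>1 * hnorm (F x) u + cmod (of_rat_pair q) * \<delta>2"
          using q \<xi>(2) hnorm_nonneg[OF C] by (intro add_mono mult_right_mono mult_left_mono) (auto simp: norm_minus_commute)
        also have "\<delta>1 * hnorm (F x) u < \<delta> / 2"
          using \<delta> hnorm_nonneg[OF C] by (simp add: \<delta>1_def field_simps add_nonneg_pos)
        also have "cmod (of_rat_pair q) * \<delta>2 \<le> \<delta> / 2"
        proof -
          define t where "t = cmod (of_rat_pair q)"
          have "t \<ge> 0" by (simp add: t_def)
          have "t * \<delta>2 \<le> (t + 1) * \<delta>2" using d2 by (simp add: distrib_right)
          also have "\<dots> = \<delta> / 2" using \<open>t \<ge> 0\<close> by (simp add: \<delta>2_def t_def[symmetric] field_simps)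
          finally show ?thesis by (simp add: t_def)
        qed
        finally show ?thesis using E_scale[OF \<xi>(1), of q]
          by (intro bexI[of _ "\<lambda>x. bscale B (of_rat_pair q) (\<xi> x)"]) simp
      qed
      thus ?thesis using scale_closed[OF C] by (simp add: K_def)
    qed
    have E_K: "\<xi> x \<in> K" if "\<xi> \<in> E" for \<xi>
      using Ex[OF that] that sub_self[OF Ex[OF that]] hnorm_zero by (auto simp: K_def intro!: bexI[of _ \<xi>])
    have "hclosed_span (F x) (range (\<lambda>n. basic_section n x)) \<subseteq> K"
    proof (rule hclosed_span_minimal)
      have "bzero B x \<in> K" using K_scale[OF E_K[OF E_f], of 0 0] scale_zero[OF Ex[OF E_f]] by simp
      thus "hsubspace (F x) K" using K_add K_scale by (auto simp: hsubspace_def K_def)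
      have "basic_section n x \<in> K" for n
      proof -
        note fx = section_in_fiber[OF basic_section(1) x, of n]
        have "1 + hnorm (F x) (basic_section n x) > 0" using hnorm_nonneg[OF fx] by simp
        hence "complex_of_real (1 + hnorm (F x) (basic_section n x)) * w n x = 1"
          unfolding w_def of_real_mult[symmetric] by simp
        hence "bscale B (of_real (1 + hnorm (F x) (basic_section n x))) (f n x) = basic_section n x"
          using scale_scale[OF fx, of "of_real (1 + hnorm (F x) (basic_section n x))" "w n x"] scale_one[OF fx] by (simp add: f_def)
        thus ?thesis using K_scale[OF E_K[OF E_f[of n]], of "of_real (1 + hnorm (F x) (basic_section n x))"] by simp
      qed
      thus "range (\<lambda>n. basic_section n x) \<subseteq> K" by blast
      fix u assume u: "u \<in> C" and lim: "\<And>e. e > 0 \<Longrightarrow> \<exists>k\<in>K. hnorm (F x) (sub u k) < e"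
      have "\<exists>\<xi>\<in>E. hnorm (F x) (sub u (\<xi> x)) < \<delta>" if \<delta>: "\<delta> > 0" for \<delta>
      proof -
        have d2: "\<delta>/2 > 0" using \<delta> by simp
        obtain k where k: "k \<in> K" "hnorm (F x) (sub u k) < \<delta>/2" using lim[OF d2] by blast
        obtain \<xi> where \<xi>: "\<xi> \<in> E" "hnorm (F x) (sub k (\<xi> x)) < \<delta>/2" using k(1) d2 unfolding K_def by blast
        have "k \<in> C" using k(1) by (simp add: K_def)
        from sub_triangle[OF u this Ex[OF \<xi>(1)]] k(2) \<xi>(2) show ?thesis by (intro bexI[OF _ \<xi>(1)]) simp
      qed
      thus "u \<in> K" using u by (simp add: K_def)
    qed
    hence "v \<in> K" using basic_section(2)[OF x] v by blast
    then obtain \<xi> where "\<xi> \<in> E" "hnorm (F x) (sub v (\<xi> x)) < \<epsilon>" using \<epsilon> unfolding K_def by blast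
    thus "\<exists>n. hnorm (F x) (sub v (e n x)) < \<epsilon>" using rE by (metis imageE)
  qed
qed

end

section \<open>Decomposing the extension over the base\<close>

text \<open>The situation of the theorem: \<open>\<pi>\<close> is the extension that the unique extension property provides.\<close>

locale direct_integral_extension = hilbert_bundle_measure X B \<mu>
  for X :: "'x measure" and B :: "('x, 'h) hilbert_bundle" and \<mu> :: "'x measure" +
  fixes S :: "'a::unital_cstar_algebra set" and \<phi> :: "'x \<Rightarrow> 'a \<Rightarrow> 'h \<Rightarrow> 'h"
    and \<pi> :: "'a \<Rightarrow> ('x \<Rightarrow> 'h) set \<Rightarrow> ('x \<Rightarrow> 'h) set"
  assumes system: "separable_operator_system S"
    and family: "ucp_family X B S \<phi>"
    and rep: "representation D \<pi>"
    and extends: "\<And>s. s \<in> S \<Longrightarrow> \<pi> s = direct_integral_map \<mu> B \<phi> s"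
    and unique: "\<And>\<psi>. cp_extension S D (direct_integral_map \<mu> B \<phi>) \<psi> \<Longrightarrow> \<psi> = \<pi>"
begin

lemma S_selfadjoint: "selfadjoint_subspace S"
  using system by (simp add: separable_operator_system_def operator_system_def selfadjoint_subspace_def)

lemma S_generates: "cstar_subalgebra K \<Longrightarrow> S \<subseteq> K \<Longrightarrow> K = UNIV"
  using system unfolding separable_operator_system_def operator_system_def cstar_generated_def by blast

lemma fiber_ucp:
  assumes "x \<in> space X"
  shows "cp_map S (F x) (\<phi> x)" "\<phi> x 1 = (\<lambda>v\<in>hcarrier (F x). v)" "operator_linear_on S (F x) (\<phi> x)"
  using family assms by (auto simp: ucp_family_def ucp_map_def cp_map_def)

lemma \<pi>_cp: "cp_map UNIV D \<pi>"
  by (rule hilbert_space.representation_cp[OF hilbert_D rep])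

lemma \<pi>_one: "\<pi> 1 = (\<lambda>v\<in>hcarrier D. v)"
  using rep by (simp add: representation_def)

lemma \<pi>_linear: "operator_linear_on UNIV D \<pi>"
  using rep by (simp add: representation_def)

text \<open>The classical notion of a decomposable operator \<open>\<pi> a\<close> with components \<open>T x\<close>.\<close>

definition decomposes :: "'a \<Rightarrow> ('x \<Rightarrow> 'h \<Rightarrow> 'h) \<Rightarrow> bool" where
  "decomposes a T \<longleftrightarrow> (\<forall>x\<in>space X. T x \<in> bounded_operators (F x)) \<and>
     (\<forall>\<xi>\<in>L2. (\<lambda>x. T x (\<xi> x)) \<in> L2 \<and> \<pi> a (cls \<xi>) = cls (\<lambda>x. T x (\<xi> x)))"

lemma decomposesD:
  assumes "decomposes a T"
  shows "x \<in> space X \<Longrightarrow> T x \<in> bounded_operators (F x)" "\<xi> \<in> L2 \<Longrightarrow> (\<lambda>x. T x (\<xi> x)) \<in> L2"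
    "\<xi> \<in> L2 \<Longrightarrow> \<pi> a (cls \<xi>) = cls (\<lambda>x. T x (\<xi> x))"
  using assms by (auto simp: decomposes_def)

lemma decomposesI_restrict:
  assumes "\<And>x. x \<in> space X \<Longrightarrow> (\<lambda>v\<in>hcarrier (F x). g x v) \<in> bounded_operators (F x)"
    "\<And>\<xi>. \<xi> \<in> L2 \<Longrightarrow> (\<lambda>x. g x (\<xi> x)) \<in> L2" "\<And>\<xi>. \<xi> \<in> L2 \<Longrightarrow> \<pi> a (cls \<xi>) = cls (\<lambda>x. g x (\<xi> x))"
  shows "decomposes a (\<lambda>x. \<lambda>v\<in>hcarrier (F x). g x v)"
  unfolding decomposes_def
proof (intro conjI ballI assms(1))
  fix \<xi> assume \<xi>: "\<xi> \<in> L2"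
  have eq: "g x (\<xi> x) = (\<lambda>v\<in>hcarrier (F x). g x v) (\<xi> x)" if "x \<in> space X" for x
    using L2_in_fiber[OF \<xi> that] by simp
  show L: "(\<lambda>x. (\<lambda>v\<in>hcarrier (F x). g x v) (\<xi> x)) \<in> L2" by (rule L2_cong[OF assms(2)[OF \<xi>] eq])
  show "\<pi> a (cls \<xi>) = cls (\<lambda>x. (\<lambda>v\<in>hcarrier (F x). g x v) (\<xi> x))"
    unfolding assms(3)[OF \<xi>] by (rule cls_cong[OF assms(2)[OF \<xi>] L eq])
qed

text \<open>Borel coordinates of \<open>\<phi> x s (\<xi> x)\<close> are given by the definition of a family; that it is a Borel section
is again \<open>section_by_coordinates\<close>.\<close>

lemma decomposes_generator:
  assumes s: "s \<in> S" shows "decomposes s (\<lambda>x. \<phi> x s)"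
  unfolding decomposes_def
proof (intro conjI ballI)
  fix x assume x: "x \<in> space X"
  show "\<phi> x s \<in> bounded_operators (F x)"
    using fiber_ucp(3)[OF x] s by (auto simp: operator_linear_on_def)
next
  fix \<xi> assume \<xi>: "\<xi> \<in> L2"
  have L: "(\<lambda>x. \<phi> x s (\<zeta> x)) \<in> L2" if \<zeta>: "\<zeta> \<in> L2" for \<zeta>
  proof (rule L2_dominated)
    show "(\<lambda>x. \<phi> x s (\<zeta> x)) \<in> sections"
    proof (rule section_by_coordinates)
      show "\<phi> x s (\<zeta> x) \<in> hcarrier (F x)" if x: "x \<in> space X" for x
        by (rule operator_linear_onD(1)[OF fiber_ucp(3)[OF x] s L2_in_fiber[OF \<zeta> x]])
      show "(\<lambda>x. bip B (\<phi> x s (\<zeta> x)) (basic_section n x)) \<in> borel_measurable X" for n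
        using family L2_section[OF \<zeta>] basic_section(1)[of n] s unfolding ucp_family_def by blast
    qed
    show "integrable \<mu> (\<lambda>x. (norm s)\<^sup>2 * (hnorm (F x) (\<zeta> x))\<^sup>2)" using \<zeta> by (simp add: L2_iff)
    fix x assume x: "x \<in> space X"
    interpret hilbert_space "F x" by (rule fiber_hilbert_space[OF x])
    have "hnorm (F x) (\<phi> x s (\<zeta> x)) \<le> norm s * hnorm (F x) (\<zeta> x)"
      by (rule ucp_contractive[OF fiber_ucp(1,2)[OF x] S_selfadjoint s L2_in_fiber[OF \<zeta> x]])
    thus "(hnorm (F x) (\<phi> x s (\<zeta> x)))\<^sup>2 \<le> (norm s)\<^sup>2 * (hnorm (F x) (\<zeta> x))\<^sup>2"
      using hnorm_nonneg[OF operator_linear_onD(1)[OF fiber_ucp(3)[OF x] s L2_in_fiber[OF \<zeta> x]]]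
      unfolding power_mult_distrib[symmetric] by (intro power_mono)
  qed
  show "(\<lambda>x. \<phi> x s (\<xi> x)) \<in> L2" by (rule L[OF \<xi>])
  have r: "ae_rep (cls \<xi>) \<in> L2" by (rule D_rep(1)[OF cls_in_D[OF \<xi>]])
  have "\<pi> s (cls \<xi>) = cls (\<lambda>x. \<phi> x s (ae_rep (cls \<xi>) x))"
    using cls_in_D[OF \<xi>] by (simp add: extends[OF s] direct_integral_map_def direct_integral_operator_def)
  also have "\<dots> = cls (\<lambda>x. \<phi> x s (\<xi> x))"
    unfolding cls_eq[OF L[OF r] L[OF \<xi>]] using rep_cls[OF \<xi>] by eventually_elim simp
  finally show "\<pi> s (cls \<xi>) = cls (\<lambda>x. \<phi> x s (\<xi> x))" .
qed

lemma decomposes_add: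
  assumes "decomposes a T" "decomposes b U"
  shows "decomposes (a + b) (\<lambda>x. \<lambda>v\<in>hcarrier (F x). badd B (T x v) (U x v))"
proof (rule decomposesI_restrict)
  note t = decomposesD[OF assms(1)] and u = decomposesD[OF assms(2)]
  show "(\<lambda>v\<in>hcarrier (F x). badd B (T x v) (U x v)) \<in> bounded_operators (F x)" if x: "x \<in> space X" for x
  proof -
    interpret hilbert_space "F x" by (rule fiber_hilbert_space[OF x])
    show ?thesis using bounded_operators_add[OF t(1)[OF x] u(1)[OF x]] by simp
  qed
  fix \<xi> assume \<xi>: "\<xi> \<in> L2"
  show "(\<lambda>x. badd B (T x (\<xi> x)) (U x (\<xi> x))) \<in> L2" by (rule L2_add[OF t(2)[OF \<xi>] u(2)[OF \<xi>]])
  show "\<pi> (a + b) (cls \<xi>) = cls (\<lambda>x. badd B (T x (\<xi> x)) (U x (\<xi> x)))"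
    unfolding operator_linear_onD(4)[OF \<pi>_linear UNIV_I cls_in_D[OF \<xi>] UNIV_I] t(3)[OF \<xi>] u(3)[OF \<xi>]
    by (rule D_add[OF t(2)[OF \<xi>] u(2)[OF \<xi>]])
qed

lemma decomposes_mult:
  assumes "decomposes a T" "decomposes b U"
  shows "decomposes (a * b) (\<lambda>x. \<lambda>v\<in>hcarrier (F x). T x (U x v))"
proof (rule decomposesI_restrict)
  note t = decomposesD[OF assms(1)] and u = decomposesD[OF assms(2)]
  show "(\<lambda>v\<in>hcarrier (F x). T x (U x v)) \<in> bounded_operators (F x)" if x: "x \<in> space X" for x
  proof -
    interpret hilbert_space "F x" by (rule fiber_hilbert_space[OF x])
    show ?thesis by (rule bounded_operators_mult[OF t(1)[OF x] u(1)[OF x]])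
  qed
  fix \<xi> assume \<xi>: "\<xi> \<in> L2"
  show "(\<lambda>x. T x (U x (\<xi> x))) \<in> L2" by (rule t(2)[OF u(2)[OF \<xi>]])
  have "\<pi> (a * b) (cls \<xi>) = \<pi> a (\<pi> b (cls \<xi>))"
    using rep cls_in_D[OF \<xi>] unfolding representation_def by blast
  thus "\<pi> (a * b) (cls \<xi>) = cls (\<lambda>x. T x (U x (\<xi> x)))"
    by (simp only: u(3)[OF \<xi>] t(3)[OF u(2)[OF \<xi>]])
qed

lemma decomposes_scale:
  assumes "decomposes a T"
  shows "decomposes (scaleC c a) (\<lambda>x. \<lambda>v\<in>hcarrier (F x). bscale B c (T x v))"
proof (rule decomposesI_restrict)
  note t = decomposesD[OF assms]
  show "(\<lambda>v\<in>hcarrier (F x). bscale B c (T x v)) \<in> bounded_operators (F x)" if x: "x \<in> space X" for x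
  proof -
    interpret hilbert_space "F x" by (rule fiber_hilbert_space[OF x])
    show ?thesis using bounded_operators_scale[OF t(1)[OF x], of c] by simp
  qed
  fix \<xi> assume \<xi>: "\<xi> \<in> L2"
  show "(\<lambda>x. bscale B c (T x (\<xi> x))) \<in> L2" by (rule L2_scale_const[OF t(2)[OF \<xi>]])
  show "\<pi> (scaleC c a) (cls \<xi>) = cls (\<lambda>x. bscale B c (T x (\<xi> x)))"
    unfolding operator_linear_onD(5)[OF \<pi>_linear UNIV_I cls_in_D[OF \<xi>]] t(3)[OF \<xi>]
    by (rule D_scale[OF t(2)[OF \<xi>]])
qed

text \<open>The norm of a decomposable operator bounds its components: otherwise, cutting \<open>\<xi>\<close> down to the set
\<open>E\<close> where the inequality fails contradicts contractivity of \<open>\<pi>\<close>.\<close>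

lemma decomposes_bound:
  assumes dec: "decomposes a T" and \<xi>: "\<xi> \<in> L2"
  shows "AE x in \<mu>. hnorm (F x) (T x (\<xi> x)) \<le> norm a * hnorm (F x) (\<xi> x)"
proof -
  note t = decomposesD[OF dec]
  define \<eta> where "\<eta> x = T x (\<xi> x)" for x
  have \<eta>: "\<eta> \<in> L2" unfolding \<eta>_def by (rule t(2)[OF \<xi>])
  define n m where "n x = (hnorm (F x) (\<eta> x))\<^sup>2" and "m x = (norm a)\<^sup>2 * (hnorm (F x) (\<xi> x))\<^sup>2" for x
  have nm: "n \<in> borel_measurable X" "m \<in> borel_measurable X" "integrable \<mu> n" "integrable \<mu> m"
    using section_norm[OF L2_section[OF \<eta>]] section_norm[OF L2_section[OF \<xi>]] \<xi> \<eta>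
    by (auto simp: n_def[abs_def] m_def[abs_def] L2_iff)
  define E where "E = {x \<in> space X. m x < n x}"
  have E: "E \<in> sets X" unfolding E_def using nm(1,2) by measurable
  define f where "f x = (indicator E x :: complex)" for x
  have f: "f \<in> borel_measurable X" unfolding f_def using E by measurable
  define w where "w x = bscale B (f x) (\<xi> x)" for x
  have w: "w \<in> L2" unfolding w_def by (rule L2_scale[OF \<xi> f, where K = 1]) (simp add: f_def indicator_def)
  note Tw = t(2)[OF w]
  have fib_facts: "hnorm (F x) (w x) = indicator E x * hnorm (F x) (\<xi> x)"
      "hnorm (F x) (T x (w x)) = indicator E x * hnorm (F x) (\<eta> x)" if x: "x \<in> space X" for x
  proof -
    interpret hilbert_space "F x" by (rule fiber_hilbert_space[OF x])
    note tb = bounded_operatorsD[OF t(1)[OF x]]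
    note \<xi>x = L2_in_fiber[OF \<xi> x]
    have cf: "cmod (f x) = indicator E x" by (simp add: f_def indicator_def)
    show "hnorm (F x) (w x) = indicator E x * hnorm (F x) (\<xi> x)"
      using hnorm_scale[OF \<xi>x, of "f x"] by (simp add: w_def cf)
    have "T x (w x) = hscale (F x) (f x) (T x (\<xi> x))" using tb(3)[OF \<xi>x, of "f x"] by (simp add: w_def)
    thus "hnorm (F x) (T x (w x)) = indicator E x * hnorm (F x) (\<eta> x)"
      using hnorm_scale[OF tb(1)[OF \<xi>x], of "f x"] by (simp add: cf \<eta>_def)
  qed
  have iE: "integrable \<mu> (\<lambda>x. indicator E x * n x)" "integrable \<mu> (\<lambda>x. indicator E x * m x)"
    using nm(3,4) E sets_eq by (auto intro!: integrable_mult_indicator[where 'b = real, simplified real_scaleR_def])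
  have i1: "(\<integral>x. (hnorm (F x) (T x (w x)))\<^sup>2 \<partial>\<mu>) = (\<integral>x. indicator E x * n x \<partial>\<mu>)"
    by (rule Bochner_Integration.integral_cong[OF refl])
      (simp add: space_eq fib_facts n_def power_mult_distrib indicator_def)
  have i2: "(norm a)\<^sup>2 * (\<integral>x. (hnorm (F x) (w x))\<^sup>2 \<partial>\<mu>) = (\<integral>x. indicator E x * m x \<partial>\<mu>)"
  proof -
    have "(norm a)\<^sup>2 * (\<integral>x. (hnorm (F x) (w x))\<^sup>2 \<partial>\<mu>) = (\<integral>x. (norm a)\<^sup>2 * (hnorm (F x) (w x))\<^sup>2 \<partial>\<mu>)" by simp
    also have "\<dots> = (\<integral>x. indicator E x * m x \<partial>\<mu>)"
      by (rule Bochner_Integration.integral_cong[OF refl])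
        (simp add: space_eq fib_facts m_def power_mult_distrib indicator_def)
    finally show ?thesis .
  qed
  interpret HD: hilbert_space D by (rule hilbert_D)
  have "hnorm D (\<pi> a (cls w)) \<le> norm a * hnorm D (cls w)"
    by (rule HD.ucp_contractive[OF \<pi>_cp \<pi>_one selfadjoint_subspace_UNIV UNIV_I cls_in_D[OF w]])
  hence "(hnorm D (cls (\<lambda>x. T x (w x))))\<^sup>2 \<le> (norm a * hnorm D (cls w))\<^sup>2"
    unfolding t(3)[OF w] by (rule power_mono) (rule HD.hnorm_nonneg[OF cls_in_D[OF Tw]])
  hence "(\<integral>x. indicator E x * n x \<partial>\<mu>) \<le> (\<integral>x. indicator E x * m x \<partial>\<mu>)"
    unfolding power_mult_distrib norm_sq_integral(2)[OF w] norm_sq_integral(2)[OF Tw] i1 i2 .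
  hence le: "(\<integral>x. indicator E x * n x - indicator E x * m x \<partial>\<mu>) \<le> 0"
    using iE by simp
  have nonneg: "0 \<le> indicator E x * n x - indicator E x * m x" for x
    by (auto simp: E_def indicator_def)
  have "(\<integral>x. indicator E x * n x - indicator E x * m x \<partial>\<mu>) = 0"
    using le by (intro antisym integral_nonneg_AE AE_I2 nonneg)
  hence "AE x in \<mu>. indicator E x * n x - indicator E x * m x = 0"
    by (subst (asm) integral_nonneg_eq_0_iff_AE) (use iE nonneg in auto)
  moreover have "AE x in \<mu>. x \<in> space \<mu>" by (rule AE_space)
  ultimately show ?thesis
  proof eventually_elim
    case (elim x)
    hence x: "x \<in> space X" by (simp add: space_eq)
    interpret hilbert_space "F x" by (rule fiber_hilbert_space[OF x])
    have "x \<notin> E" using elim(1) by (auto simp: E_def)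
    hence "(hnorm (F x) (T x (\<xi> x)))\<^sup>2 \<le> (norm a * hnorm (F x) (\<xi> x))\<^sup>2"
      using x by (simp add: E_def n_def m_def \<eta>_def power_mult_distrib not_less)
    thus ?case
      using hnorm_nonneg[OF L2_in_fiber[OF \<xi> x]] by (intro power2_le_imp_le[OF _ mult_nonneg_nonneg]) auto
  qed
qed

subsection \<open>A countable dense *-algebra of decomposed elements\<close>

text \<open>Elements of the algebra are carried along with operator fields that decompose them. An element may occur with
several fields; that these agree almost everywhere is a consequence of \<open>decomposes_bound\<close>.\<close>

definition field_op :: "bool + rat \<times> rat \<Rightarrow> 'a \<times> ('x \<Rightarrow> 'h \<Rightarrow> 'h) \<Rightarrow> 'a \<times> ('x \<Rightarrow> 'h \<Rightarrow> 'h) \<Rightarrow> 'a \<times> ('x \<Rightarrow> 'h \<Rightarrow> 'h)" where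
  "field_op i p q = (case i of
       Inl b \<Rightarrow> if b then (fst p + fst q, \<lambda>x. \<lambda>v\<in>hcarrier (F x). badd B (snd p x v) (snd q x v))
                else (fst p * fst q, \<lambda>x. \<lambda>v\<in>hcarrier (F x). snd p x (snd q x v))
     | Inr r \<Rightarrow> (scaleC (of_rat_pair r) (fst p), \<lambda>x. \<lambda>v\<in>hcarrier (F x). bscale B (of_rat_pair r) (snd p x v)))"

definition fields_over :: "'a set \<Rightarrow> ('a \<times> ('x \<Rightarrow> 'h \<Rightarrow> 'h)) set" where
  "fields_over S0 = operation_closure ((\<lambda>s. (s, \<lambda>x. \<phi> x s)) ` S0) field_op"

lemma countable_fields: "countable S0 \<Longrightarrow> countable (fields_over S0)"
  unfolding fields_over_def by (rule countable_operation_closure) simp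

lemma fields_generator: "s \<in> S0 \<Longrightarrow> (s, \<lambda>x. \<phi> x s) \<in> fields_over S0"
  unfolding fields_over_def by (rule operation_closure.base) simp

lemma fields_closed:
  assumes "(a, T) \<in> fields_over S0" "(b, U) \<in> fields_over S0"
  shows "(a + b, \<lambda>x. \<lambda>v\<in>hcarrier (F x). badd B (T x v) (U x v)) \<in> fields_over S0"
    "(a * b, \<lambda>x. \<lambda>v\<in>hcarrier (F x). T x (U x v)) \<in> fields_over S0"
    "(scaleC (of_rat_pair r) a, \<lambda>x. \<lambda>v\<in>hcarrier (F x). bscale B (of_rat_pair r) (T x v)) \<in> fields_over S0"
proof -
  note st = operation_closure.step[OF assms(1)[unfolded fields_over_def] assms(2)[unfolded fields_over_def]]
  show "(a + b, \<lambda>x. \<lambda>v\<in>hcarrier (F x). badd B (T x v) (U x v)) \<in> fields_over S0"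
    using st[of "Inl True"] by (simp add: field_op_def fields_over_def)
  show "(a * b, \<lambda>x. \<lambda>v\<in>hcarrier (F x). T x (U x v)) \<in> fields_over S0"
    using st[of "Inl False"] by (simp add: field_op_def fields_over_def)
  show "(scaleC (of_rat_pair r) a, \<lambda>x. \<lambda>v\<in>hcarrier (F x). bscale B (of_rat_pair r) (T x v)) \<in> fields_over S0"
    using st[of "Inr r"] by (simp add: field_op_def fields_over_def)
qed

lemma fields_induct [consumes 1, case_names generator add mult scale]:
  assumes "(a, T) \<in> fields_over S0"
    and "\<And>s. s \<in> S0 \<Longrightarrow> P s (\<lambda>x. \<phi> x s)"
    and "\<And>a T b U. (a, T) \<in> fields_over S0 \<Longrightarrow> P a T \<Longrightarrow> (b, U) \<in> fields_over S0 \<Longrightarrow> P b U \<Longrightarrow>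
      P (a + b) (\<lambda>x. \<lambda>v\<in>hcarrier (F x). badd B (T x v) (U x v))"
    and "\<And>a T b U. (a, T) \<in> fields_over S0 \<Longrightarrow> P a T \<Longrightarrow> (b, U) \<in> fields_over S0 \<Longrightarrow> P b U \<Longrightarrow>
      P (a * b) (\<lambda>x. \<lambda>v\<in>hcarrier (F x). T x (U x v))"
    and "\<And>a T r. (a, T) \<in> fields_over S0 \<Longrightarrow> P a T \<Longrightarrow>
      P (scaleC (of_rat_pair r) a) (\<lambda>x. \<lambda>v\<in>hcarrier (F x). bscale B (of_rat_pair r) (T x v))"
  shows "P a T"
proof -
  have "P (fst p) (snd p)" if "p \<in> fields_over S0" for p
    using that unfolding fields_over_def
  proof induction
    case (base g)
    thus ?case using assms(2) by auto
  next
    case (step p q i)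
    have pq: "(fst p, snd p) \<in> fields_over S0" "(fst q, snd q) \<in> fields_over S0"
      using step by (simp_all add: fields_over_def)
    show ?case
    proof (cases i)
      case (Inl b)
      show ?thesis
        by (cases b) (use assms(3)[OF pq(1) step.IH(1) pq(2) step.IH(2)] assms(4)[OF pq(1) step.IH(1) pq(2) step.IH(2)] in \<open>simp_all add: Inl field_op_def del: restrict_apply\<close>)
    next
      case (Inr r)
      show ?thesis using assms(5)[OF pq(1) step.IH(1), of r] by (simp add: Inr field_op_def del: restrict_apply)
    qed
  qed
  from this[OF assms(1)] show ?thesis by simp
qed

lemma fields_decompose:
  assumes "S0 \<subseteq> S" "(a, T) \<in> fields_over S0"
  shows "decomposes a T"
  using assms(2)
proof (induction rule: fields_induct)
  case (generator s)
  thus ?case using decomposes_generator assms(1) by blast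
qed (rule decomposes_add decomposes_mult decomposes_scale; assumption)+

text \<open>Adjoints hold in every fiber, since they hold for the unital completely positive maps \<open>\<phi> x\<close> on
generators.\<close>

lemma fields_star:
  assumes S0: "S0 \<subseteq> S" "\<And>s. s \<in> S0 \<Longrightarrow> star s \<in> S0" and aT: "(a, T) \<in> fields_over S0"
  shows "\<exists>U. (star a, U) \<in> fields_over S0 \<and>
    (\<forall>x\<in>space X. \<forall>v\<in>hcarrier (F x). \<forall>w\<in>hcarrier (F x). bip B (U x v) w = bip B v (T x w))"
  using aT
proof (induction rule: fields_induct)
  case (generator s)
  have "bip B (\<phi> x (star s) v) w = bip B v (\<phi> x s w)"
    if x: "x \<in> space X" and vw: "v \<in> hcarrier (F x)" "w \<in> hcarrier (F x)" for x v w
  proof -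
    interpret hilbert_space "F x" by (rule fiber_hilbert_space[OF x])
    show ?thesis using ucp_hermitian[OF fiber_ucp(1,2)[OF x] S_selfadjoint _ vw, of s] generator S0(1) by auto
  qed
  thus ?case using fields_generator[OF S0(2)[OF generator]] by (intro exI[of _ "\<lambda>x. \<phi> x (star s)"]) simp
next
  case (add a T b U)
  obtain T' where T': "(star a, T') \<in> fields_over S0" "\<And>x v w. x \<in> space X \<Longrightarrow> v \<in> hcarrier (F x) \<Longrightarrow> w \<in> hcarrier (F x) \<Longrightarrow> bip B (T' x v) w = bip B v (T x w)"
    using add by metis
  obtain U' where U': "(star b, U') \<in> fields_over S0" "\<And>x v w. x \<in> space X \<Longrightarrow> v \<in> hcarrier (F x) \<Longrightarrow> w \<in> hcarrier (F x) \<Longrightarrow> bip B (U' x v) w = bip B v (U x w)"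
    using add by metis
  have "bip B (badd B (T' x v) (U' x v)) w = bip B v (badd B (T x w) (U x w))"
    if x: "x \<in> space X" and vw: "v \<in> hcarrier (F x)" "w \<in> hcarrier (F x)" for x v w
  proof -
    interpret hilbert_space "F x" by (rule fiber_hilbert_space[OF x])
    note cl = bounded_operatorsD(1)[OF decomposesD(1)[OF fields_decompose[OF S0(1)] x]]
    show ?thesis
      using ip_add_left[OF cl[OF T'(1) vw(1)] cl[OF U'(1) vw(1)] vw(2)]
        ip_add_right[OF vw(1) cl[OF add.hyps(1) vw(2)] cl[OF add.hyps(2) vw(2)]] T'(2)[OF x vw] U'(2)[OF x vw] by simp
  qed
  hence "\<forall>x\<in>space X. \<forall>v\<in>hcarrier (F x). \<forall>w\<in>hcarrier (F x).
      bip B ((\<lambda>v\<in>hcarrier (F x). badd B (T' x v) (U' x v)) v) w = bip B v ((\<lambda>v\<in>hcarrier (F x). badd B (T x v) (U x v)) w)"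
    by simp
  with fields_closed(1)[OF T'(1) U'(1)] show ?case unfolding star_add by blast
next
  case (mult a T b U)
  obtain T' where T': "(star a, T') \<in> fields_over S0" "\<And>x v w. x \<in> space X \<Longrightarrow> v \<in> hcarrier (F x) \<Longrightarrow> w \<in> hcarrier (F x) \<Longrightarrow> bip B (T' x v) w = bip B v (T x w)"
    using mult by metis
  obtain U' where U': "(star b, U') \<in> fields_over S0" "\<And>x v w. x \<in> space X \<Longrightarrow> v \<in> hcarrier (F x) \<Longrightarrow> w \<in> hcarrier (F x) \<Longrightarrow> bip B (U' x v) w = bip B v (U x w)"
    using mult by metis
  have "bip B (U' x (T' x v)) w = bip B v (T x (U x w))"
    if x: "x \<in> space X" and vw: "v \<in> hcarrier (F x)" "w \<in> hcarrier (F x)" for x v w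
  proof -
    interpret hilbert_space "F x" by (rule fiber_hilbert_space[OF x])
    note cl = bounded_operatorsD(1)[OF decomposesD(1)[OF fields_decompose[OF S0(1)] x]]
    show ?thesis using U'(2)[OF x cl[OF T'(1) vw(1)] vw(2)] T'(2)[OF x vw(1) cl[OF mult.hyps(2) vw(2)]] by simp
  qed
  hence "\<forall>x\<in>space X. \<forall>v\<in>hcarrier (F x). \<forall>w\<in>hcarrier (F x).
      bip B ((\<lambda>v\<in>hcarrier (F x). U' x (T' x v)) v) w = bip B v ((\<lambda>v\<in>hcarrier (F x). T x (U x v)) w)"
    by simp
  with fields_closed(2)[OF U'(1) T'(1)] show ?case unfolding star_mult by blast
next
  case (scale a T r)
  obtain T' where T': "(star a, T') \<in> fields_over S0" "\<And>x v w. x \<in> space X \<Longrightarrow> v \<in> hcarrier (F x) \<Longrightarrow> w \<in> hcarrier (F x) \<Longrightarrow> bip B (T' x v) w = bip B v (T x w)"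
    using scale by metis
  define r' where "r' = (fst r, - snd r)"
  have r': "of_rat_pair r' = cnj (of_rat_pair r)" by (simp add: r'_def of_rat_pair_def of_rat_minus complex_eq_iff)
  have "bip B (bscale B (of_rat_pair r') (T' x v)) w = bip B v (bscale B (of_rat_pair r) (T x w))"
    if x: "x \<in> space X" and vw: "v \<in> hcarrier (F x)" "w \<in> hcarrier (F x)" for x v w
  proof -
    interpret hilbert_space "F x" by (rule fiber_hilbert_space[OF x])
    note cl = bounded_operatorsD(1)[OF decomposesD(1)[OF fields_decompose[OF S0(1)] x]]
    show ?thesis
      using ip_scale_left[OF cl[OF T'(1) vw(1)] vw(2), of "of_rat_pair r'"]
        ip_scale_right[OF vw(1) cl[OF scale.hyps vw(2)], of "of_rat_pair r"] T'(2)[OF x vw] by (simp add: r')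
  qed
  hence "\<forall>x\<in>space X. \<forall>v\<in>hcarrier (F x). \<forall>w\<in>hcarrier (F x).
      bip B ((\<lambda>v\<in>hcarrier (F x). bscale B (of_rat_pair r') (T' x v)) v) w = bip B v ((\<lambda>v\<in>hcarrier (F x). bscale B (of_rat_pair r) (T x v)) w)"
    by simp
  with fields_closed(3)[OF T'(1) T'(1), of r'] show ?case unfolding star_scaleC r'[symmetric] by blast
qed

lemma fields_dense:
  assumes S0: "S \<subseteq> closure S0" "\<And>s. s \<in> S0 \<Longrightarrow> star s \<in> S0" "S0 \<subseteq> S" "S0 \<noteq> {}"
  shows "closure (fst ` fields_over S0) = UNIV"
proof (rule S_generates)
  let ?A = "fst ` fields_over S0"
  have A_add: "a + b \<in> ?A" if "a \<in> ?A" "b \<in> ?A" for a b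
    using that fields_closed(1)[of _ _ S0] by force
  have A_mult: "a * b \<in> ?A" if "a \<in> ?A" "b \<in> ?A" for a b
    using that fields_closed(2)[of _ _ S0] by force
  have A_scale: "scaleC (of_rat_pair r) a \<in> ?A" if "a \<in> ?A" for a r
  proof -
    note a = that
    obtain T where T: "(a, T) \<in> fields_over S0" using a by force
    from fields_closed(3)[OF T T, of r] show ?thesis by (rule rev_image_eqI) simp
  qed
  have A_star: "star a \<in> ?A" if "a \<in> ?A" for a
    using that fields_star[OF S0(3,2)] by force
  have gen: "S0 \<subseteq> ?A" using fields_generator by force
  show "S \<subseteq> closure ?A" using S0(1) closure_mono[OF gen] by blast
  have cont: "f a b \<in> closure ?A"
    if f: "continuous_on UNIV (\<lambda>p. f (fst p) (snd p))" and PA: "\<And>a b. a \<in> P \<Longrightarrow> b \<in> ?A \<Longrightarrow> f a b \<in> ?A"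
      and ab: "a \<in> closure P" "b \<in> closure ?A" for f :: "'p::metric_space \<Rightarrow> 'a \<Rightarrow> 'a" and P a b
  proof -
    have "(\<lambda>p. f (fst p) (snd p)) ` closure (P \<times> ?A) \<subseteq> closure ?A"
    proof (rule image_closure_subset)
      show "continuous_on (closure (P \<times> ?A)) (\<lambda>p. f (fst p) (snd p))" by (rule continuous_on_subset[OF f]) simp
      show "(\<lambda>p. f (fst p) (snd p)) ` (P \<times> ?A) \<subseteq> closure ?A"
      proof
        fix y assume "y \<in> (\<lambda>p. f (fst p) (snd p)) ` (P \<times> ?A)"
        then obtain p where p: "p \<in> P \<times> ?A" "y = f (fst p) (snd p)" by (rule imageE)
        have "y \<in> ?A" unfolding p(2) by (rule PA) (use p(1) in \<open>simp_all only: mem_Times_iff\<close>)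
        thus "y \<in> closure ?A" using closure_subset by (rule rev_subsetD)
      qed
    qed simp
    moreover have "(a, b) \<in> closure (P \<times> ?A)" using ab by (simp add: closure_Times)
    ultimately show ?thesis by force
  qed
  have cl_add: "a + b \<in> closure ?A" if "a \<in> closure ?A" "b \<in> closure ?A" for a b
    by (rule cont[of "(+)" ?A, OF _ A_add that]) (intro continuous_intros)
  have cl_mult: "a * b \<in> closure ?A" if "a \<in> closure ?A" "b \<in> closure ?A" for a b
    by (rule cont[of "(*)" ?A, OF _ A_mult that]) (intro continuous_intros)
  have cl_scale: "scaleC c a \<in> closure ?A" if "a \<in> closure ?A" for c a
  proof (rule cont[of scaleC "range of_rat_pair", OF _ _ _ that])
    have split: "scaleC c b = Re c *\<^sub>R b + Im c *\<^sub>R scaleC \<i> b" for c and b :: 'a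
      unfolding scaleR_eq_scaleC scaleC_scaleC scaleC_add_left[symmetric]
      by (rule arg_cong[of _ _ "\<lambda>c. scaleC c b"]) (simp add: complex_eq_iff)
    have bl: "bounded_linear (scaleC \<i> :: 'a \<Rightarrow> 'a)"
      by (rule bounded_linear_intro[where K = 1])
        (simp_all only: scaleC_add_right scaleR_eq_scaleC scaleC_scaleC norm_scaleC mult.commute norm_ii mult_1 order_refl mult_1_right)
    have eq: "(\<lambda>p::complex \<times> 'a. scaleC (fst p) (snd p)) = (\<lambda>p. Re (fst p) *\<^sub>R snd p + Im (fst p) *\<^sub>R scaleC \<i> (snd p))"
      by (rule ext) (rule split)
    show "continuous_on UNIV (\<lambda>p::complex \<times> 'a. scaleC (fst p) (snd p))"
      unfolding eq
      by (intro continuous_on_add continuous_on_scaleR bounded_linear.continuous_on[OF bl] continuous_on_Re continuous_on_Im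
          continuous_on_fst continuous_on_snd continuous_on_id)
    show "scaleC z b \<in> ?A" if "z \<in> range of_rat_pair" "b \<in> ?A" for z b using that A_scale by blast
    show "c \<in> closure (range of_rat_pair)" by (simp add: closure_of_rat_pair)
  qed
  have cl_star: "star a \<in> closure ?A" if "a \<in> closure ?A" for a
  proof -
    have "star ` closure ?A \<subseteq> closure ?A"
    proof (rule image_closure_subset)
      show "continuous_on (closure ?A) star" by (rule bounded_linear.continuous_on[OF bounded_linear_star continuous_on_id])
      show "star ` ?A \<subseteq> closure ?A" using A_star closure_subset[of ?A] by blast
    qed simp
    thus ?thesis using that by blast
  qed
  have "0 \<in> closure ?A"
  proof -
    obtain s where "s \<in> S0" using S0(4) by blast
    hence "s \<in> closure ?A" using gen closure_subset[of ?A] by blast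
    from cl_scale[OF this, of 0] show ?thesis by simp
  qed
  thus "cstar_subalgebra (closure ?A)"
    unfolding cstar_subalgebra_def module.subspace_def[OF module_scaleC]
    using cl_add cl_mult cl_scale cl_star by simp
qed

lemma countable_generators:
  obtains S0 where "countable S0" "S0 \<subseteq> S" "S \<subseteq> closure S0" "1 \<in> S0" "\<And>s. s \<in> S0 \<Longrightarrow> star s \<in> S0"
proof -
  obtain C where C: "countable C" "C \<subseteq> S" "top_of_set S closure_of C = S"
    using system unfolding separable_operator_system_def separable_space_def by auto
  have SC: "S \<subseteq> closure C"
    using C(3) closure_of_subtopology_subset[of euclidean S C] by simp
  note D = selfadjoint_subspaceD[OF S_selfadjoint]
  show ?thesis
  proof (rule that[of "insert 1 (C \<union> star ` C)"])
    show "countable (insert 1 (C \<union> star ` C))" using C(1) by simp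
    show "insert 1 (C \<union> star ` C) \<subseteq> S" using C(2) D by auto
    show "S \<subseteq> closure (insert 1 (C \<union> star ` C))"
      using SC closure_mono[of C "insert 1 (C \<union> star ` C)"] by blast
    show "star s \<in> insert 1 (C \<union> star ` C)" if "s \<in> insert 1 (C \<union> star ` C)" for s
      using that by (auto simp: star_star)
  qed simp
qed

end

section \<open>Uniqueness in almost every fiber\<close>

context direct_integral_extension
begin

text \<open>The counterpart of \<open>evaluation\<close> in the fiber over \<open>x\<close>: a formal sum over the direct integral is
evaluated at \<open>x\<close> on representing sections.\<close>

definition fiber_evaluation :: "('a \<Rightarrow> 'h \<Rightarrow> 'h) \<Rightarrow> 'x \<Rightarrow> ('x \<Rightarrow> 'h) set \<times> ('x \<Rightarrow> 'h) set \<Rightarrow> 'a \<Rightarrow> real" where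
  "fiber_evaluation \<psi> x k a = (if fst k \<in> hcarrier D \<and> snd k \<in> hcarrier D
     then Re (bip B (\<psi> a (ae_rep (fst k) x)) (ae_rep (snd k) x)) else 0)"

lemma fiber_evaluation_simps:
  "u \<in> hcarrier D \<Longrightarrow> v \<in> hcarrier D \<Longrightarrow> fiber_evaluation \<psi> x (u, v) a = Re (bip B (\<psi> a (ae_rep u x)) (ae_rep v x))"
  "u \<notin> hcarrier D \<or> v \<notin> hcarrier D \<Longrightarrow> fiber_evaluation \<psi> x (u, v) a = 0"
  by (auto simp: fiber_evaluation_def)

lemma rep_in_fiber: "u \<in> hcarrier D \<Longrightarrow> x \<in> space X \<Longrightarrow> ae_rep u x \<in> hcarrier (F x)"
  by (rule L2_in_fiber[OF D_rep(1)])

lemma linear_fiber_evaluation: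
  assumes x: "x \<in> space X" and lin: "operator_linear_on UNIV (F x) \<psi>"
  shows "linear (fiber_evaluation \<psi> x k)"
proof -
  interpret hilbert_space "F x" by (rule fiber_hilbert_space[OF x])
  note L = operator_linear_onD[OF lin UNIV_I]
  obtain u v where k: "k = (u, v)" by (cases k)
  show ?thesis
  proof (cases "u \<in> hcarrier D \<and> v \<in> hcarrier D")
    case True
    note uv = rep_in_fiber[OF conjunct1[OF True] x] rep_in_fiber[OF conjunct2[OF True] x]
    show ?thesis
    proof (rule linearI)
      fix a b
      show "fiber_evaluation \<psi> x k (a + b) = fiber_evaluation \<psi> x k a + fiber_evaluation \<psi> x k b"
        using L(4)[OF uv(1), of b a] ip_add_left[OF L(1)[OF uv(1), of a] L(1)[OF uv(1), of b] uv(2)] True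
        by (simp add: k fiber_evaluation_simps)
    next
      fix r :: real and a
      show "fiber_evaluation \<psi> x k (r *\<^sub>R a) = r *\<^sub>R fiber_evaluation \<psi> x k a"
        using L(5)[OF uv(1), of "of_real r" a] ip_scale_left[OF L(1)[OF uv(1), of a] uv(2), of "of_real r"] True
        by (simp add: k fiber_evaluation_simps scaleR_eq_scaleC)
    qed
  next
    case False
    thus ?thesis by (intro linearI) (auto simp: k fiber_evaluation_simps)
  qed
qed

lemma AE_fiberI:
  assumes "AE x in \<mu>. P x" "\<And>x \<psi>. x \<in> space X \<Longrightarrow> P x \<Longrightarrow> cp_map UNIV (F x) \<psi> \<Longrightarrow> \<psi> 1 = (\<lambda>v\<in>hcarrier (F x). v) \<Longrightarrow> Q x \<psi>"
  shows "AE x in \<mu>. \<forall>\<psi>. cp_map UNIV (F x) \<psi> \<and> \<psi> 1 = (\<lambda>v\<in>hcarrier (F x). v) \<longrightarrow> Q x \<psi>"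
  using assms(1) AE_space[of \<mu>] by eventually_elim (use assms(2) in \<open>auto simp: space_eq\<close>)

text \<open>The null set depends on the element of the cone but not on \<open>\<psi>\<close>. This is what replaces a measurable choice
of \<open>\<psi>\<close>: each generator involves at most one relation between classes of sections, and that relation holds pointwise
almost everywhere.\<close>

lemma positive_cone_fibers:
  assumes "u \<in> positive_cone D"
  shows "AE x in \<mu>. \<forall>\<psi>. cp_map UNIV (F x) \<psi> \<and> \<psi> 1 = (\<lambda>v\<in>hcarrier (F x). v) \<longrightarrow>
    0 \<le> pairing (fiber_evaluation \<psi> x) u"
proof -
  have P: "linear (pairing (fiber_evaluation \<psi> x))"
    and Ps: "pairing (fiber_evaluation \<psi> x) (Poly_Mapping.single k a) = fiber_evaluation \<psi> x k a"
    if "x \<in> space X" "cp_map UNIV (F x) \<psi>" for x \<psi> k a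
    using linear_pairing[of "fiber_evaluation \<psi> x"] pairing_single[of "fiber_evaluation \<psi> x"]
      linear_fiber_evaluation[of x \<psi>] that by (auto simp: cp_map_def)
  have lin: "operator_linear_on UNIV (F x) \<psi>" if "cp_map UNIV (F x) \<psi>" for x \<psi>
    using that by (simp add: cp_map_def)
  show ?thesis using assms
  proof induction
    case (cone_add u v)
    from cone_add.IH AE_space[of \<mu>] show ?case
    proof eventually_elim
      case (elim x)
      thus ?case using P[of x] by (auto simp: linear_add space_eq)
    qed
  next
    case (cone_scale u r)
    from cone_scale.IH AE_space[of \<mu>] show ?case
    proof eventually_elim
      case (elim x)
      thus ?case using P[of x] cone_scale.hyps by (auto simp: linear_scale space_eq)
    qed
  next
    case (cone_gram n v b)
    show ?case
    proof (rule AE_fiberI[where P = "\<lambda>_. True"])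
      fix x and \<psi> :: "'a \<Rightarrow> 'h \<Rightarrow> 'h" assume x: "x \<in> space X" and cp: "cp_map UNIV (F x) \<psi>"
      interpret hilbert_space "F x" by (rule fiber_hilbert_space[OF x])
      have "0 \<le> (\<Sum>i<n. \<Sum>j<n. Re (hip (F x) (\<psi> (star (b i) * b j) (ae_rep (v j) x)) (ae_rep (v i) x)))"
        by (rule cp_gram[OF cp]) (rule rep_in_fiber[OF cone_gram x])
      also have "\<dots> = pairing (fiber_evaluation \<psi> x) (\<Sum>i<n. \<Sum>j<n. Poly_Mapping.single (v j, v i) (star (b i) * b j))"
        using cone_gram by (simp add: linear_sum[OF P[OF x cp]] Ps[OF x cp] fiber_evaluation_simps)
      finally show "0 \<le> pairing (fiber_evaluation \<psi> x) (\<Sum>i<n. \<Sum>j<n. Poly_Mapping.single (v j, v i) (star (b i) * b j))" .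
    qed simp
  next
    case (cone_linear_add \<eta> \<eta>' \<xi> a)
    interpret HD: hilbert_space D by (rule hilbert_D)
    note sum_D = HD.add_closed[OF cone_linear_add(1,2)]
    have "hadd D \<eta> \<eta>' = cls (\<lambda>x. badd B (ae_rep \<eta> x) (ae_rep \<eta>' x))"
      using D_add[OF D_rep(1)[OF cone_linear_add(1)] D_rep(1)[OF cone_linear_add(2)]]
      unfolding D_rep(2)[OF cone_linear_add(1)] D_rep(2)[OF cone_linear_add(2)] .
    hence "AE x in \<mu>. ae_rep (hadd D \<eta> \<eta>') x = badd B (ae_rep \<eta> x) (ae_rep \<eta>' x)"
      using rep_cls[OF L2_add[OF D_rep(1)[OF cone_linear_add(1)] D_rep(1)[OF cone_linear_add(2)]]] by simp
    thus ?case
    proof (rule AE_fiberI)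
      fix x and \<psi> :: "'a \<Rightarrow> 'h \<Rightarrow> 'h" assume x: "x \<in> space X" and cp: "cp_map UNIV (F x) \<psi>"
        and eq: "ae_rep (hadd D \<eta> \<eta>') x = badd B (ae_rep \<eta> x) (ae_rep \<eta>' x)"
      interpret hilbert_space "F x" by (rule fiber_hilbert_space[OF x])
      note L = operator_linear_onD[OF lin[OF cp] UNIV_I]
      note m = rep_in_fiber[OF cone_linear_add(1) x] rep_in_fiber[OF cone_linear_add(2) x] rep_in_fiber[OF cone_linear_add(3) x]
      show "0 \<le> pairing (fiber_evaluation \<psi> x) (Poly_Mapping.single (hadd D \<eta> \<eta>', \<xi>) a - Poly_Mapping.single (\<eta>, \<xi>) a - Poly_Mapping.single (\<eta>', \<xi>) a)"
        using L(2)[OF m(1,2), of a] ip_add_left[OF L(1)[OF m(1), of a] L(1)[OF m(2), of a] m(3)] cone_linear_add sum_D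
        by (simp add: linear_diff[OF P[OF x cp]] Ps[OF x cp] fiber_evaluation_simps eq)
    qed
  next
    case (cone_linear_scale \<eta> \<xi> c a)
    interpret HD: hilbert_space D by (rule hilbert_D)
    note scale_D = HD.scale_closed[OF cone_linear_scale(1)]
    have "hscale D c \<eta> = cls (\<lambda>x. bscale B c (ae_rep \<eta> x))"
      using D_scale[OF D_rep(1)[OF cone_linear_scale(1)]] unfolding D_rep(2)[OF cone_linear_scale(1)] .
    hence "AE x in \<mu>. ae_rep (hscale D c \<eta>) x = bscale B c (ae_rep \<eta> x)"
      using rep_cls[OF L2_scale_const[OF D_rep(1)[OF cone_linear_scale(1)]]] by simp
    thus ?case
    proof (rule AE_fiberI)
      fix x and \<psi> :: "'a \<Rightarrow> 'h \<Rightarrow> 'h" assume x: "x \<in> space X" and cp: "cp_map UNIV (F x) \<psi>"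
        and eq: "ae_rep (hscale D c \<eta>) x = bscale B c (ae_rep \<eta> x)"
      note L = operator_linear_onD[OF lin[OF cp] UNIV_I]
      note m = rep_in_fiber[OF cone_linear_scale(1) x]
      show "0 \<le> pairing (fiber_evaluation \<psi> x) (Poly_Mapping.single (hscale D c \<eta>, \<xi>) a - Poly_Mapping.single (\<eta>, \<xi>) (scaleC c a))"
        using L(3)[OF m, of a c] L(5)[OF m, of c a] cone_linear_scale scale_D
        by (simp add: linear_diff[OF P[OF x cp]] Ps[OF x cp] fiber_evaluation_simps eq)
    qed
  next
    case (cone_hermitian \<eta> \<xi> a)
    show ?case
    proof (rule AE_fiberI[where P = "\<lambda>_. True"])
      fix x and \<psi> :: "'a \<Rightarrow> 'h \<Rightarrow> 'h" assume x: "x \<in> space X" and cp: "cp_map UNIV (F x) \<psi>" and one: "\<psi> 1 = (\<lambda>v\<in>hcarrier (F x). v)"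
      interpret hilbert_space "F x" by (rule fiber_hilbert_space[OF x])
      note L = operator_linear_onD[OF lin[OF cp] UNIV_I]
      note m = rep_in_fiber[OF cone_hermitian(1) x] rep_in_fiber[OF cone_hermitian(2) x]
      have "hip (F x) (\<psi> (star a) (ae_rep \<xi> x)) (ae_rep \<eta> x) = hip (F x) (ae_rep \<xi> x) (\<psi> a (ae_rep \<eta> x))"
        by (rule ucp_hermitian[OF cp one selfadjoint_subspace_UNIV UNIV_I m(2,1)])
      also have "\<dots> = cnj (hip (F x) (\<psi> a (ae_rep \<eta> x)) (ae_rep \<xi> x))"
        by (rule ip_commute[OF L(1)[OF m(1)] m(2)])
      finally have h: "bip B (\<psi> (star a) (ae_rep \<xi> x)) (ae_rep \<eta> x) = cnj (bip B (\<psi> a (ae_rep \<eta> x)) (ae_rep \<xi> x))" by simp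
      show "0 \<le> pairing (fiber_evaluation \<psi> x) (Poly_Mapping.single (\<eta>, \<xi>) a - Poly_Mapping.single (\<xi>, \<eta>) (star a))"
        using cone_hermitian by (simp add: linear_diff[OF P[OF x cp]] Ps[OF x cp] fiber_evaluation_simps h)
    qed simp
  next
    case (cone_off_carrier \<eta> \<xi> a)
    show ?case
    proof (rule AE_fiberI[where P = "\<lambda>_. True"])
      fix x and \<psi> :: "'a \<Rightarrow> 'h \<Rightarrow> 'h" assume x: "x \<in> space X" and cp: "cp_map UNIV (F x) \<psi>"
      show "0 \<le> pairing (fiber_evaluation \<psi> x) (Poly_Mapping.single (\<eta>, \<xi>) a)"
        using cone_off_carrier by (simp add: Ps[OF x cp] fiber_evaluation_simps)
    qed simp
  qed
qed

text \<open>On \<open>S\<close>-valued sums the fiber values depend on \<open>\<phi>\<close> alone, and they integrate to the value at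
\<open>\<pi>\<close>.\<close>

lemma integral_pairing:
  assumes \<sigma>: "\<And>k. Poly_Mapping.lookup \<sigma> k \<in> S"
  shows "integrable \<mu> (\<lambda>x. pairing (fiber_evaluation (\<phi> x) x) \<sigma>)"
    "(\<integral>x. pairing (fiber_evaluation (\<phi> x) x) \<sigma> \<partial>\<mu>) = pairing (evaluation D \<pi>) \<sigma>"
proof -
  have summand: "integrable \<mu> (\<lambda>x. fiber_evaluation (\<phi> x) x k s)"
    "(\<integral>x. fiber_evaluation (\<phi> x) x k s \<partial>\<mu>) = evaluation D \<pi> k s" if s: "s \<in> S" for k s
  proof -
    obtain u v where k: "k = (u, v)" by (cases k)
    have "integrable \<mu> (\<lambda>x. fiber_evaluation (\<phi> x) x k s) \<and>
      (\<integral>x. fiber_evaluation (\<phi> x) x k s \<partial>\<mu>) = evaluation D \<pi> k s"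
    proof (cases "u \<in> hcarrier D \<and> v \<in> hcarrier D")
      case True
      hence u: "u \<in> hcarrier D" and v: "v \<in> hcarrier D" by auto
      note dec = decomposesD[OF decomposes_generator[OF s]]
      note ru = D_rep[OF u] and rv = D_rep[OF v]
      have int: "integrable \<mu> (\<lambda>x. bip B (\<phi> x s (ae_rep u x)) (ae_rep v x))"
        by (rule L2_ip[OF dec(2)[OF ru(1)] rv(1)])
      have "hip D (\<pi> s u) v = (\<integral>x. bip B (\<phi> x s (ae_rep u x)) (ae_rep v x) \<partial>\<mu>)"
        using dec(3)[OF ru(1)] D_ip[OF dec(2)[OF ru(1)] rv(1)] unfolding ru(2) rv(2) by simp
      thus ?thesis using int u v by (simp add: k fiber_evaluation_simps evaluation_def)
    next
      case False
      thus ?thesis by (auto simp: k fiber_evaluation_simps evaluation_def)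
    qed
    thus "integrable \<mu> (\<lambda>x. fiber_evaluation (\<phi> x) x k s)"
      "(\<integral>x. fiber_evaluation (\<phi> x) x k s \<partial>\<mu>) = evaluation D \<pi> k s" by auto
  qed
  show "integrable \<mu> (\<lambda>x. pairing (fiber_evaluation (\<phi> x) x) \<sigma>)"
    unfolding pairing_def by (intro Bochner_Integration.integrable_sum summand(1) \<sigma>)
  show "(\<integral>x. pairing (fiber_evaluation (\<phi> x) x) \<sigma> \<partial>\<mu>) = pairing (evaluation D \<pi>) \<sigma>"
    unfolding pairing_def
    by (subst Bochner_Integration.integral_sum) (auto intro!: summand \<sigma> sum.cong)
qed

lemma extension_is_ucp:
  assumes x: "x \<in> space X" and ext: "cp_extension S (F x) (\<phi> x) \<psi>"
  shows "cp_map UNIV (F x) \<psi>" "\<psi> 1 = (\<lambda>v\<in>hcarrier (F x). v)" "\<And>s. s \<in> S \<Longrightarrow> \<psi> s = \<phi> x s"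
  using ext fiber_ucp(2)[OF x] selfadjoint_subspaceD(2)[OF S_selfadjoint] by (auto simp: cp_extension_def)

text \<open>Let \<open>g k\<close> be the fiber values of a dominating \<open>S\<close>-valued sum for \<open>\<epsilon> = (1/2)^k\<close>, and \<open>h\<close> those that
belong to \<open>\<pi>\<close>. Every \<open>g k\<close> bounds all extensions in almost every fiber, in particular the one that realizes \<open>h\<close>. So
\<open>g k - h\<close> is nonnegative with integral at most \<open>(1/2)^k\<close>, and its infimum over \<open>k\<close> vanishes almost everywhere.\<close>

lemma fiber_extension_bound:
  assumes dec: "decomposes a T" and \<xi>: "\<xi> \<in> L2" "\<eta> \<in> L2"
    and good: "AE x in \<mu>. \<exists>\<rho>. cp_extension S (F x) (\<phi> x) \<rho> \<and> (\<forall>v\<in>hcarrier (F x). \<rho> a v = T x v)"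
  shows "AE x in \<mu>. \<forall>\<psi>. cp_extension S (F x) (\<phi> x) \<psi> \<longrightarrow> Re (bip B (\<psi> a (\<xi> x)) (\<eta> x)) \<le> Re (bip B (T x (\<xi> x)) (\<eta> x))"
proof -
  interpret HD: hilbert_space D by (rule hilbert_D)
  note t = decomposesD[OF dec]
  define h where "h x = Re (bip B (T x (\<xi> x)) (\<eta> x))" for x
  have h: "integrable \<mu> h" "(\<integral>x. h x \<partial>\<mu>) = Re (hip D (\<pi> a (cls \<xi>)) (cls \<eta>))"
    using L2_ip[OF t(2)[OF \<xi>(1)] \<xi>(2)] D_ip[OF t(2)[OF \<xi>(1)] \<xi>(2)]
    by (simp_all add: h_def[abs_def] t(3)[OF \<xi>(1)])
  have uniq: "\<psi> = \<pi>" if "cp_extension S D \<pi> \<psi>" for \<psi>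
    by (rule unique) (use that extends in \<open>simp add: cp_extension_def\<close>)
  have "\<exists>\<sigma>. (\<forall>k. Poly_Mapping.lookup \<sigma> k \<in> S) \<and> \<sigma> - Poly_Mapping.single (cls \<xi>, cls \<eta>) a \<in> positive_cone D \<and>
      pairing (evaluation D \<pi>) \<sigma> < Re (hip D (\<pi> a (cls \<xi>)) (cls \<eta>)) + (1/2)^k" for k :: nat
  proof -
    have "(0::real) < (1/2)^k" by simp
    from HD.extension_duality[OF S_selfadjoint \<pi>_cp \<pi>_one uniq cls_in_D[OF \<xi>(1)] cls_in_D[OF \<xi>(2)] this]
    show ?thesis by metis
  qed
  then obtain \<sigma> where \<sigma>: "\<And>k j. Poly_Mapping.lookup (\<sigma> k) j \<in> S"
      "\<And>k. \<sigma> k - Poly_Mapping.single (cls \<xi>, cls \<eta>) a \<in> positive_cone D"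
      "\<And>k. pairing (evaluation D \<pi>) (\<sigma> k) < Re (hip D (\<pi> a (cls \<xi>)) (cls \<eta>)) + (1/2)^k"
    by metis
  define g where "g k x = pairing (fiber_evaluation (\<phi> x) x) (\<sigma> k)" for k x
  have g: "integrable \<mu> (g k)" "(\<integral>x. g k x \<partial>\<mu>) = pairing (evaluation D \<pi>) (\<sigma> k)" for k
    unfolding g_def using integral_pairing[OF \<sigma>(1)] by auto
  have above: "AE x in \<mu>. \<forall>\<psi>. cp_extension S (F x) (\<phi> x) \<psi> \<longrightarrow> Re (bip B (\<psi> a (\<xi> x)) (\<eta> x)) \<le> g k x" for k
    using positive_cone_fibers[OF \<sigma>(2)[of k]] rep_cls[OF \<xi>(1)] rep_cls[OF \<xi>(2)] AE_space[of \<mu>]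
  proof eventually_elim
    case (elim x)
    hence x: "x \<in> space X" by (simp add: space_eq)
    show ?case
    proof (intro allI impI)
      fix \<psi> assume "cp_extension S (F x) (\<phi> x) \<psi>"
      note \<psi> = extension_is_ucp[OF x this]
      have lin: "operator_linear_on UNIV (F x) \<psi>" using \<psi>(1) by (simp add: cp_map_def)
      note fl = linear_fiber_evaluation[OF x lin]
      have "0 \<le> pairing (fiber_evaluation \<psi> x) (\<sigma> k - Poly_Mapping.single (cls \<xi>, cls \<eta>) a)"
        using elim(1) \<psi>(1,2) by blast
      also have "\<dots> = pairing (fiber_evaluation \<psi> x) (\<sigma> k) - fiber_evaluation \<psi> x (cls \<xi>, cls \<eta>) a"
        by (simp add: linear_diff[OF linear_pairing[OF fl]] pairing_single[OF fl])
      also have "fiber_evaluation \<psi> x (cls \<xi>, cls \<eta>) a = Re (bip B (\<psi> a (\<xi> x)) (\<eta> x))"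
        unfolding fiber_evaluation_simps(1)[OF cls_in_D[OF \<xi>(1)] cls_in_D[OF \<xi>(2)]] elim(2,3) ..
      also have "pairing (fiber_evaluation \<psi> x) (\<sigma> k) = g k x"
        unfolding g_def pairing_def by (intro sum.cong refl) (simp only: fiber_evaluation_def \<psi>(3)[OF \<sigma>(1)])
      finally show "Re (bip B (\<psi> a (\<xi> x)) (\<eta> x)) \<le> g k x" by simp
    qed
  qed
  have ge: "AE x in \<mu>. h x \<le> g k x" for k
    using above[of k] good AE_space[of \<mu>]
  proof eventually_elim
    case (elim x)
    hence x: "x \<in> space X" by (simp add: space_eq)
    obtain \<rho> where \<rho>: "cp_extension S (F x) (\<phi> x) \<rho>" "\<And>v. v \<in> hcarrier (F x) \<Longrightarrow> \<rho> a v = T x v" using elim(2) by blast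
    have "Re (bip B (\<rho> a (\<xi> x)) (\<eta> x)) \<le> g k x" using elim(1) \<rho>(1) by blast
    thus ?case by (simp add: h_def \<rho>(2)[OF L2_in_fiber[OF \<xi>(1) x]])
  qed
  define i where "i x = (INF k. ennreal (g k x - h x))" for x
  have gh_meas: "(\<lambda>x. ennreal (g k x - h x)) \<in> borel_measurable \<mu>" for k
    using borel_measurable_integrable[OF g(1)[of k]] borel_measurable_integrable[OF h(1)] by measurable
  have i_meas: "i \<in> borel_measurable \<mu>" unfolding i_def using gh_meas by (intro borel_measurable_INF) auto
  have "(\<integral>\<^sup>+x. i x \<partial>\<mu>) \<le> ennreal ((1/2)^k)" for k
  proof -
    have "(\<integral>\<^sup>+x. i x \<partial>\<mu>) \<le> (\<integral>\<^sup>+x. ennreal (g k x - h x) \<partial>\<mu>)"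
      unfolding i_def by (intro nn_integral_mono INF_lower) auto
    also have "\<dots> = ennreal (\<integral>x. g k x - h x \<partial>\<mu>)"
      by (rule nn_integral_eq_integral) (use g(1) h(1) ge[of k] in auto)
    also have "(\<integral>x. g k x - h x \<partial>\<mu>) \<le> (1/2)^k"
      using \<sigma>(3)[of k] by (simp add: g h)
    finally show ?thesis by (simp add: ennreal_leI)
  qed
  moreover have "(\<lambda>k. ennreal ((1/2)^k)) \<longlonglongrightarrow> ennreal 0"
    by (intro tendsto_ennrealI LIMSEQ_power_zero) simp
  ultimately have "(\<integral>\<^sup>+x. i x \<partial>\<mu>) \<le> ennreal 0" by (intro LIMSEQ_le_const) auto
  hence "AE x in \<mu>. i x = 0" using nn_integral_0_iff_AE[OF i_meas] by simp
  moreover have "AE x in \<mu>. \<forall>k. \<forall>\<psi>. cp_extension S (F x) (\<phi> x) \<psi> \<longrightarrow> Re (bip B (\<psi> a (\<xi> x)) (\<eta> x)) \<le> g k x"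
    using above by (simp add: AE_all_countable)
  ultimately show ?thesis
  proof eventually_elim
    case (elim x)
    show ?case
    proof (intro allI impI)
      fix \<psi> assume \<psi>: "cp_extension S (F x) (\<phi> x) \<psi>"
      have "Re (bip B (\<psi> a (\<xi> x)) (\<eta> x)) \<le> h x + \<epsilon>" if \<epsilon>: "\<epsilon> > 0" for \<epsilon>
      proof -
        have "(INF k. ennreal (g k x - h x)) < ennreal \<epsilon>" using elim(1) \<epsilon> by (simp add: i_def)
        then obtain k where "ennreal (g k x - h x) < ennreal \<epsilon>" unfolding INF_less_iff by blast
        hence "\<not> \<epsilon> \<le> g k x - h x" using ennreal_leI[of \<epsilon> "g k x - h x"] by (auto simp: not_le[symmetric])
        hence "g k x - h x < \<epsilon>" by simp
        moreover have "Re (bip B (\<psi> a (\<xi> x)) (\<eta> x)) \<le> g k x" using elim(2) \<psi> by blast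
        ultimately show ?thesis by simp
      qed
      thus "Re (bip B (\<psi> a (\<xi> x)) (\<eta> x)) \<le> Re (bip B (T x (\<xi> x)) (\<eta> x))"
        unfolding h_def[symmetric] by (rule field_le_epsilon)
    qed
  qed
qed

text \<open>The contractive action of rational polynomials extends to a representation. It agrees with \<open>\<phi> x\<close> on the
generators \<open>S0\<close>, hence on \<open>S\<close>, because both maps are contractive.\<close>

lemma fiber_representation:
  assumes x: "x \<in> space X" and S0: "S0 \<subseteq> S" "S \<subseteq> closure S0" "1 \<in> S0" "\<And>s. s \<in> S0 \<Longrightarrow> star s \<in> S0"
    and bound: "\<And>a T v. (a, T) \<in> fields_over S0 \<Longrightarrow> v \<in> hcarrier (F x) \<Longrightarrow> hnorm (F x) (T x v) \<le> norm a * hnorm (F x) v"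
  obtains \<rho> where "representation (F x) \<rho>" "cp_extension S (F x) (\<phi> x) \<rho>"
    "\<And>a T v. (a, T) \<in> fields_over S0 \<Longrightarrow> v \<in> hcarrier (F x) \<Longrightarrow> \<rho> a v = T x v"
proof -
  interpret hilbert_space "F x" by (rule fiber_hilbert_space[OF x])
  define R where "R = (\<lambda>(a, T). (a, T x)) ` fields_over S0"
  have RI: "(a, T x) \<in> R" if "(a, T) \<in> fields_over S0" for a T using that by (force simp: R_def)
  have RE: "\<exists>T'. (a, T') \<in> fields_over S0 \<and> T = T' x" if "(a, T) \<in> R" for a T using that by (auto simp: R_def)
  obtain \<rho> where \<rho>: "representation (F x) \<rho>"
    "\<And>a b T v. (b, T) \<in> R \<Longrightarrow> v \<in> hcarrier (F x) \<Longrightarrow> hnorm (F x) (sub (\<rho> a v) (T v)) \<le> norm (a - b) * hnorm (F x) v"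
  proof (rule extend_dense_representation[of R])
    show "T \<in> bounded_operators (F x)" if "(a, T) \<in> R" for a T
      using RE[OF that] decomposesD(1)[OF fields_decompose[OF S0(1)] x] by blast
    show "hnorm (F x) (T v) \<le> norm a * hnorm (F x) v" if "(a, T) \<in> R" "v \<in> hcarrier (F x)" for a T v
      using RE[OF that(1)] bound that(2) by blast
    show "\<exists>W. (a + b, W) \<in> R \<and> (\<forall>v\<in>hcarrier (F x). W v = hadd (F x) (T v) (U v))" if "(a, T) \<in> R" "(b, U) \<in> R" for a T b U
    proof -
      note ab = that
      obtain T' where T: "(a, T') \<in> fields_over S0" "T = T' x" using RE[OF ab(1)] by blast
      obtain U' where U: "(b, U') \<in> fields_over S0" "U = U' x" using RE[OF ab(2)] by blast
      from RI[OF fields_closed(1)[OF T(1) U(1)]] show ?thesis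
        by (intro exI[of _ "\<lambda>v\<in>hcarrier (F x). badd B (T' x v) (U' x v)"]) (simp add: T(2) U(2) del: restrict_apply, simp)
    qed
    show "\<exists>W. (a * b, W) \<in> R \<and> (\<forall>v\<in>hcarrier (F x). W v = T (U v))" if "(a, T) \<in> R" "(b, U) \<in> R" for a T b U
    proof -
      note ab = that
      obtain T' where T: "(a, T') \<in> fields_over S0" "T = T' x" using RE[OF ab(1)] by blast
      obtain U' where U: "(b, U') \<in> fields_over S0" "U = U' x" using RE[OF ab(2)] by blast
      from RI[OF fields_closed(2)[OF T(1) U(1)]] show ?thesis
        by (intro exI[of _ "\<lambda>v\<in>hcarrier (F x). T' x (U' x v)"]) (simp add: T(2) U(2) del: restrict_apply, simp)
    qed
    show "\<exists>W. (scaleC (of_rat_pair q) a, W) \<in> R \<and> (\<forall>v\<in>hcarrier (F x). W v = hscale (F x) (of_rat_pair q) (T v))" if "(a, T) \<in> R" for a T q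
    proof -
      note ab = that
      obtain T' where T: "(a, T') \<in> fields_over S0" "T = T' x" using RE[OF ab(1)] by blast
      from RI[OF fields_closed(3)[OF T(1) T(1), of q]] show ?thesis
        by (intro exI[of _ "\<lambda>v\<in>hcarrier (F x). bscale B (of_rat_pair q) (T' x v)"]) (simp add: T(2) del: restrict_apply, simp)
    qed
    show "\<exists>W. (star a, W) \<in> R \<and> (\<forall>v\<in>hcarrier (F x). \<forall>w\<in>hcarrier (F x). hip (F x) (W v) w = hip (F x) v (T w))" if "(a, T) \<in> R" for a T
    proof -
      note ab = that
      obtain T' where T: "(a, T') \<in> fields_over S0" "T = T' x" using RE[OF ab(1)] by blast
      obtain U where U: "(star a, U) \<in> fields_over S0"
        "\<forall>x\<in>space X. \<forall>v\<in>hcarrier (F x). \<forall>w\<in>hcarrier (F x). bip B (U x v) w = bip B v (T' x w)"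
        using fields_star[OF S0(1,4) T(1)] by blast
      show ?thesis using RI[OF U(1)] U(2) x by (intro exI[of _ "U x"]) (simp add: T(2))
    qed
    show "\<exists>T. (1, T) \<in> R \<and> (\<forall>v\<in>hcarrier (F x). T v = v)"
      using RI[OF fields_generator[OF S0(3)]] fiber_ucp(2)[OF x] by (intro exI[of _ "\<phi> x 1"]) simp
    have "fst ` R = fst ` fields_over S0" by (force simp: R_def)
    thus "closure (fst ` R) = UNIV" using fields_dense[OF S0(2,4,1)] S0(3) by auto
  qed (rule that)
  have \<rho>_lin: "operator_linear_on UNIV (F x) \<rho>" using \<rho>(1) by (simp add: representation_def)
  note L = operator_linear_onD[OF \<rho>_lin UNIV_I]
  note K = operator_linear_onD[OF fiber_ucp(3)[OF x]]
  have agree: "\<rho> a v = T x v" if aT: "(a, T) \<in> fields_over S0" "v \<in> hcarrier (F x)" for a T v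
  proof (rule eq_if_sub_le[where K = 0])
    show "hnorm (F x) (sub (\<rho> a v) (T x v)) \<le> e * 0" for e
      using \<rho>(2)[OF RI[OF aT(1)] aT(2), of a] by simp
    show "T x v \<in> hcarrier (F x)"
      by (rule bounded_operatorsD(1)[OF decomposesD(1)[OF fields_decompose[OF S0(1) aT(1)] x] aT(2)])
  qed (rule L(1)[OF aT(2)])
  have "\<rho> s = \<phi> x s" if s: "s \<in> S" for s
  proof (rule extensionalityI[of _ "hcarrier (F x)"])
    show "\<rho> s \<in> extensional (hcarrier (F x))" using L(6)[OF zero_closed] .
    show "\<phi> x s \<in> extensional (hcarrier (F x))" using K(6)[OF s zero_closed] .
    fix v assume v: "v \<in> hcarrier (F x)"
    show "\<rho> s v = \<phi> x s v"
    proof (rule eq_if_sub_le[OF L(1)[OF v] K(1)[OF s v]])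
      fix e :: real assume e: "e > 0"
      have "s \<in> closure S0" using S0(2) s by blast
      hence "\<forall>e>0. \<exists>y\<in>S0. dist y s < e" by (simp only: closure_approachable)
      then obtain s' where s': "s' \<in> S0" "norm (s' - s) < e" using e unfolding dist_norm by blast
      have s'S: "s' \<in> S" using s'(1) S0(1) by blast
      have "hnorm (F x) (sub (\<rho> s v) (\<phi> x s v)) \<le> hnorm (F x) (sub (\<rho> s v) (\<phi> x s' v)) + hnorm (F x) (sub (\<phi> x s' v) (\<phi> x s v))"
        by (rule sub_triangle[OF L(1)[OF v] K(1)[OF s'S v] K(1)[OF s v]])
      moreover have "hnorm (F x) (sub (\<rho> s v) (\<phi> x s' v)) \<le> e * hnorm (F x) v"
      proof -
        have "hnorm (F x) (sub (\<rho> s v) (\<phi> x s' v)) \<le> norm (s - s') * hnorm (F x) v"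
          by (rule \<rho>(2)[OF RI[OF fields_generator[OF s'(1)]] v])
        also have "\<dots> \<le> e * hnorm (F x) v"
          using s'(2) hnorm_nonneg[OF v] by (intro mult_right_mono) (auto simp: norm_minus_commute)
        finally show ?thesis .
      qed
      moreover have "hnorm (F x) (sub (\<phi> x s' v) (\<phi> x s v)) \<le> e * hnorm (F x) v"
      proof -
        note SD = selfadjoint_subspaceD[OF S_selfadjoint]
        have m: "scaleC (-1) s \<in> S" by (rule SD(4)[OF s])
        have d: "s' - s \<in> S" using SD(6)[OF s'S m] by simp
        have "\<phi> x (s' + scaleC (-1) s) v = sub (\<phi> x s' v) (\<phi> x s v)"
          using K(4)[OF s'S v m] K(5)[OF s v, of "-1"] by (simp add: sub_def)
        hence "sub (\<phi> x s' v) (\<phi> x s v) = \<phi> x (s' - s) v" by simp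
        hence "hnorm (F x) (sub (\<phi> x s' v) (\<phi> x s v)) \<le> norm (s' - s) * hnorm (F x) v"
          using ucp_contractive[OF fiber_ucp(1,2)[OF x] S_selfadjoint d v] by simp
        also have "\<dots> \<le> e * hnorm (F x) v"
          using s'(2) hnorm_nonneg[OF v] by (intro mult_right_mono) auto
        finally show ?thesis .
      qed
      ultimately show "hnorm (F x) (sub (\<rho> s v) (\<phi> x s v)) \<le> e * (2 * hnorm (F x) v)" by simp
    qed
  qed
  hence "cp_extension S (F x) (\<phi> x) \<rho>" using representation_cp[OF \<rho>(1)] by (simp add: cp_extension_def)
  with \<rho>(1) agree show ?thesis using that by blast
qed

text \<open>Outside a null set, the contractivity estimates and the bounds on extensions hold for all members of the
countable algebra and all sections of the dense sequence. The former give a representation \<open>\<rho>\<close> extending \<open>\<phi> x\<close>, the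
latter \<open>Re \<langle>\<psi>(a) v, w\<rangle> \<le> Re \<langle>\<rho>(a) v, w\<rangle>\<close> on dense sets, hence everywhere; replacing \<open>w\<close> by \<open>- w\<close> gives
equality.\<close>

theorem almost_every_fiber:
  "AE x in \<mu>. unique_extension_property S (F x) (\<phi> x)"
proof -
  obtain S0 where S0: "countable S0" "S0 \<subseteq> S" "S \<subseteq> closure S0" "1 \<in> S0" "\<And>s. s \<in> S0 \<Longrightarrow> star s \<in> S0"
    by (rule countable_generators) (rule that)
  note cA = countable_fields[OF S0(1)]
  obtain e :: "nat \<Rightarrow> 'x \<Rightarrow> 'h" where e: "\<And>n. e n \<in> L2"
    and e_dense: "\<And>x v \<epsilon>. x \<in> space X \<Longrightarrow> v \<in> hcarrier (F x) \<Longrightarrow> \<epsilon> > 0 \<Longrightarrow> \<exists>n. hnorm (F x) (pre_hilbert_space.sub (F x) v (e n x)) < \<epsilon>"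
    by (rule dense_L2_sections) (rule that)
  have e_seq: "\<exists>r. (\<lambda>k. hnorm (F x) (pre_hilbert_space.sub (F x) (e (r k) x) v)) \<longlonglongrightarrow> 0"
    if x: "x \<in> space X" and v: "v \<in> hcarrier (F x)" for x v
  proof -
    interpret hilbert_space "F x" by (rule fiber_hilbert_space[OF x])
    have "\<exists>n. hnorm (F x) (sub v (e n x)) < (1/2)^k" for k :: nat by (rule e_dense[OF x v]) simp
    then obtain r where r: "\<And>k. hnorm (F x) (sub v (e (r k) x)) < (1/2)^k" by metis
    have ex: "e n x \<in> hcarrier (F x)" for n by (rule L2_in_fiber[OF e x])
    have "norm (hnorm (F x) (sub (e (r k) x) v)) \<le> (1/2)^k" for k
      using less_imp_le[OF r[of k]] sub_commute[OF ex v, of "r k"] hnorm_nonneg[OF sub_closed[OF ex v], of "r k"] by simp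
    hence "\<forall>\<^sub>F k in sequentially. norm (hnorm (F x) (sub (e (r k) x) v)) \<le> (1/2)^k"
      by (rule always_eventually[OF allI])
    moreover have "(\<lambda>k. (1/2)^k :: real) \<longlonglongrightarrow> 0" by (rule LIMSEQ_power_zero) simp
    ultimately have "(\<lambda>k. hnorm (F x) (sub (e (r k) x) v)) \<longlonglongrightarrow> 0" by (rule Lim_null_comparison)
    thus ?thesis by blast
  qed
  have "AE x in \<mu>. \<forall>p\<in>fields_over S0. \<forall>n. hnorm (F x) (snd p x (e n x)) \<le> norm (fst p) * hnorm (F x) (e n x)"
    unfolding AE_ball_countable[OF cA] AE_all_countable
    using decomposes_bound[OF fields_decompose[OF S0(2)] e] by (metis prod.collapse)
  hence good: "AE x in \<mu>. x \<in> space X \<and> (\<exists>\<rho>. representation (F x) \<rho> \<and> cp_extension S (F x) (\<phi> x) \<rho> \<and>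
      (\<forall>a T. (a, T) \<in> fields_over S0 \<longrightarrow> (\<forall>v\<in>hcarrier (F x). \<rho> a v = T x v)))"
    using AE_space[of \<mu>]
  proof eventually_elim
    case (elim x)
    hence x: "x \<in> space X" by (simp add: space_eq)
    interpret hilbert_space "F x" by (rule fiber_hilbert_space[OF x])
    have ex: "e n x \<in> hcarrier (F x)" for n by (rule L2_in_fiber[OF e x])
    have bound: "hnorm (F x) (T x v) \<le> norm a * hnorm (F x) v"
      if aT: "(a, T) \<in> fields_over S0" and v: "v \<in> hcarrier (F x)" for a T v
    proof -
      note tb = bounded_operatorsD[OF decomposesD(1)[OF fields_decompose[OF S0(2) aT] x]]
      obtain K where K: "K \<ge> 0" "\<And>v. v \<in> hcarrier (F x) \<Longrightarrow> hnorm (F x) (T x v) \<le> K * hnorm (F x) v" using tb(4) by blast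
      obtain r where r: "(\<lambda>k. hnorm (F x) (sub (e (r k) x) v)) \<longlonglongrightarrow> 0" using e_seq[OF x v] by blast
      have "hnorm (F x) (T x v) \<le> norm a * hnorm (F x) v + (norm a + K) * hnorm (F x) (sub (e (r k) x) v)" for k
      proof -
        define u where "u = e (r k) x"
        have u: "u \<in> hcarrier (F x)" by (simp add: u_def ex)
        have "T x v = sub (T x u) (T x (sub u v))"
          by (rule eq_by_ip) (use tb(1-3) u v in \<open>auto simp: sub_def ips scale_closed simp del: fiber_simps\<close>)
        hence h1: "hnorm (F x) (T x v) \<le> hnorm (F x) (T x u) + hnorm (F x) (T x (sub u v))"
          using hnorm_sub_diff[OF tb(1)[OF v] tb(1)[OF u]] sub_triangle[OF tb(1)[OF u] zero_closed tb(1)[OF sub_closed[OF u v]]]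
            hnorm_triangle[OF tb(1)[OF u] scale_closed[OF tb(1)[OF sub_closed[OF u v]]], of "-1"]
            hnorm_scale[OF tb(1)[OF sub_closed[OF u v]], of "-1"] by (simp add: sub_def)
        have h2: "hnorm (F x) (T x u) \<le> norm a * hnorm (F x) u"
          using elim(1) aT unfolding u_def by force
        have h3: "hnorm (F x) u \<le> hnorm (F x) v + hnorm (F x) (sub u v)"
          using hnorm_sub_diff[OF u v] by linarith
        have h4: "hnorm (F x) (T x (sub u v)) \<le> K * hnorm (F x) (sub u v)" by (rule K(2)[OF sub_closed[OF u v]])
        have "norm a * hnorm (F x) u \<le> norm a * hnorm (F x) v + norm a * hnorm (F x) (sub u v)"
          using mult_left_mono[OF h3 norm_ge_zero[of a]] by (simp only: distrib_left)
        with h1 h2 h4 show ?thesis by (simp add: u_def distrib_right)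
      qed
      moreover have "(\<lambda>k. norm a * hnorm (F x) v + (norm a + K) * hnorm (F x) (sub (e (r k) x) v)) \<longlonglongrightarrow> norm a * hnorm (F x) v + (norm a + K) * 0"
        by (intro tendsto_intros r)
      ultimately have "hnorm (F x) (T x v) \<le> norm a * hnorm (F x) v + (norm a + K) * 0"
        by (intro LIMSEQ_le_const) auto
      thus ?thesis by simp
    qed
    show ?case
    proof (rule fiber_representation[of x S0, OF x S0(2,3,4)])
      show "star s \<in> S0" if "s \<in> S0" for s by (rule S0(5)[OF that])
      show "hnorm (F x) (T x v) \<le> norm a * hnorm (F x) v"
        if "(a, T) \<in> fields_over S0" "v \<in> hcarrier (F x)" for a T v by (rule bound[OF that])
    next
      fix \<rho> assume \<rho>: "representation (F x) \<rho>" "cp_extension S (F x) (\<phi> x) \<rho>"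
        "\<And>a T v. (a, T) \<in> fields_over S0 \<Longrightarrow> v \<in> hcarrier (F x) \<Longrightarrow> \<rho> a v = T x v"
      show "x \<in> space X \<and> (\<exists>\<rho>. representation (F x) \<rho> \<and> cp_extension S (F x) (\<phi> x) \<rho> \<and>
          (\<forall>a T. (a, T) \<in> fields_over S0 \<longrightarrow> (\<forall>v\<in>hcarrier (F x). \<rho> a v = T x v)))"
        by (intro conjI x exI[of _ \<rho>] \<rho>(1,2)) (simp add: \<rho>(3))
    qed
  qed
  have "AE x in \<mu>. \<forall>p\<in>fields_over S0. \<forall>m n. \<forall>\<psi>. cp_extension S (F x) (\<phi> x) \<psi> \<longrightarrow>
      Re (bip B (\<psi> (fst p) (e m x)) (e n x)) \<le> Re (bip B (snd p x (e m x)) (e n x))"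
    unfolding AE_ball_countable[OF cA] AE_all_countable
  proof (intro ballI allI)
    fix p m n assume p: "p \<in> fields_over S0"
    hence p': "(fst p, snd p) \<in> fields_over S0" by simp
    have "AE x in \<mu>. \<exists>\<rho>. cp_extension S (F x) (\<phi> x) \<rho> \<and> (\<forall>v\<in>hcarrier (F x). \<rho> (fst p) v = snd p x v)"
      using good by eventually_elim (use p' in blast)
    thus "AE x in \<mu>. \<forall>\<psi>. cp_extension S (F x) (\<phi> x) \<psi> \<longrightarrow>
        Re (bip B (\<psi> (fst p) (e m x)) (e n x)) \<le> Re (bip B (snd p x (e m x)) (e n x))"
      by (rule fiber_extension_bound[OF fields_decompose[OF S0(2) p'] e e])
  qed
  with good show ?thesis
  proof eventually_elim
    case (elim x)
    then obtain \<rho> where x: "x \<in> space X" and \<rho>: "representation (F x) \<rho>" "cp_extension S (F x) (\<phi> x) \<rho>"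
      "\<And>a T v. (a, T) \<in> fields_over S0 \<Longrightarrow> v \<in> hcarrier (F x) \<Longrightarrow> \<rho> a v = T x v" by blast
    interpret hilbert_space "F x" by (rule fiber_hilbert_space[OF x])
    have ex: "e n x \<in> hcarrier (F x)" for n by (rule L2_in_fiber[OF e x])
    have uniq: "\<psi> = \<rho>" if ext: "cp_extension S (F x) (\<phi> x) \<psi>" for \<psi>
    proof -
      note cp\<psi> = extension_is_ucp[OF x ext] and cp\<rho> = extension_is_ucp[OF x \<rho>(2)]
      have lin: "operator_linear_on UNIV (F x) \<psi>" "operator_linear_on UNIV (F x) \<rho>"
        using cp\<psi>(1) cp\<rho>(1) by (simp_all add: cp_map_def)
      note L = operator_linear_onD[OF lin(1) UNIV_I] and K = operator_linear_onD[OF lin(2) UNIV_I]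
      note contr\<psi> = ucp_contractive[OF cp\<psi>(1,2) selfadjoint_subspace_UNIV UNIV_I]
        and contr\<rho> = ucp_contractive[OF cp\<rho>(1,2) selfadjoint_subspace_UNIV UNIV_I]
      have op_lim: "(\<lambda>k. hnorm (F x) (sub (\<omega> a (u k)) (\<omega> a v))) \<longlonglongrightarrow> 0"
        if \<omega>: "cp_map UNIV (F x) \<omega>" "\<omega> 1 = (\<lambda>v\<in>hcarrier (F x). v)"
          and u: "\<And>k::nat. u k \<in> hcarrier (F x)" "v \<in> hcarrier (F x)" "(\<lambda>k. hnorm (F x) (sub (u k) v)) \<longlonglongrightarrow> 0"
        for \<omega> a u v
      proof -
        have \<omega>l: "operator_linear_on UNIV (F x) \<omega>" using \<omega>(1) by (simp add: cp_map_def)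
        have "norm (hnorm (F x) (sub (\<omega> a (u k)) (\<omega> a v))) \<le> norm a * hnorm (F x) (sub (u k) v)" for k
          using ucp_contractive[OF \<omega> selfadjoint_subspace_UNIV UNIV_I sub_closed[OF u(1)[of k] u(2)], of a]
            hnorm_nonneg[OF sub_closed[OF operator_linear_onD(1)[OF \<omega>l UNIV_I u(1)[of k]] operator_linear_onD(1)[OF \<omega>l UNIV_I u(2)]], of a a]
          unfolding operator_linear_sub[OF \<omega>l UNIV_I u(1)[of k] u(2)] by simp
        hence "\<forall>\<^sub>F k in sequentially. norm (hnorm (F x) (sub (\<omega> a (u k)) (\<omega> a v))) \<le> norm a * hnorm (F x) (sub (u k) v)"
          by (rule always_eventually[OF allI])
        thus ?thesis by (rule Lim_null_comparison[OF _ tendsto_mult_right_zero[OF u(3)]])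
      qed
      have dense_eq: "\<psi> a v = \<rho> a v" if a: "a \<in> fst ` fields_over S0" and v: "v \<in> hcarrier (F x)" for a v
      proof -
        obtain T where aT: "(a, T) \<in> fields_over S0" using a by force
        have le: "Re (hip (F x) (\<psi> a v) w) \<le> Re (hip (F x) (\<rho> a v) w)" if w: "w \<in> hcarrier (F x)" for w
        proof -
          obtain r where r: "(\<lambda>k. hnorm (F x) (sub (e (r k) x) v)) \<longlonglongrightarrow> 0" using e_seq[OF x v] by blast
          obtain s where s: "(\<lambda>k. hnorm (F x) (sub (e (s k) x) w)) \<longlonglongrightarrow> 0" using e_seq[OF x w] by blast
          have "(\<lambda>k. hip (F x) (\<psi> a (e (r k) x)) (e (s k) x)) \<longlonglongrightarrow> hip (F x) (\<psi> a v) w"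
            by (rule ip_tendsto[OF L(1)[OF ex] L(1)[OF v] op_lim[OF cp\<psi>(1,2) ex v r] ex w s])
          moreover have "(\<lambda>k. hip (F x) (\<rho> a (e (r k) x)) (e (s k) x)) \<longlonglongrightarrow> hip (F x) (\<rho> a v) w"
            by (rule ip_tendsto[OF K(1)[OF ex] K(1)[OF v] op_lim[OF cp\<rho>(1,2) ex v r] ex w s])
          moreover have "Re (hip (F x) (\<psi> a (e (r k) x)) (e (s k) x)) \<le> Re (hip (F x) (\<rho> a (e (r k) x)) (e (s k) x))" for k
          proof -
            have "\<forall>m n. \<forall>\<psi>. cp_extension S (F x) (\<phi> x) \<psi> \<longrightarrow>
              Re (bip B (\<psi> (fst (a, T)) (e m x)) (e n x)) \<le> Re (bip B (snd (a, T) x (e m x)) (e n x))"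
              using elim(2) aT by (rule bspec)
            thus ?thesis using ext \<rho>(3)[OF aT ex, of "r k"] by simp
          qed
          ultimately show ?thesis by (intro LIMSEQ_le[OF tendsto_Re tendsto_Re]) auto
        qed
        show ?thesis
        proof (rule eq_real_ip[OF L(1)[OF v] K(1)[OF v]])
          fix w assume w: "w \<in> hcarrier (F x)"
          have "Re (hip (F x) (\<psi> a v) (hscale (F x) (-1) w)) \<le> Re (hip (F x) (\<rho> a v) (hscale (F x) (-1) w))"
            by (rule le[OF scale_closed[OF w]])
          hence "Re (hip (F x) (\<rho> a v) w) \<le> Re (hip (F x) (\<psi> a v) w)"
            unfolding ip_scale_right[OF L(1)[OF v] w] ip_scale_right[OF K(1)[OF v] w] by simp
          with le[OF w] show "Re (hip (F x) (\<psi> a v) w) = Re (hip (F x) (\<rho> a v) w)" by (rule antisym)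
        qed
      qed
      have eq: "\<psi> a v = \<rho> a v" if v: "v \<in> hcarrier (F x)" for a v
      proof (rule eq_if_sub_le[OF L(1)[OF v] K(1)[OF v]])
        fix \<epsilon> :: real assume \<epsilon>: "\<epsilon> > 0"
        have "S0 \<noteq> {}" using S0(4) by blast
        hence "a \<in> closure (fst ` fields_over S0)" using fields_dense[OF S0(3,5,2)] by simp
        hence "\<forall>e>0. \<exists>y\<in>fst ` fields_over S0. dist y a < e" by (simp only: closure_approachable)
        then obtain b where b: "b \<in> fst ` fields_over S0" "norm (b - a) < \<epsilon>" using \<epsilon> unfolding dist_norm by blast
        have diff: "hnorm (F x) (sub (\<omega> a v) (\<omega> b v)) \<le> \<epsilon> * hnorm (F x) v"
          if \<omega>: "cp_map UNIV (F x) \<omega>" "\<omega> 1 = (\<lambda>v\<in>hcarrier (F x). v)" for \<omega>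
        proof -
          have \<omega>l: "operator_linear_on UNIV (F x) \<omega>" using \<omega>(1) by (simp add: cp_map_def)
          have "\<omega> (a + scaleC (-1) b) v = sub (\<omega> a v) (\<omega> b v)"
            using operator_linear_onD(4)[OF \<omega>l UNIV_I v UNIV_I, of a "scaleC (-1) b"] operator_linear_onD(5)[OF \<omega>l UNIV_I v, of "-1" b]
            by (simp add: sub_def)
          hence "sub (\<omega> a v) (\<omega> b v) = \<omega> (a - b) v" by simp
          hence "hnorm (F x) (sub (\<omega> a v) (\<omega> b v)) \<le> norm (a - b) * hnorm (F x) v"
            using ucp_contractive[OF \<omega> selfadjoint_subspace_UNIV UNIV_I v, of "a - b"] by simp
          also have "\<dots> \<le> \<epsilon> * hnorm (F x) v"
            using b(2) hnorm_nonneg[OF v] by (intro mult_right_mono) (auto simp: norm_minus_commute)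
          finally show ?thesis .
        qed
        have "hnorm (F x) (sub (\<psi> a v) (\<rho> a v)) \<le> hnorm (F x) (sub (\<psi> a v) (\<psi> b v)) + hnorm (F x) (sub (\<psi> b v) (\<rho> a v))"
          by (rule sub_triangle[OF L(1)[OF v] L(1)[OF v] K(1)[OF v]])
        also have "hnorm (F x) (sub (\<psi> b v) (\<rho> a v)) = hnorm (F x) (sub (\<rho> a v) (\<rho> b v))"
          unfolding dense_eq[OF b(1) v] by (rule sub_commute[OF K(1)[OF v] K(1)[OF v]])
        finally show "hnorm (F x) (sub (\<psi> a v) (\<rho> a v)) \<le> \<epsilon> * (2 * hnorm (F x) v)"
          using diff[OF cp\<psi>(1,2)] diff[OF cp\<rho>(1,2)] by simp
      qed
      show ?thesis
      proof (rule HOL.ext)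
        fix a
        show "\<psi> a = \<rho> a"
          by (rule extensionalityI[OF L(6)[OF zero_closed] K(6)[OF zero_closed] eq])
      qed
    qed
    have "(THE \<psi>. cp_extension S (F x) (\<phi> x) \<psi>) = \<rho>" by (rule the_equality) (fact \<rho>(2), rule uniq)
    moreover have "\<exists>!\<psi>. cp_extension S (F x) (\<phi> x) \<psi>" by (rule ex1I) (fact \<rho>(2), rule uniq)
    ultimately show ?case unfolding unique_extension_property_def using \<rho>(1) by simp
  qed
qed

end

theorem theorem6p1:
  fixes S :: "'a::unital_cstar_algebra set"
    and X \<mu> :: "'x measure"
    and B :: "('x, 'h) hilbert_bundle"
    and \<phi> :: "'x \<Rightarrow> 'a \<Rightarrow> 'h \<Rightarrow> 'h"
  assumes "separable_operator_system S"
    and "standard_borel_space X"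
    and "standard_hilbert_bundle X B"
    and "ucp_family X B S \<phi>"
    and "sets \<mu> = sets X" and "prob_space \<mu>"
    and "unique_extension_property S (direct_integral \<mu> B) (direct_integral_map \<mu> B \<phi>)"
  shows "\<exists>N\<in>sets X. emeasure \<mu> N = 0 \<and>
           (\<forall>x\<in>space X - N. unique_extension_property S (fiber B x) (\<phi> x))"
proof -
  let ?D = "direct_integral \<mu> B" and ?\<Phi> = "direct_integral_map \<mu> B \<phi>"
  define \<pi> where "\<pi> = (THE \<psi>. cp_extension S ?D ?\<Phi> \<psi>)"
  have ex1: "\<exists>!\<psi>. cp_extension S ?D ?\<Phi> \<psi>" and rep: "representation ?D \<pi>"
    using assms(7) by (auto simp: unique_extension_property_def \<pi>_def)
  have ext: "cp_extension S ?D ?\<Phi> \<pi>" unfolding \<pi>_def by (rule theI'[OF ex1])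
  interpret direct_integral_extension X B \<mu> S \<phi> \<pi>
  proof (intro direct_integral_extension.intro hilbert_bundle_measure.intro
      hilbert_bundle_measure_axioms.intro direct_integral_extension_axioms.intro assms rep)
    show "\<pi> s = ?\<Phi> s" if "s \<in> S" for s using ext that by (simp add: cp_extension_def)
    show "\<psi> = \<pi>" if "cp_extension S ?D ?\<Phi> \<psi>" for \<psi> using ex1 ext that by blast
  qed
  obtain N where N: "{x \<in> space \<mu>. \<not> unique_extension_property S (fiber B x) (\<phi> x)} \<subseteq> N"
      "emeasure \<mu> N = 0" "N \<in> sets \<mu>"
    using almost_every_fiber by (rule AE_E)
  show ?thesis
  proof (intro bexI[of _ N] conjI ballI)
    show "N \<in> sets X" using N(3) assms(5) by simp
    show "emeasure \<mu> N = 0" by (rule N(2))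
    show "unique_extension_property S (fiber B x) (\<phi> x)" if "x \<in> space X - N" for x
      using N(1) that space_eq by blast
  qed
qed

end
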